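(* A map $\operatorname{z}\colon\operatorname{Conv}_{\mathrm{sc}}(\mathbb{R}^n)\to\mathbb{R}^n$ is a continuous, epi-translation invariant valuation that is epi-homogeneous of degree $n$ if and only if there exists $\psi\in C_c(\mathbb{R}^n;\mathbb{R}^n)$ such that $\operatorname{z}(u)=\int_{\operatorname{dom}(u)}\psi(\nabla u(x))\,\mathrm{d}x$ for every $u\in\operatorname{Conv}_{\mathrm{sc}}(\mathbb{R}^n)$. For $n\geq3$, such a $\operatorname{z}$ is in addition rotation equivariant if and only if there exists $\xi\in C_b((0,\infty))$ with $\lim_{t\to0^+}\xi(t)t=0$ such that $\operatorname{z}=\operatorname{t}_{n,\xi}$. For $n\in\{1,2\}$ the same holds with rotation equivariance replaced by $\operatorname{O}(n)$ equivariance.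
   Context: $\operatorname{Conv}_{\mathrm{sc}}(\mathbb{R}^n)$ is the space of proper, lower semicontinuous, convex $u\colon\mathbb{R}^n\to(-\infty,\infty]$ with $\lim_{|x|\to\infty}u(x)/|x|=\infty$, with the topology of epi-convergence; $\operatorname{dom}(u)=\{u<\infty\}$. Valuation: $\operatorname{z}(u\vee w)+\operatorname{z}(u\wedge w)=\operatorname{z}(u)+\operatorname{z}(w)$ whenever $u,w$ and their pointwise max/min lie in the space. Epi-translation invariant: $\operatorname{z}(u\circ\tau_x^{-1}+c)=\operatorname{z}(u)$ for all $x\in\mathbb{R}^n$, $c\in\mathbb{R}$, where $\tau_x(y)=y+x$. Epi-homogeneous of degree $s$: $\operatorname{z}(\lambda\,\square\, u)=\lambda^s\operatorname{z}(u)$ for $\lambda>0$, where $(\lambda\,\square\,u)(x)=\lambda u(x/\lambda)$. Rotation equivariant: $\operatorname{z}(u\circ\vartheta^{-1})=\vartheta\operatorname{z}(u)$ for $\vartheta\in\operatorname{SO}(n)$; $\operatorname{O}(n)$ equivariant analogously. $C_b((0,\infty))$: continuous functions with bounded support in $(0,\infty)$. $\operatorname{t}_{n,\xi}(u)=\int_{\operatorname{dom}(u)}\xi(|\nabla u(x)|)\nabla u(x)\,\mathrm{d}x$ with $y\mapsto\xi(|y|)y$ extended by $o$ at $y=o$. *)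

theory Defs
  imports "HOL-Analysis.Analysis"
begin

definition dom_fun :: "('a \<Rightarrow> ereal) \<Rightarrow> 'a set" where
  "dom_fun u = {x. u x < \<infinity>}"

definition proper_fun :: "('a \<Rightarrow> ereal) \<Rightarrow> bool" where
  "proper_fun u \<longleftrightarrow> (\<exists>x. u x < \<infinity>) \<and> (\<forall>x. u x \<noteq> -\<infinity>)"

definition lsc_fun :: "('a::topological_space \<Rightarrow> ereal) \<Rightarrow> bool" where
  "lsc_fun u \<longleftrightarrow> (\<forall>t::real. closed {x. u x \<le> ereal t})"

definition convex_fun :: "('a::real_vector \<Rightarrow> ereal) \<Rightarrow> bool" where
  "convex_fun u \<longleftrightarrow> convex (dom_fun u) \<and> convex_on (dom_fun u) (\<lambda>x. real_of_ereal (u x))"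

definition super_coercive :: "('a::real_normed_vector \<Rightarrow> ereal) \<Rightarrow> bool" where
  "super_coercive u \<longleftrightarrow> ((\<lambda>x. u x / ereal (norm x)) \<longlongrightarrow> \<infinity>) at_infinity"

definition Conv_sc :: "('n::finite) itself \<Rightarrow> (real^'n \<Rightarrow> ereal) set" where
  "Conv_sc _ = {u. proper_fun u \<and> lsc_fun u \<and> convex_fun u \<and> super_coercive u}"

definition epi_converges :: "(nat \<Rightarrow> 'a::metric_space \<Rightarrow> ereal) \<Rightarrow> ('a \<Rightarrow> ereal) \<Rightarrow> bool" where
  "epi_converges us u \<longleftrightarrow>
     (\<forall>x. (\<forall>xs. xs \<longlonglongrightarrow> x \<longrightarrow> u x \<le> liminf (\<lambda>k. us k (xs k))) \<and>
          (\<exists>xs. xs \<longlonglongrightarrow> x \<and> (\<lambda>k. us k (xs k)) \<longlonglongrightarrow> u x))"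

definition epi_continuous :: "(real^'n \<Rightarrow> ereal) set \<Rightarrow> ((real^'n \<Rightarrow> ereal) \<Rightarrow> 'b::topological_space) \<Rightarrow> bool" where
  "epi_continuous C z \<longleftrightarrow>
     (\<forall>us u. (\<forall>k. us k \<in> C) \<longrightarrow> u \<in> C \<longrightarrow> epi_converges us u \<longrightarrow> (\<lambda>k. z (us k)) \<longlonglongrightarrow> z u)"

definition is_valuation :: "(real^'n \<Rightarrow> ereal) set \<Rightarrow> ((real^'n \<Rightarrow> ereal) \<Rightarrow> 'b::ab_group_add) \<Rightarrow> bool" where
  "is_valuation C z \<longleftrightarrow>
     (\<forall>u\<in>C. \<forall>w\<in>C. (\<lambda>x. max (u x) (w x)) \<in> C \<longrightarrow> (\<lambda>x. min (u x) (w x)) \<in> C \<longrightarrow>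
        z (\<lambda>x. max (u x) (w x)) + z (\<lambda>x. min (u x) (w x)) = z u + z w)"

definition epi_translation_invariant :: "(real^'n \<Rightarrow> ereal) set \<Rightarrow> ((real^'n \<Rightarrow> ereal) \<Rightarrow> 'b) \<Rightarrow> bool" where
  "epi_translation_invariant C z \<longleftrightarrow>
     (\<forall>u\<in>C. \<forall>x0 (c::real). z (\<lambda>y. u (y - x0) + ereal c) = z u)"

definition epi_mult :: "real \<Rightarrow> ('a::real_vector \<Rightarrow> ereal) \<Rightarrow> 'a \<Rightarrow> ereal" where
  "epi_mult l u = (\<lambda>x. ereal l * u (x /\<^sub>R l))"

definition epi_homogeneous :: "(real^'n \<Rightarrow> ereal) set \<Rightarrow> real \<Rightarrow> ((real^'n \<Rightarrow> ereal) \<Rightarrow> 'b::real_vector) \<Rightarrow> bool" where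
  "epi_homogeneous C s z \<longleftrightarrow> (\<forall>u\<in>C. \<forall>l>0. z (epi_mult l u) = l powr s *\<^sub>R z u)"

definition SO_matrices :: "(real^'n^'n) set" where
  "SO_matrices = {A. orthogonal_matrix A \<and> det A = 1}"

definition O_matrices :: "(real^'n^'n) set" where
  "O_matrices = {A. orthogonal_matrix A}"

definition equivariant :: "(real^'n^'n) set \<Rightarrow> (real^'n \<Rightarrow> ereal) set \<Rightarrow> ((real^'n \<Rightarrow> ereal) \<Rightarrow> real^'n) \<Rightarrow> bool" where
  "equivariant G C z \<longleftrightarrow> (\<forall>u\<in>C. \<forall>A\<in>G. z (\<lambda>x. u (matrix_inv A *v x)) = A *v z u)"

text \<open>Gradient of u at x (where u is finite near x and differentiable); o elsewhere
  (the exceptional set is Lebesgue-null within dom u for u in Conv_sc).\<close>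
definition grad :: "(real^'n \<Rightarrow> ereal) \<Rightarrow> real^'n \<Rightarrow> real^'n" where
  "grad u x = (if x \<in> interior (dom_fun u) \<and>
                  (\<exists>g. ((\<lambda>y. real_of_ereal (u y)) has_derivative (\<lambda>h. g \<bullet> h)) (at x))
               then (SOME g. ((\<lambda>y. real_of_ereal (u y)) has_derivative (\<lambda>h. g \<bullet> h)) (at x))
               else 0)"

definition Cc :: "('a::real_normed_vector \<Rightarrow> 'b::real_normed_vector) \<Rightarrow> bool" where
  "Cc f \<longleftrightarrow> continuous_on UNIV f \<and> compact (closure {x. f x \<noteq> 0})"

definition Cb_pos :: "(real \<Rightarrow> real) \<Rightarrow> bool" where
  "Cb_pos \<xi> \<longleftrightarrow> continuous_on {0<..} \<xi> \<and> (\<exists>b. \<forall>t>b. \<xi> t = 0)"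

definition t_op :: "(real \<Rightarrow> real) \<Rightarrow> (real^'n \<Rightarrow> ereal) \<Rightarrow> real^'n" where
  "t_op \<xi> u = (LINT x : dom_fun u | lebesgue.
                  (if grad u x = 0 then 0 else \<xi> (norm (grad u x)) *\<^sub>R grad u x))"

definition grad_integral :: "(real^'n \<Rightarrow> real^'n) \<Rightarrow> (real^'n \<Rightarrow> ereal) \<Rightarrow> real^'n" where
  "grad_integral \<psi> u = (LINT x : dom_fun u | lebesgue. \<psi> (grad u x))"

definition top_degree_valuation :: "'n itself \<Rightarrow> ((real^'n \<Rightarrow> ereal) \<Rightarrow> real^'n) \<Rightarrow> bool" where
  "top_degree_valuation T z \<longleftrightarrow>
     epi_continuous (Conv_sc T) z \<and> is_valuation (Conv_sc T) z \<and>
     epi_translation_invariant (Conv_sc T) z \<and> epi_homogeneous (Conv_sc T) (real CARD('n)) z"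

end

theory Submission
  imports Defs "HOL-Complex_Analysis.Great_Picard"
begin

text \<open>
  For \<open>\<psi>\<close> in \<open>Cc\<close> the functional \<open>u \<mapsto> \<integral> \<psi>(\<nabla>u)\<close> is continuous because the gradients of an
  epi-convergent sequence converge almost everywhere on the domain of the limit, while they are
  uniformly large far out and tend to infinity off the domain, where \<open>\<psi>\<close> vanishes.

  Conversely put \<open>\<psi>(y) = z(\<langle>y, \<cdot>\<rangle> + I)\<close>, where \<open>I\<close> is the indicator of the unit cube. By homogeneity
  \<open>z\<close> vanishes on functions over degenerate boxes, so it is additive under subdivision of boxes.
  For convex Lipschitz \<open>f\<close> and a box cut into cells of side \<open>1/N\<close>, homogeneity and invariance turn the
  contribution of a cell into \<open>N\<^sup>-\<^sup>n\<close> times \<open>z\<close> at the blow-up of \<open>f\<close> on that cell. These blow-ups converge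
  to \<open>\<langle>\<nabla>f(x), \<cdot>\<rangle>\<close> at every point \<open>x\<close> of differentiability, and dominated convergence gives
  \<open>z(f + I\<^sub>B) = \<integral>\<^sub>B \<psi>(\<nabla>f)\<close>; no approximation by piecewise affine functions is needed. Restrictions of
  Lipschitz regularizations to growing cubes approximate a general \<open>u\<close>.

  Since \<open>z(\<langle>y, \<cdot>\<rangle> + I\<^sub>K) = |K| \<psi>(y)\<close>, equivariance of \<open>z\<close> amounts to equivariance of \<open>\<psi>\<close>, which forces
  \<open>\<psi>(y) = \<xi>(|y|) y\<close> as soon as the group is transitive on spheres and contains, for \<open>w\<close> orthogonal
  to \<open>y\<close>, an element fixing \<open>y\<close> and reversing \<open>w\<close>.
\<close>

section \<open>Differentiability of convex functions\<close>

text \<open>No size estimate for \<open>z\<close> is given, so every bound comes from compactness: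
  convex functions with a fixed Lipschitz constant over a fixed box, normalized to vanish at its
  corner, form a family on which continuity makes \<open>z\<close> bounded. Homogeneity of degree n
  scales this to a bound proportional to the volume of small similar cells. The same bound makes
  \<open>z\<close> vanish on degenerate boxes, which consist of too few cells, and provides the
  dominating constant for the passage to the limit. It is also the reason for regularizing u to
  Lipschitz functions first. On the way from \<open>z\<close> to its density the valuation property
  enters only through cuts of a box by coordinate hyperplanes.

  The case distinction on the dimension comes from maps that commute with rotations: in the plane a
  quarter-turn J commutes with all of them, so \<xi>(|y|) J y is SO(2) equivariant as well, and
  SO(1) is trivial. Reflections exclude such densities; from dimension 3 on, a half-turn that fixes
  y does the same.\<close>

lemma convex_on_slope_le:
  assumes "convex_on S f" "x \<in> S" "x + d *\<^sub>R v \<in> S" "0 < h" "h \<le> (d::real)"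
  shows "d * (f (x + h *\<^sub>R v) - f x) \<le> h * (f (x + d *\<^sub>R v) - f x)"
proof -
  have "f ((1 - h/d) *\<^sub>R x + (h/d) *\<^sub>R (x + d *\<^sub>R v)) \<le> (1 - h/d) * f x + (h/d) * f (x + d *\<^sub>R v)"
    using assms by (intro convex_onD[OF assms(1)]) auto
  moreover have "(1 - h/d) *\<^sub>R x + (h/d) *\<^sub>R (x + d *\<^sub>R v) = x + h *\<^sub>R v"
    using assms by (simp add: algebra_simps)
  ultimately show ?thesis using assms by (simp add: field_simps)
qed

text \<open>The point \<open>x\<close> is the convex combination of the two outer points with
  weights h/(h+d) and d/(h+d), so a backward slope never exceeds a forward one.\<close>

lemma convex_on_slope_ge:
  assumes "convex_on S f" "x - d *\<^sub>R v \<in> S" "x + h *\<^sub>R v \<in> S" "0 < h" "0 < (d::real)"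
  shows "h * (f x - f (x - d *\<^sub>R v)) \<le> d * (f (x + h *\<^sub>R v) - f x)"
proof -
  have "f ((1 - d/(h+d)) *\<^sub>R (x - d *\<^sub>R v) + (d/(h+d)) *\<^sub>R (x + h *\<^sub>R v))
     \<le> (1 - d/(h+d)) * f (x - d *\<^sub>R v) + (d/(h+d)) * f (x + h *\<^sub>R v)"
    using assms by (intro convex_onD[OF assms(1)]) auto
  moreover have "(1 - d/(h+d)) *\<^sub>R (x - d *\<^sub>R v) + (d/(h+d)) *\<^sub>R (x + h *\<^sub>R v)
      = x + (h * (d/(h+d)) - d * (1 - d/(h+d))) *\<^sub>R v"
    by (simp add: algebra_simps)
  moreover have "h * (d/(h+d)) - d * (1 - d/(h+d)) = 0"
    using assms by (simp add: field_simps)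
  moreover have "1 - d/(h+d) = h/(h+d)" using assms by (simp add: field_simps)
  ultimately have "f x \<le> h/(h+d) * f (x - d *\<^sub>R v) + (d/(h+d)) * f (x + h *\<^sub>R v)" by simp
  then have "f x \<le> (h * f (x - d *\<^sub>R v) + d * f (x + h *\<^sub>R v)) / (h + d)"
    by (simp add: add_divide_distrib)
  then have "(h+d) * f x \<le> h * f (x - d *\<^sub>R v) + d * f (x + h *\<^sub>R v)"
    using assms by (simp add: pos_le_divide_eq mult.commute)
  then show ?thesis by (simp add: algebra_simps)
qed

section \<open>Second differences and differentiability almost everywhere\<close>

lemma lborel_integral_translation:
  fixes f :: "'a::euclidean_space \<Rightarrow> 'b::{banach, second_countable_topology}"
  assumes "f \<in> borel_measurable borel"
  shows "(LINT x|lborel. f (t + x)) = (LINT x|lborel. f x)"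
proof -
  have "(LINT x|lborel. f x) = (LINT x|distr lborel borel ((+) t). f x)"
    by (simp add: lborel_distr_plus)
  also have "\<dots> = (LINT x|lborel. f (t + x))"
    using assms by (subst integral_distr) auto
  finally show ?thesis by simp
qed

text \<open>Only one step h per e is asked for: slopes of a convex function are monotone, so one
  good step controls all shorter ones. A single index of a subsequence that converges at x is
  therefore enough.\<close>

definition second_diff_small :: "'a::real_vector set \<Rightarrow> ('a \<Rightarrow> real) \<Rightarrow> 'a \<Rightarrow> 'a \<Rightarrow> bool" where
  "second_diff_small S f v x \<longleftrightarrow> (\<forall>e>0. \<exists>h>0. x + h *\<^sub>R v \<in> S \<and> x - h *\<^sub>R v \<in> S \<and>
      f (x + h *\<^sub>R v) + f (x - h *\<^sub>R v) - 2 * f x \<le> e * h)"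

text \<open>By translation invariance the integral of the second difference quotient over a box \<open>K\<close> is
  that of the first difference quotient against the difference of the indicators of \<open>K\<close> and of a
  small translate of \<open>K\<close>. This replaces the usual one-dimensional argument together with Fubini.\<close>

lemma AE_second_diff_small_cbox:
  fixes f :: "'a::euclidean_space \<Rightarrow> real"
  assumes S: "open S" and f: "convex_on S f" and K: "cbox a b \<subseteq> S"
  shows "AE x in lborel. x \<in> cbox a b \<longrightarrow> second_diff_small S f v x"
proof -
  define K where "K = cbox a b"
  have KS: "K \<subseteq> S" "compact K" using assms by (auto simp: K_def)
  obtain e where e: "e > 0" "(\<Union>x\<in>K. cball x e) \<subseteq> S"
    using compact_subset_open_imp_cball_epsilon_subset[OF KS(2) S KS(1)] by auto
  \<comment> \<open>A point one step away from K, moved once more by at most d, is at distance at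
    most 2 d |v| from K; this has to stay within e. The summand 1 covers v = 0.\<close>
  define d where "d = e / 2 / (norm v + 1)"
  have d: "d > 0" using e by (simp add: d_def add_nonneg_pos)
  have dv: "2 * (d * norm v) \<le> e"
  proof -
    have "norm v + 1 \<noteq> 0" using norm_ge_zero[of v] by linarith
    then have "2 * (d * norm v) = e * (norm v / (norm v + 1))" by (simp add: d_def field_simps)
    also have "\<dots> \<le> e * 1" using e by (intro mult_left_mono) (auto simp: divide_le_eq add_nonneg_pos)
    finally show ?thesis by simp
  qed
  define C where "C = (\<Union>x\<in>K. cball x e)"
  have C: "compact C" "C \<subseteq> S"
    using e compact_minkowski_sum_cball[OF KS(2), of e] by (auto simp: C_def)
  have Cin: "x + t *\<^sub>R v \<in> C" if "x \<in> K" "\<bar>t\<bar> \<le> 2 * d" for x t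
  proof -
    have "\<bar>t\<bar> * norm v \<le> 2 * d * norm v" using that by (intro mult_right_mono) auto
    then have "norm (t *\<^sub>R v) \<le> e" using dv by simp
    then show ?thesis unfolding C_def using that(1)
      by (intro UN_I[of x]) (auto simp: dist_norm)
  qed
  have contf: "continuous_on C f"
    using convex_on_continuous[OF S f] C continuous_on_subset by blast
  then obtain B where B: "\<And>x. x \<in> C \<Longrightarrow> \<bar>f x\<bar> \<le> B"
    using compact_imp_bounded[OF compact_continuous_image[OF _ C(1)]] by (force simp: bounded_iff)
  have B0: "0 \<le> B \<or> K = {}"
  proof (cases "K = {}")
    case False then obtain x where "x \<in> K" by auto
    then have "x \<in> C" using Cin[of x 0] d by auto
    then show ?thesis using B[of x] by linarith
  qed auto
  define F where "F = (\<lambda>x. indicator C x *\<^sub>R f x)"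
  have F: "F \<in> borel_measurable borel"
    unfolding F_def using contf C(1)
    by (intro borel_measurable_continuous_on_indicator borel_compact)
  have Fin: "F x = f x" if "x \<in> C" for x using that by (simp add: F_def)
  define h where "h = (\<lambda>k::nat. d / (real k + 1))"
  have h: "h k > 0" "h k \<le> d" for k using d by (auto simp: h_def field_simps)
  have h0: "h \<longlonglongrightarrow> 0"
    unfolding h_def by real_asymp
  define q where "q = (\<lambda>k x. (F (x + h k *\<^sub>R v) - F x) / h k)"
  have q[measurable]: "q k \<in> borel_measurable borel" for k
    unfolding q_def using F by measurable
  have Kb[measurable]: "K \<in> sets borel" by (simp add: K_def)
  have qb: "\<bar>q k x\<bar> \<le> 2 * B / d" if x: "x \<in> K \<or> x + h k *\<^sub>R v \<in> K" for k x
  proof -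
    have in1: "x + t *\<^sub>R v \<in> C" if "\<bar>t\<bar> \<le> d" for t
    proof (cases "x \<in> K")
      case True then show ?thesis using Cin[of x t] that d by auto
    next
      case False
      then have "x + h k *\<^sub>R v \<in> K" using x by auto
      from Cin[OF this, of "t - h k"] show ?thesis using that h[of k] by (simp add: algebra_simps)
    qed
    have i: "x \<in> C" "x + h k *\<^sub>R v \<in> C" "x + d *\<^sub>R v \<in> C" "x - d *\<^sub>R v \<in> C"
      using in1[of 0] in1[of "h k"] in1[of d] in1[of "-d"] h[of k] d by auto
    have Cc: "\<And>y. y \<in> C \<Longrightarrow> y \<in> S" using C by auto
    have 1: "d * (f (x + h k *\<^sub>R v) - f x) \<le> h k * (f (x + d *\<^sub>R v) - f x)"
      using convex_on_slope_le[OF f Cc[OF i(1)] Cc[OF i(3)] h(1)[of k] h(2)[of k]] .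
    have 2: "h k * (f x - f (x - d *\<^sub>R v)) \<le> d * (f (x + h k *\<^sub>R v) - f x)"
      using convex_on_slope_ge[OF f Cc[OF i(4)] Cc[OF i(2)] h(1)[of k] d] .
    have b1: "h k * (f (x + d *\<^sub>R v) - f x) \<le> h k * (2*B)" "h k * (-(2*B)) \<le> h k * (f x - f (x - d *\<^sub>R v))"
      using B[OF i(1)] B[OF i(3)] B[OF i(4)] h(1)[of k]
      by (simp_all only: mult_le_cancel_left_pos)
    have "d * (f (x + h k *\<^sub>R v) - f x) \<le> h k * (2*B)" "- (h k * (2*B)) \<le> d * (f (x + h k *\<^sub>R v) - f x)"
      using 1 2 b1 by auto
    then have "\<bar>d * (f (x + h k *\<^sub>R v) - f x)\<bar> \<le> h k * (2*B)" by linarith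
    then have "d * \<bar>f (x + h k *\<^sub>R v) - f x\<bar> \<le> h k * (2*B)" using d by (simp add: abs_mult)
    then have "\<bar>f (x + h k *\<^sub>R v) - f x\<bar> / h k \<le> 2 * B / d" using d h(1)[of k]
      by (simp add: field_simps)
    then show ?thesis unfolding q_def using Fin i h(1)[of k] by (simp add: abs_divide)
  qed
  define g where "g = (\<lambda>k x. (indicator K x - indicator K (x + h k *\<^sub>R v)) * q k x)"
  define s where "s = (\<lambda>k x. indicator K x * (q k x - q k (x - h k *\<^sub>R v)))"
  have gb: "norm (g k x) \<le> indicator C x * (2 * B / d)" for k x
  proof (cases "x \<in> K \<or> x + h k *\<^sub>R v \<in> K")
    case True
    then have "x \<in> C" using Cin[of x 0] Cin[of "x + h k *\<^sub>R v" "- h k"] h[of k] d by auto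
    moreover have "\<bar>indicator K x - indicator K (x + h k *\<^sub>R v)\<bar> \<le> (1::real)"
      by (auto simp: indicator_def)
    ultimately show ?thesis
      using mult_mono[OF _ qb[OF True], of _ 1] by (simp add: g_def abs_mult)
  next
    case False
    have "0 \<le> B \<or> x \<notin> C" using B0 by (auto simp: C_def)
    with False d show ?thesis by (auto simp: g_def)
  qed
  have fin: "integrable lborel (\<lambda>x. indicator C x * (2 * B / d))"
    using C(1) by (intro integrable_mult_left integrable_real_indicator emeasure_compact_finite)
       (auto intro: borel_compact)
  have gi: "integrable lborel (g k)" for k
  proof (rule Bochner_Integration.integrable_bound[OF fin])
    show "g k \<in> borel_measurable lborel" unfolding g_def by measurable
    show "AE x in lborel. norm (g k x) \<le> norm (indicator C x * (2 * B / d))"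
      using order_trans[OF gb abs_ge_self] by (intro AE_I2) (simp only: real_norm_def)
  qed
  have "(\<lambda>k. LINT x|lborel. g k x) \<longlonglongrightarrow> (LINT x::'a|lborel. (0::real))"
  proof (rule integral_dominated_convergence[OF _ _ fin])
    show "g k \<in> borel_measurable lborel" for k using gi by (rule borel_measurable_integrable)
    show "AE x in lborel. norm (g k x) \<le> indicator C x * (2 * B / d)" for k
      by (intro AE_I2 gb)
    \<comment> \<open>Off the frontier of K, short steps do not change membership in K, so
      \<open>g k x\<close> is eventually 0.\<close>
    have "AE x in lborel. x \<notin> frontier K"
      using negligible_convex_frontier[of K]
      by (auto simp: K_def negligible_iff_null_sets eventually_ae_filter null_sets_completion_iff)
    then show "AE x in lborel. (\<lambda>k. g k x) \<longlonglongrightarrow> 0"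
    proof (rule AE_mp, intro AE_I2 impI)
      fix x assume x: "x \<notin> frontier K"
      have lim: "(\<lambda>k. x + h k *\<^sub>R v) \<longlonglongrightarrow> x"
        using tendsto_add[OF tendsto_const tendsto_scaleR[OF h0 tendsto_const], of x v] by simp
      have "\<forall>\<^sub>F k in sequentially. (x + h k *\<^sub>R v \<in> K \<longleftrightarrow> x \<in> K)"
      proof (cases "x \<in> interior K")
        case True
        then show ?thesis using topological_tendstoD[OF lim open_interior True] interior_subset[of K]
          by (auto elim: eventually_mono)
      next
        case False
        then have xx: "x \<in> - closure K" using x by (auto simp: frontier_def)
        have "\<forall>\<^sub>F k in sequentially. x + h k *\<^sub>R v \<in> - closure K"
          by (rule topological_tendstoD[OF lim _ xx]) auto
        then show ?thesis by eventually_elim (use xx closure_subset[of K] in auto)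
      qed
      then have "\<forall>\<^sub>F k in sequentially. g k x = 0"
        by eventually_elim (auto simp: g_def indicator_def)
      then show "(\<lambda>k. g k x) \<longlonglongrightarrow> 0" by (rule tendsto_eventually)
    qed
  qed auto
  then have g0: "(\<lambda>k. LINT x|lborel. g k x) \<longlonglongrightarrow> 0" by simp
  have iKq: "integrable lborel (\<lambda>x. indicator K x * q k x)" (is ?i1)
    and iKq': "integrable lborel (\<lambda>x. indicator K (x + h k *\<^sub>R v) * q k x)" (is ?i2) for k
  proof -
    have nb: "norm (indicator A x * q k x) \<le> norm (indicator C x * (2 * B / d))"
      if "A = K \<or> A = (\<lambda>x. x + h k *\<^sub>R v) -` K" for A x
    proof (cases "x \<in> A")
      case True
      then have xx: "x \<in> K \<or> x + h k *\<^sub>R v \<in> K" using that by auto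
      then have "x \<in> C" using Cin[of x 0] Cin[of "x + h k *\<^sub>R v" "- h k"] h[of k] d by auto
      then show ?thesis using True order_trans[OF qb[OF xx] abs_ge_self] by simp
    qed auto
    show ?i1
      apply (rule Bochner_Integration.integrable_bound[OF fin])
      using nb[of K] by auto
    have ie: "indicator K (x + h k *\<^sub>R v) = indicator ((\<lambda>x. x + h k *\<^sub>R v) -` K) x" for x
      by (auto simp: indicator_def)
    have "(\<lambda>x. x + h k *\<^sub>R v) -` K \<in> sets borel"
      by (rule measurable_sets_borel[OF _ Kb]) simp
    then show ?i2
      unfolding ie
      apply (intro Bochner_Integration.integrable_bound[OF fin])
      using nb by auto
  qed
  have seq: "s k x = indicator K x * q k x - (\<lambda>y. indicator K (y + h k *\<^sub>R v) * q k y) (- (h k *\<^sub>R v) + x)" for k x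
    by (simp add: s_def algebra_simps)
  have meas2: "(\<lambda>y. indicator K (y + h k *\<^sub>R v) * q k y) \<in> borel_measurable borel" for k
    by measurable
  have iT: "integrable lborel (\<lambda>x. (\<lambda>y. indicator K (y + h k *\<^sub>R v) * q k y) (- (h k *\<^sub>R v) + x))" for k
    using iKq'[of k] lborel_distr_plus[of "- (h k *\<^sub>R v)"]
    by (subst (asm) lborel_distr_plus[of "- (h k *\<^sub>R v)", symmetric], subst (asm) integrable_distr_eq) auto
  have sint: "(LINT x|lborel. s k x) = (LINT x|lborel. g k x)" for k
    unfolding seq Bochner_Integration.integral_diff[OF iKq iT] lborel_integral_translation[OF meas2]
    unfolding g_def left_diff_distrib Bochner_Integration.integral_diff[OF iKq iKq'] ..
  have spos: "0 \<le> s k x" and sval: "x \<in> K \<Longrightarrow> s k x = (f (x + h k *\<^sub>R v) + f (x - h k *\<^sub>R v) - 2 * f x) / h k" for k x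
  proof -
    have *: "s k x = (f (x + h k *\<^sub>R v) + f (x - h k *\<^sub>R v) - 2 * f x) / h k \<and> 0 \<le> s k x" if x: "x \<in> K"
    proof -
      have i: "x \<in> C" "x + h k *\<^sub>R v \<in> C" "x - h k *\<^sub>R v \<in> C"
        using Cin[OF x, of 0] Cin[OF x, of "h k"] Cin[OF x, of "- h k"] h[of k] d by auto
      have e1: "s k x = (f (x + h k *\<^sub>R v) + f (x - h k *\<^sub>R v) - 2 * f x) / h k"
        using x i h(1)[of k] by (simp add: s_def q_def Fin field_simps)
      have "h k * (f x - f (x - h k *\<^sub>R v)) \<le> h k * (f (x + h k *\<^sub>R v) - f x)"
        using convex_on_slope_ge[OF f _ _ h(1) h(1), of x k v k] i C by auto
      then have "f x - f (x - h k *\<^sub>R v) \<le> f (x + h k *\<^sub>R v) - f x" using h(1)[of k] by simp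
      then show ?thesis using e1 h(1)[of k] by simp
    qed
    show "0 \<le> s k x" using * by (cases "x \<in> K") (auto simp: s_def)
    show "x \<in> K \<Longrightarrow> s k x = (f (x + h k *\<^sub>R v) + f (x - h k *\<^sub>R v) - 2 * f x) / h k" using * by auto
  qed
  have si: "integrable lborel (s k)" for k
    unfolding seq by (intro Bochner_Integration.integrable_diff iKq iT)
  \<comment> \<open>By convexity \<open>s k\<close> is nonnegative, so convergence of its integrals
    to 0 is convergence in L1, and a subsequence converges almost everywhere.\<close>
  have "\<exists>r. strict_mono r \<and> (AE x in lborel. (\<lambda>n. s (r n) x) \<longlonglongrightarrow> 0)"
    by (rule tendsto_L1_AE_subseq[OF si]) (use g0 sint spos in simp)
  then obtain r where r: "strict_mono r" "AE x in lborel. (\<lambda>n. s (r n) x) \<longlonglongrightarrow> 0"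
    by (auto intro: AE_I2)
  show ?thesis
    using r(2)
  proof (rule AE_mp, intro AE_I2 impI)
    fix x assume l: "(\<lambda>n. s (r n) x) \<longlonglongrightarrow> 0" and "x \<in> cbox a b"
    then have x: "x \<in> K" by (simp add: K_def)
    show "second_diff_small S f v x"
      unfolding second_diff_small_def
    proof (intro allI impI)
      fix e :: real assume "e > 0"
      then have "\<forall>\<^sub>F n in sequentially. s (r n) x < e" using l order_tendstoD(2) by blast
      then obtain n where n: "s (r n) x < e" by (auto simp: eventually_sequentially)
      let ?h = "h (r n)"
      have "x + ?h *\<^sub>R v \<in> C" "x - ?h *\<^sub>R v \<in> C"
        using Cin[OF x, of "?h"] Cin[OF x, of "- ?h"] h[of "r n"] d by auto
      moreover have "f (x + ?h *\<^sub>R v) + f (x - ?h *\<^sub>R v) - 2 * f x \<le> e * ?h"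
        using n h(1)[of "r n"] unfolding sval[OF x] by (simp add: field_simps)
      ultimately show "\<exists>h>0. x + h *\<^sub>R v \<in> S \<and> x - h *\<^sub>R v \<in> S \<and>
             f (x + h *\<^sub>R v) + f (x - h *\<^sub>R v) - 2 * f x \<le> e * h" using h(1) C by blast
    qed
  qed
qed

lemma AE_second_diff_small:
  fixes f :: "'a::euclidean_space \<Rightarrow> real"
  assumes S: "open S" and f: "convex_on S f"
  shows "AE x in lborel. x \<in> S \<longrightarrow> second_diff_small S f v x"
proof -
  obtain D where D: "countable D" "D \<subseteq> Pow S" "\<And>X. X \<in> D \<Longrightarrow> \<exists>a b. X = cbox a b" "\<Union>D = S"
    using open_countable_Union_open_cbox[OF S] by metis
  have "AE x in lborel. \<forall>X\<in>D. x \<in> X \<longrightarrow> second_diff_small S f v x"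
    unfolding AE_ball_countable[OF D(1)]
  proof
    fix X assume X: "X \<in> D"
    then obtain a b where "X = cbox a b" using D(3) by blast
    then show "AE x in lborel. x \<in> X \<longrightarrow> second_diff_small S f v x"
      using AE_second_diff_small_cbox[OF S f, of a b v] X D(2) by auto
  qed
  then show ?thesis by (rule AE_mp) (use D(4) in auto)
qed

text \<open>Every backward slope lies below every forward slope; p is the infimum of the forward
  slopes. A step at which the two slopes differ by at most e squeezes both to within e of p, and by
  monotonicity the same holds for all shorter steps.\<close>

lemma second_diff_small_slope:
  assumes f: "convex_on S f" and x: "x \<in> S" and sd: "second_diff_small S f v x"
  obtains p where "\<And>e. e > 0 \<Longrightarrow> \<exists>h>0. \<forall>t. \<bar>t\<bar> \<le> h \<longrightarrow> x + t *\<^sub>R v \<in> S \<and> f (x + t *\<^sub>R v) \<le> f x + p * t + e * \<bar>t\<bar>"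
proof
  define R where "R = {(f (x + h *\<^sub>R v) - f x) / h | h. h > 0 \<and> x + h *\<^sub>R v \<in> S}"
  have cS: "convex S" using f by (simp add: convex_on_def)
  have lb: "(f x - f (x - d *\<^sub>R v)) / d \<le> r" if "r \<in> R" "d > 0" "x - d *\<^sub>R v \<in> S" for r d
  proof -
    obtain h where h: "r = (f (x + h *\<^sub>R v) - f x) / h" "h > 0" "x + h *\<^sub>R v \<in> S"
      using \<open>r \<in> R\<close> by (auto simp: R_def)
    show ?thesis using convex_on_slope_ge[OF f that(3) h(3) h(2) that(2)] h(2) that(2)
      unfolding h(1) by (simp add: divide_simps) (simp add: algebra_simps)
  qed
  fix e :: real assume "e > 0"
  then obtain h where h: "h > 0" "x + h *\<^sub>R v \<in> S" "x - h *\<^sub>R v \<in> S"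
      "f (x + h *\<^sub>R v) + f (x - h *\<^sub>R v) - 2 * f x \<le> e * h"
    using sd unfolding second_diff_small_def by blast
  have R1: "(f (x + h *\<^sub>R v) - f x) / h \<in> R" using h by (auto simp: R_def)
  have bdd: "bdd_below R" using lb[OF _ h(1,3)] by (auto simp: bdd_below_def)
  have ge: "(f x - f (x - h *\<^sub>R v)) / h \<le> Inf R"
    using R1 lb[OF _ h(1,3)] by (intro cInf_greatest) auto
  have le: "Inf R \<le> (f (x + h *\<^sub>R v) - f x) / h" using R1 bdd by (rule cInf_lower)
  have h4: "(f (x + h *\<^sub>R v) - f x) / h \<le> (f x - f (x - h *\<^sub>R v)) / h + e"
    using h by (simp add: divide_simps)
  have "x + t *\<^sub>R v \<in> S \<and> f (x + t *\<^sub>R v) \<le> f x + Inf R * t + e * \<bar>t\<bar>" if t: "\<bar>t\<bar> \<le> h" for t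
  proof -
    consider "t = 0" | "t > 0" | "t < 0" by linarith
    then show ?thesis
    proof cases
      case 1 then show ?thesis using x by simp
    next
      case 2
      have "x + t *\<^sub>R v = (1 - t/h) *\<^sub>R x + (t/h) *\<^sub>R (x + h *\<^sub>R v)"
        using h(1) by (simp add: algebra_simps)
      then have S: "x + t *\<^sub>R v \<in> S" using convexD_alt[OF cS x h(2), of "t/h"] t 2 by simp
      have "h * (f (x + t *\<^sub>R v) - f x) \<le> t * (f (x + h *\<^sub>R v) - f x)"
        using convex_on_slope_le[OF f x h(2) 2] t by simp
      then have "f (x + t *\<^sub>R v) - f x \<le> t * ((f (x + h *\<^sub>R v) - f x) / h)"
        using h(1) by (simp add: field_simps)
      also have "\<dots> \<le> t * (Inf R + e)" using ge h4 2 by (intro mult_left_mono) auto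
      finally show ?thesis using S 2 by (simp add: algebra_simps)
    next
      case 3
      have eq: "(1 - -t/h) *\<^sub>R x + (-t/h) *\<^sub>R (x - h *\<^sub>R v) = x + t *\<^sub>R v"
        using h(1) by (simp add: algebra_simps)
      have th: "0 \<le> -t/h" "-t/h \<le> 1" using t 3 h(1) by (auto simp: field_simps)
      have S: "x + t *\<^sub>R v \<in> S" using convexD_alt[OF cS x h(3) th] unfolding eq .
      have "h * (f (x + (-t) *\<^sub>R (-v)) - f x) \<le> (-t) * (f (x + h *\<^sub>R (-v)) - f x)"
        using h(3) 3 t by (intro convex_on_slope_le[OF f x]) auto
      then have "f (x + t *\<^sub>R v) - f x \<le> t * ((f x - f (x - h *\<^sub>R v)) / h)"
        using h(1) by (simp add: field_simps)
      also have "\<dots> \<le> t * (Inf R - e)" using le h4 3 by (intro mult_left_mono_neg) auto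
      finally show ?thesis using S 3 by (simp add: algebra_simps)
    qed
  qed
  then show "\<exists>h>0. \<forall>t. \<bar>t\<bar> \<le> h \<longrightarrow> x + t *\<^sub>R v \<in> S \<and> f (x + t *\<^sub>R v) \<le> f x + Inf R * t + e * \<bar>t\<bar>"
    using h(1) by blast
qed

text \<open>Upper estimates along the axes suffice. The point x + w is the average of the n points x
  + n (w \<bullet> b) b, so Jensen's inequality gives an upper estimate there; the midpoint
  inequality between x + w and x - w turns the estimate at -w into the lower estimate at w.\<close>

lemma convex_on_differentiable_if_second_diff_small:
  fixes f :: "'a::euclidean_space \<Rightarrow> real"
  assumes f: "convex_on S f" and x: "x \<in> S"
    and sd: "\<And>b. b \<in> Basis \<Longrightarrow> second_diff_small S f b x"
  shows "\<exists>g. (f has_derivative (\<lambda>h. g \<bullet> h)) (at x)"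
proof -
  have "\<forall>b\<in>Basis. \<exists>p. \<forall>e>0. \<exists>h>0. \<forall>t. \<bar>t\<bar> \<le> h \<longrightarrow> x + t *\<^sub>R b \<in> S \<and> f (x + t *\<^sub>R b) \<le> f x + p * t + e * \<bar>t\<bar>"
    by (metis second_diff_small_slope[OF f x sd])
  then obtain p where p: "\<And>b e. b \<in> Basis \<Longrightarrow> e > 0 \<Longrightarrow>
     \<exists>h>0. \<forall>t. \<bar>t\<bar> \<le> h \<longrightarrow> x + t *\<^sub>R b \<in> S \<and> f (x + t *\<^sub>R b) \<le> f x + p b * t + e * \<bar>t\<bar>"
    by metis
  define g where "g = (\<Sum>b\<in>Basis. p b *\<^sub>R b)"
  define n where "n = real DIM('a)"
  have n: "n \<ge> 1" by (simp add: n_def DIM_positive Suc_leI)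
  have gw: "g \<bullet> w = (\<Sum>b\<in>Basis. p b * (w \<bullet> b))" for w
    unfolding g_def inner_sum_left by (intro sum.cong) (auto simp: inner_commute)
  have "\<exists>d>0. \<forall>y. norm (y - x) < d \<longrightarrow> norm (f y - f x - g \<bullet> (y - x)) \<le> e * norm (y - x)" if e: "e > 0" for e
  proof -
    obtain h where h: "\<And>b. b \<in> Basis \<Longrightarrow> h b > 0"
      "\<And>b t. b \<in> Basis \<Longrightarrow> \<bar>t\<bar> \<le> h b \<Longrightarrow> x + t *\<^sub>R b \<in> S \<and> f (x + t *\<^sub>R b) \<le> f x + p b * t + (e / n) * \<bar>t\<bar>"
      using p[of _ "e / n"] e n by (metis divide_pos_pos less_le_trans zero_less_one)
    \<comment> \<open>The axis displacements are n times the coordinates of w, hence the division by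
      n.\<close>
    define d where "d = Min (h ` Basis) / n"
    have d: "d > 0" using h n by (auto simp: d_def)
    have up: "x + w \<in> S \<and> f (x + w) \<le> f x + g \<bullet> w + e * norm w" if w: "norm w < d" for w
    proof -
      have bt: "\<bar>n * (w \<bullet> b)\<bar> \<le> h b" if b: "b \<in> Basis" for b
      proof -
        have "\<bar>n * (w \<bullet> b)\<bar> \<le> n * norm w" using n Basis_le_norm[OF b, of w] by (simp add: abs_mult)
        also have "\<dots> \<le> n * d" using n w by simp
        also have "\<dots> \<le> h b" using n b by (simp add: d_def)
        finally show ?thesis .
      qed
      define y where "y = (\<lambda>b. x + (n * (w \<bullet> b)) *\<^sub>R b)"
      have y: "y b \<in> S" "f (y b) \<le> f x + p b * (n * (w \<bullet> b)) + (e / n) * \<bar>n * (w \<bullet> b)\<bar>" if "b \<in> Basis" for b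
        using h(2)[OF that bt[OF that]] by (auto simp: y_def)
      have xw: "(\<Sum>b\<in>Basis. (1/n) *\<^sub>R y b) = x + w"
      proof -
        have "(\<Sum>b\<in>Basis. (1/n) *\<^sub>R y b) = (\<Sum>b\<in>(Basis::'a set). (1/n) *\<^sub>R x) + (\<Sum>b\<in>Basis. (w \<bullet> b) *\<^sub>R b)"
        proof -
          have "(1/n) *\<^sub>R y b = (1/n) *\<^sub>R x + (w \<bullet> b) *\<^sub>R b" for b
            using n by (simp add: y_def scaleR_add_right)
          then show ?thesis by (simp only: sum.distrib)
        qed
        also have "(\<Sum>b\<in>(Basis::'a set). (1/n) *\<^sub>R x) = (\<Sum>b\<in>(Basis::'a set). (1/n)) *\<^sub>R x"
          by (rule scaleR_sum_left[symmetric])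
        also have "(\<Sum>b\<in>(Basis::'a set). (1/n)) = 1" using n by (simp add: n_def)
        also have "1 *\<^sub>R x + (\<Sum>b\<in>Basis. (w \<bullet> b) *\<^sub>R b) = x + w"
          by (simp only: euclidean_representation scaleR_one)
        finally show ?thesis .
      qed
      have s1: "(\<Sum>b\<in>(Basis::'a set). (1/n)) = 1" using n by (simp add: n_def)
      have cS: "convex S" using f by (simp add: convex_on_def)
      have "f (\<Sum>b\<in>Basis. (1/n) *\<^sub>R y b) \<le> (\<Sum>b\<in>Basis. (1/n) * f (y b))"
        using n y by (intro convex_on_sum[OF _ _ f s1]) auto
      also have "\<dots> \<le> (\<Sum>b\<in>Basis. (1/n) * (f x + p b * (n * (w \<bullet> b)) + (e / n) * \<bar>n * (w \<bullet> b)\<bar>))"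
        using y n by (intro sum_mono mult_left_mono) auto
      also have "\<dots> = (\<Sum>b\<in>Basis. (1/n) * f x + p b * (w \<bullet> b) + (e/n) * \<bar>w \<bullet> b\<bar>)"
        using n by (intro sum.cong refl) (simp add: field_simps abs_mult)
      also have "\<dots> = (\<Sum>b\<in>(Basis::'a set). (1/n)) * f x + g \<bullet> w + (\<Sum>b\<in>Basis. (e/n) * \<bar>w \<bullet> b\<bar>)"
        by (simp only: gw sum.distrib sum_distrib_right)
      also have "\<dots> \<le> f x + g \<bullet> w + (\<Sum>b\<in>(Basis::'a set). (e/n) * norm w)"
        unfolding s1 mult_1 using e n by (intro add_left_mono sum_mono mult_left_mono Basis_le_norm) auto
      also have "(\<Sum>b\<in>(Basis::'a set). (e/n) * norm w) = e * norm w" using n by (simp add: n_def)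
      finally have "f (x + w) \<le> f x + g \<bullet> w + e * norm w" by (simp only: xw)
      moreover have "x + w \<in> S" unfolding xw[symmetric] using n y
        by (intro convex_sum[OF _ cS s1]) auto
      ultimately show ?thesis by simp
    qed
    show ?thesis
    proof (intro exI[of _ d] conjI allI impI d)
      fix y assume y: "norm (y - x) < d"
      define w where "w = y - x"
      have u: "x + w \<in> S \<and> f (x + w) \<le> f x + g \<bullet> w + e * norm w"
          "x + -w \<in> S \<and> f (x + -w) \<le> f x + g \<bullet> -w + e * norm (-w)"
        using y up[of w] up[of "-w"] by (auto simp: w_def norm_minus_commute)
      have "f ((1 - 1/2) *\<^sub>R (x + w) + (1/2) *\<^sub>R (x + -w)) \<le> (1 - 1/2) * f (x + w) + (1/2) * f (x + -w)"
        using u by (intro convex_onD[OF f]) auto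
      moreover have "(1 - 1/2) *\<^sub>R (x + w) + (1/2) *\<^sub>R (x + -w) = x"
      proof -
        have "(1 - 1/2) *\<^sub>R (x + w) + (1/2) *\<^sub>R (x + -w) = (1/2) *\<^sub>R (x + x)"
          by (simp add: scaleR_diff_right scaleR_add_right)
        then show ?thesis by (simp only: scaleR_half_double)
      qed
      ultimately have "2 * f x \<le> f (x + w) + f (x + -w)" by simp
      then have "\<bar>f (x + w) - f x - g \<bullet> w\<bar> \<le> e * norm w" using u by (simp add: abs_le_iff)
      then show "norm (f y - f x - g \<bullet> (y - x)) \<le> e * norm (y - x)" by (simp add: w_def)
    qed
  qed
  then show ?thesis unfolding has_derivative_at_alt by (blast intro: bounded_linear_inner_right)
qed

proposition AE_convex_on_differentiable:
  fixes f :: "'a::euclidean_space \<Rightarrow> real"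
  assumes S: "open S" and f: "convex_on S f"
  shows "AE x in lborel. x \<in> S \<longrightarrow> (\<exists>g. (f has_derivative (\<lambda>h. g \<bullet> h)) (at x))"
proof -
  have "AE x in lborel. \<forall>b\<in>Basis. x \<in> S \<longrightarrow> second_diff_small S f b x"
    unfolding AE_ball_countable[OF countable_finite[OF finite_Basis]]
    using AE_second_diff_small[OF S f] by blast
  then show ?thesis
    by (rule AE_mp) (auto intro!: AE_I2 convex_on_differentiable_if_second_diff_small[OF f])
qed

section \<open>Super-coercive convex functions and epi-convergence\<close>

text \<open>Infinite values become 0, so a statement about \<open>rval u x\<close> carries
  information only for x in the domain.\<close>

abbreviation rval :: "('a \<Rightarrow> ereal) \<Rightarrow> 'a \<Rightarrow> real" where
  "rval u x \<equiv> real_of_ereal (u x)"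

lemma Conv_sc_not_MInf: "u \<in> Conv_sc T \<Longrightarrow> u x \<noteq> -\<infinity>"
  by (simp add: Conv_sc_def proper_fun_def)

lemma dom_fun_nonempty: "u \<in> Conv_sc T \<Longrightarrow> \<exists>x. x \<in> dom_fun u"
  by (simp add: Conv_sc_def proper_fun_def dom_fun_def)

lemma ereal_rval: "u \<in> Conv_sc T \<Longrightarrow> x \<in> dom_fun u \<Longrightarrow> ereal (rval u x) = u x"
  using Conv_sc_not_MInf[of u T x] by (cases "u x") (auto simp: dom_fun_def)

lemma not_in_dom: "x \<notin> dom_fun u \<Longrightarrow> u x = \<infinity>"
  by (simp add: dom_fun_def)

lemma le_in_dom: "u x \<le> ereal t \<Longrightarrow> x \<in> dom_fun u"
  by (auto simp: dom_fun_def intro: le_less_trans)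

lemma Conv_sc_convex_on: "u \<in> Conv_sc T \<Longrightarrow> convex_on (dom_fun u) (rval u)"
  by (simp add: Conv_sc_def convex_fun_def)

lemma Conv_sc_convex_dom: "u \<in> Conv_sc T \<Longrightarrow> convex (dom_fun u)"
  by (simp add: Conv_sc_def convex_fun_def)

lemma Conv_sc_closed: "u \<in> Conv_sc T \<Longrightarrow> closed {x. u x \<le> ereal t}"
  by (simp add: Conv_sc_def lsc_fun_def)

lemma Conv_sc_coercive:
  fixes u :: "real^'n \<Rightarrow> ereal"
  assumes "u \<in> Conv_sc T"
  obtains R where "R > 0" "\<And>x. x \<in> dom_fun u \<Longrightarrow> norm x \<ge> R \<Longrightarrow> rval u x \<ge> c * norm x"
proof -
  have "((\<lambda>x. u x / ereal (norm x)) \<longlongrightarrow> \<infinity>) at_infinity"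
    using assms by (simp add: Conv_sc_def super_coercive_def)
  then have "\<forall>\<^sub>F x in at_infinity. ereal c < u x / ereal (norm x)"
    by (auto simp: tendsto_PInfty)
  then obtain b where b: "\<And>x. b \<le> norm x \<Longrightarrow> ereal c < u x / ereal (norm x)"
    by (auto simp: eventually_at_infinity)
  show ?thesis
  proof (rule that[of "max b 1"])
    fix x assume x: "x \<in> dom_fun u" "max b 1 \<le> norm x"
    have "ereal c < ereal (rval u x) / ereal (norm x)" using b[of x] x ereal_rval[OF assms x(1)] by simp
    moreover have nx: "norm x > 0" using x by auto
    ultimately have "c < rval u x / norm x" by (simp add: divide_ereal_def divide_inverse)
    then show "rval u x \<ge> c * norm x" using pos_less_divide_eq[OF nx] by (simp add: less_imp_le)
  qed simp
qed

lemma Conv_scI: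
  fixes u :: "real^'n \<Rightarrow> ereal"
  assumes "\<exists>x. x \<in> dom_fun u" "\<And>x. u x \<noteq> -\<infinity>" "\<And>t. closed {x. u x \<le> ereal t}"
    "convex_on (dom_fun u) (rval u)"
    "\<And>c. \<exists>R. \<forall>x\<in>dom_fun u. norm x \<ge> R \<longrightarrow> rval u x \<ge> c * norm x"
  shows "u \<in> Conv_sc T"
proof -
  have "super_coercive u"
    unfolding super_coercive_def tendsto_PInfty
  proof
    fix r :: real
    obtain R where R: "\<And>x. x \<in> dom_fun u \<Longrightarrow> norm x \<ge> R \<Longrightarrow> rval u x \<ge> (r + 1) * norm x"
      using assms(5)[of "r + 1"] by blast
    show "\<forall>\<^sub>F x in at_infinity. ereal r < u x / ereal (norm x)"
      unfolding eventually_at_infinity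
    proof (intro exI[of _ "max R 1"] allI impI)
      fix x :: "real^'n" assume x: "max R 1 \<le> norm x"
      then have x0: "x \<noteq> 0" by auto
      show "ereal r < u x / ereal (norm x)"
      proof (cases "x \<in> dom_fun u")
        case True
        then obtain q where q: "u x = ereal q" using assms(2)[of x] by (cases "u x") (auto simp: dom_fun_def)
        have "r + 1 \<le> q / norm x" using R[OF True] x0 x q by (simp add: le_divide_eq)
        then show ?thesis using x0 q by (simp add: divide_ereal_def divide_inverse)
      next
        case False
        then show ?thesis using x0 by (auto simp: not_in_dom divide_ereal_def)
      qed
    qed
  qed
  then show ?thesis using assms
    by (auto simp: Conv_sc_def proper_fun_def convex_fun_def lsc_fun_def dom_fun_def convex_on_def)
qed

text \<open>In the language of convex analysis this is f plus the indicator of A.\<close>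

definition restr :: "'a set \<Rightarrow> ('a \<Rightarrow> real) \<Rightarrow> 'a \<Rightarrow> ereal" where
  "restr A f = (\<lambda>x. if x \<in> A then ereal (f x) else \<infinity>)"

lemma dom_restr[simp]: "dom_fun (restr A f) = A"
  by (auto simp: dom_fun_def restr_def)

lemma rval_restr[simp]: "x \<in> A \<Longrightarrow> rval (restr A f) x = f x"
  by (simp add: restr_def)

lemma restr_Conv_sc:
  fixes A :: "(real^'n) set"
  assumes "compact A" "A \<noteq> {}" "convex_on A f" "continuous_on A f"
  shows "restr A f \<in> Conv_sc TYPE('n)"
proof (rule Conv_scI)
  show "closed {x. restr A f x \<le> ereal t}" for t
  proof -
    have "{x. restr A f x \<le> ereal t} = A \<inter> f -` {..t}" by (auto simp: restr_def)
    then show ?thesis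
      using continuous_closed_preimage[OF assms(4) compact_imp_closed[OF assms(1)] closed_atMost] by simp
  qed
  show "convex_on (dom_fun (restr A f)) (rval (restr A f))"
    using assms(3) by (auto simp: convex_on_def convex_def)
  show "\<exists>R. \<forall>x\<in>dom_fun (restr A f). R \<le> norm x \<longrightarrow> c * norm x \<le> rval (restr A f) x" for c
  proof -
    obtain B where "\<And>x. x \<in> A \<Longrightarrow> norm x \<le> B"
      using compact_imp_bounded[OF assms(1)] by (auto simp: bounded_iff)
    then show ?thesis by (intro exI[of _ "B + 1"]) force
  qed
next
  show "\<exists>x. x \<in> dom_fun (restr A f)" using assms(2) by auto
qed (simp add: restr_def)

section \<open>Sequential tools for epi-convergence\<close>

lemma epi_converges_subseq_le:
  assumes ep: "epi_converges us u" and s: "strict_mono (\<sigma>::nat\<Rightarrow>nat)" and xs: "xs \<longlonglongrightarrow> x"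
    and le: "\<forall>\<^sub>F k in sequentially. us (\<sigma> k) (xs k) \<le> t"
  shows "u x \<le> t"
proof -
  have inj: "inj \<sigma>" using s by (rule strict_mono_imp_inj_on)
  \<comment> \<open>The lower bound in the definition concerns full sequences, so the indices
    outside the range of \<sigma> are filled with the limit point itself.\<close>
  define ys where "ys n = (if n \<in> range \<sigma> then xs (inv \<sigma> n) else x)" for n
  have ys: "ys (\<sigma> k) = xs k" for k using inj by (simp add: ys_def)
  have "ys \<longlonglongrightarrow> x"
    unfolding lim_sequentially
  proof (intro allI impI)
    fix r :: real assume "r > 0"
    then obtain N where N: "\<And>n. n \<ge> N \<Longrightarrow> dist (xs n) x < r" using xs unfolding lim_sequentially by blast
    have "dist (ys n) x < r" if "n \<ge> \<sigma> N" for n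
    proof (cases "n \<in> range \<sigma>")
      case True
      then obtain k where "n = \<sigma> k" by auto
      then show ?thesis using that N[of k] s ys by (simp add: strict_mono_less_eq)
    qed (use \<open>r > 0\<close> in \<open>simp add: ys_def\<close>)
    then show "\<exists>no. \<forall>n\<ge>no. dist (ys n) x < r" by blast
  qed
  then have "u x \<le> liminf (\<lambda>k. us k (ys k))" using ep by (simp add: epi_converges_def)
  also have "\<dots> \<le> liminf ((\<lambda>k. us k (ys k)) \<circ> \<sigma>)" by (rule liminf_subseq_mono[OF s])
  also have "\<dots> \<le> t" by (rule Liminf_le) (use le ys in auto)
  finally show ?thesis .
qed

lemma epi_converges_recovery:
  assumes ep: "epi_converges us u" and u: "u \<in> Conv_sc T" and x: "x \<in> dom_fun u"
  obtains xs where "xs \<longlonglongrightarrow> x" "(\<lambda>k. rval (us k) (xs k)) \<longlonglongrightarrow> rval u x"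
    "\<forall>\<^sub>F k in sequentially. xs k \<in> dom_fun (us k) \<and> us k (xs k) = ereal (rval (us k) (xs k))"
proof -
  obtain xs where xs: "xs \<longlonglongrightarrow> x" "(\<lambda>k. us k (xs k)) \<longlonglongrightarrow> u x"
    using ep by (auto simp: epi_converges_def)
  have l: "(\<lambda>k. us k (xs k)) \<longlonglongrightarrow> ereal (rval u x)" using xs(2) ereal_rval[OF u x] by simp
  show ?thesis
  proof (rule that[OF xs(1)])
    show "(\<lambda>k. rval (us k) (xs k)) \<longlonglongrightarrow> rval u x" using l by (rule lim_real_of_ereal)
    show "\<forall>\<^sub>F k in sequentially. xs k \<in> dom_fun (us k) \<and> us k (xs k) = ereal (rval (us k) (xs k))"
      using real_lim_then_eventually_real[OF l] by eventually_elim (auto simp: dom_fun_def)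
  qed
qed

lemma le_liminf_if_subseq_le:
  fixes X :: "nat \<Rightarrow> ereal"
  assumes lower: "\<And>\<sigma> t. strict_mono (\<sigma>::nat\<Rightarrow>nat) \<Longrightarrow> (\<And>k. X (\<sigma> k) \<le> ereal t) \<Longrightarrow> l \<le> ereal t"
  shows "l \<le> liminf X"
proof (rule ccontr)
  assume "\<not> ?thesis"
  then have "liminf X < l" by simp
  then obtain t where t: "liminf X < ereal t" "ereal t < l" using ereal_dense2 by blast
  have "\<not> (\<forall>\<^sub>F k in sequentially. ereal t < X k)"
  proof
    assume "\<forall>\<^sub>F k in sequentially. ereal t < X k"
    then have "\<forall>\<^sub>F k in sequentially. ereal t \<le> X k" by eventually_elim auto
    then show False using Liminf_bounded t(1) by (metis leD)
  qed
  then have inf: "infinite {k. X k \<le> ereal t}"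
    by (simp add: eventually_sequentially infinite_nat_iff_unbounded_le not_less)
  define \<sigma> where "\<sigma> = enumerate {k. X k \<le> ereal t}"
  have s: "strict_mono \<sigma>" unfolding \<sigma>_def by (rule strict_mono_enumerate[OF inf])
  have "X (\<sigma> k) \<le> ereal t" for k
    using enumerate_in_set[OF inf, of k] by (simp add: \<sigma>_def)
  then show False using lower[OF s] t(2) by (simp add: not_le[symmetric])
qed

text \<open>The lower half is tested only along subsequences whose values stay below a real level,
  so that the points involved lie in the domains automatically. At points with infinite limit value
  the lower half already forces convergence, and a recovery sequence has to be built only on the
  domain.\<close>

lemma epi_convergesI:
  assumes lower: "\<And>x xs \<sigma> t. xs \<longlonglongrightarrow> x \<Longrightarrow> strict_mono (\<sigma>::nat\<Rightarrow>nat) \<Longrightarrow> (\<And>k. us (\<sigma> k) (xs k) \<le> ereal t) \<Longrightarrow> u x \<le> ereal t"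
    and upper: "\<And>x. x \<in> dom_fun u \<Longrightarrow> \<exists>xs. xs \<longlonglongrightarrow> x \<and> limsup (\<lambda>k. us k (xs k)) \<le> u x"
  shows "epi_converges us u"
proof -
  have low: "u x \<le> liminf (\<lambda>k. us k (xs k))" if xs: "xs \<longlonglongrightarrow> x" for x xs
    by (rule le_liminf_if_subseq_le, rule lower[OF LIMSEQ_subseq_LIMSEQ[OF xs]]) (auto simp: o_def)
  have "\<exists>xs. xs \<longlonglongrightarrow> x \<and> limsup (\<lambda>k. us k (xs k)) \<le> u x" for x
    using upper[of x] not_in_dom[of x u] tendsto_const[of x] by (cases "x \<in> dom_fun u") auto
  moreover have "(\<lambda>k. us k (xs k)) \<longlonglongrightarrow> u x" if xs: "xs \<longlonglongrightarrow> x" "limsup (\<lambda>k. us k (xs k)) \<le> u x" for x xs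
  proof (rule Liminf_eq_Limsup[OF sequentially_bot])
    have "liminf (\<lambda>k. us k (xs k)) \<le> limsup (\<lambda>k. us k (xs k))"
      by (rule Liminf_le_Limsup[OF sequentially_bot])
    then show "liminf (\<lambda>k. us k (xs k)) = u x" "limsup (\<lambda>k. us k (xs k)) = u x"
      using low[OF xs(1)] xs(2) by auto
  qed
  ultimately have "\<exists>xs. xs \<longlonglongrightarrow> x \<and> (\<lambda>k. us k (xs k)) \<longlonglongrightarrow> u x" for x by blast
  then show ?thesis using low by (simp add: epi_converges_def)
qed

lemma epi_converges_const:
  assumes "u \<in> Conv_sc T"
  shows "epi_converges (\<lambda>_. u) u"
proof (rule epi_convergesI)
  fix x :: "real^'a" and xs :: "nat \<Rightarrow> real^'a" and t assume "xs \<longlonglongrightarrow> x" "\<And>k. u (xs k) \<le> ereal t"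
  then show "u x \<le> ereal t"
    using closed_sequentially[OF Conv_sc_closed[OF assms, of t], of xs x] by simp
next
  fix x assume "x \<in> dom_fun u"
  show "\<exists>xs. xs \<longlonglongrightarrow> x \<and> limsup (\<lambda>k. u (xs k)) \<le> u x"
    by (rule exI[of _ "\<lambda>_. x"]) (simp add: Limsup_const)
qed

text \<open>\<open>grad\<close> is 0 both at a critical point and where no gradient exists; the
  relation separates the two cases.\<close>

definition has_grad :: "(real^'n \<Rightarrow> ereal) \<Rightarrow> real^'n \<Rightarrow> real^'n \<Rightarrow> bool" where
  "has_grad u x g \<longleftrightarrow> x \<in> interior (dom_fun u) \<and> (rval u has_derivative (\<lambda>h. g \<bullet> h)) (at x)"

lemma has_grad_in_dom: "has_grad u x g \<Longrightarrow> x \<in> dom_fun u"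
  using interior_subset by (auto simp: has_grad_def)

lemma has_grad_grad: assumes "has_grad u x g" shows "grad u x = g"
proof -
  have un: "g' = g" if "(rval u has_derivative (\<lambda>h. g' \<bullet> h)) (at x)" for g'
    using has_derivative_unique[OF that, of "\<lambda>h. g \<bullet> h"] assms
    by (metis has_grad_def vector_eq_rdot)
  have "(SOME g'. (rval u has_derivative (\<lambda>h. g' \<bullet> h)) (at x)) = g"
    using assms un by (intro some_equality) (auto simp: has_grad_def)
  then show ?thesis using assms by (auto simp: has_grad_def grad_def)
qed

lemma grad_eq_0: "\<nexists>g. has_grad u x g \<Longrightarrow> grad u x = 0"
  by (auto simp: has_grad_def grad_def)

text \<open>For small t the difference quotient in direction y - x is close to g \<bullet> (y - x),
  and by convexity it is at most the quotient at t = 1. The point y may lie on the boundary of the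
  domain.\<close>

lemma has_grad_subgradient:
  assumes u: "u \<in> Conv_sc T" and g: "has_grad u x g" and y: "y \<in> dom_fun u"
  shows "rval u x + g \<bullet> (y - x) \<le> rval u y"
proof (rule field_le_epsilon)
  fix e :: real assume e: "e > 0"
  define v where "v = y - x"
  define e' where "e' = e / (norm v + 1)"
  have nv: "norm v + 1 > 0" by (simp add: add_nonneg_pos)
  then have e': "e' > 0" "e' * norm v \<le> e" using e by (auto simp: e'_def divide_le_eq field_simps)
  obtain d where d: "d > 0" "\<And>z. norm (z - x) < d \<Longrightarrow> norm (rval u z - rval u x - g \<bullet> (z - x)) \<le> e' * norm (z - x)"
    using g e'(1) unfolding has_grad_def has_derivative_at_alt by blast
  define t where "t = min 1 (d / (2 * (norm v + 1)))"
  have t: "0 < t" "t \<le> 1" using d(1) nv by (auto simp: t_def)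
  have "t * norm v \<le> d / (2 * (norm v + 1)) * norm v" by (intro mult_right_mono) (auto simp: t_def)
  also have "\<dots> < d"
    using d(1) nv add_nonneg_pos[OF mult_nonneg_nonneg[of d "norm v"], of "d * 2"] by (simp add: field_simps)
  finally have "norm ((x + t *\<^sub>R v) - x) < d" using t by simp
  from d(2)[OF this] have "t * (g \<bullet> v) - e' * (t * norm v) \<le> rval u (x + t *\<^sub>R v) - rval u x"
    using t by (simp add: abs_le_iff)
  moreover have "1 * (rval u (x + t *\<^sub>R v) - rval u x) \<le> t * (rval u (x + 1 *\<^sub>R v) - rval u x)"
    using t y has_grad_in_dom[OF g] by (intro convex_on_slope_le[OF Conv_sc_convex_on[OF u]]) (auto simp: v_def)
  ultimately have "t * (g \<bullet> v - e' * norm v) \<le> t * (rval u y - rval u x)"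
    by (simp add: v_def algebra_simps)
  then have "g \<bullet> v - e' * norm v \<le> rval u y - rval u x" using t by simp
  then show "rval u x + g \<bullet> (y - x) \<le> rval u y + e" using e'(2) by (simp add: v_def)
qed

text \<open>The difference of u and the affine minorant with slope p attains its minimum at x, so
  its derivative there vanishes.\<close>

lemma has_grad_unique_subgradient:
  assumes g: "has_grad u x g" and p: "\<And>y. y \<in> dom_fun u \<Longrightarrow> rval u x + p \<bullet> (y - x) \<le> rval u y"
  shows "p = g"
proof -
  have d: "((\<lambda>y. rval u y - p \<bullet> (y - x)) has_derivative (\<lambda>h. g \<bullet> h - p \<bullet> h)) (at x)"
    using g unfolding has_grad_def by (auto intro!: derivative_eq_intros)
  have "(\<lambda>h. g \<bullet> h - p \<bullet> h) = (\<lambda>v. 0)"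
  proof (rule differential_zero_maxmin[OF _ open_interior d])
    show "x \<in> interior (dom_fun u)" using g by (simp add: has_grad_def)
    show "(\<forall>y\<in>interior (dom_fun u). rval u y - p \<bullet> (y - x) \<le> rval u x - p \<bullet> (x - x)) \<or>
          (\<forall>y\<in>interior (dom_fun u). rval u x - p \<bullet> (x - x) \<le> rval u y - p \<bullet> (y - x))"
      using p interior_subset[of "dom_fun u"] by (force simp: algebra_simps)
  qed
  then have "(g - p) \<bullet> (g - p) = 0" by (metis inner_diff_left)
  then show ?thesis by simp
qed

text \<open>The part of the domain outside its interior lies in the frontier, which is a null set
  because the domain is convex.\<close>

lemma AE_has_grad:
  assumes u: "u \<in> Conv_sc T"
  shows "AE x in lebesgue. x \<in> dom_fun u \<longrightarrow> has_grad u x (grad u x)"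
proof -
  let ?S = "interior (dom_fun u)"
  have f: "convex_on ?S (rval u)"
    using Conv_sc_convex_on[OF u] by (rule convex_on_subset)
      (auto simp: interior_subset convex_interior Conv_sc_convex_dom[OF u])
  have 1: "AE x in lebesgue. x \<in> ?S \<longrightarrow> (\<exists>g. (rval u has_derivative (\<lambda>h. g \<bullet> h)) (at x))"
    by (rule AE_completion, rule AE_convex_on_differentiable[OF open_interior f])
  have "frontier (dom_fun u) \<in> null_sets lebesgue"
    using negligible_convex_frontier[OF Conv_sc_convex_dom[OF u]] by (simp add: negligible_iff_null_sets)
  then have 2: "AE x in lebesgue. x \<notin> frontier (dom_fun u)" by (rule AE_not_in)
  show ?thesis using 1 2
  proof eventually_elim
    case (elim x)
    show ?case
    proof
      assume "x \<in> dom_fun u"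
      then have "x \<in> ?S" using elim(2) closure_subset[of "dom_fun u"] by (auto simp: frontier_def)
      then obtain g where "has_grad u x g" using elim(1) by (auto simp: has_grad_def)
      then show "has_grad u x (grad u x)" using has_grad_grad by blast
    qed
  qed
qed

section \<open>Measurability of the gradient integrand\<close>

lemma borel_measurable_Conv_sc:
  assumes u: "u \<in> Conv_sc T"
  shows "u \<in> borel_measurable borel"
  unfolding borel_measurable_ereal_iff_Ioi
proof
  fix a :: ereal
  have "u -` {..a} \<in> sets borel"
  proof (cases a)
    case (real r)
    then have "u -` {..a} = {x. u x \<le> ereal r}" by auto
    then show ?thesis using Conv_sc_closed[OF u] by auto
  next
    case MInf
    then have "u -` {..a} = {}" using Conv_sc_not_MInf[OF u] by auto
    then show ?thesis by simp
  next
    case PInf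
    then have "u -` {..a} = space borel" by auto
    then show ?thesis by (metis sets.top)
  qed
  moreover have "u -` {a<..} \<inter> space borel = UNIV - u -` {..a}" by auto
  ultimately show "u -` {a<..} \<inter> space borel \<in> sets borel" by (metis sets.Diff space_in_borel)
qed

lemma dom_fun_borel:
  assumes u: "u \<in> Conv_sc T"
  shows "dom_fun u \<in> sets borel"
proof -
  have "dom_fun u = u -` {..<\<infinity>} \<inter> space borel" by (auto simp: dom_fun_def)
  also have "\<dots> \<in> sets borel" by (rule measurable_sets[OF borel_measurable_Conv_sc[OF u]]) simp
  finally show ?thesis .
qed

definition grad_integrand :: "(real^'n \<Rightarrow> real^'n) \<Rightarrow> (real^'n \<Rightarrow> ereal) \<Rightarrow> real^'n \<Rightarrow> real^'n" where
  "grad_integrand \<psi> u x = indicator (dom_fun u) x *\<^sub>R \<psi> (grad u x)"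

lemma grad_integral_eq: "grad_integral \<psi> u = (LINT x|lebesgue. grad_integrand \<psi> u x)"
  by (simp add: grad_integral_def grad_integrand_def set_lebesgue_integral_def)

text \<open>Prepares measurability: \<open>grad\<close> is defined by a choice operator, whereas the
  difference quotients are Borel functions of x.\<close>

lemma difference_quotients_tendsto_grad:
  fixes u :: "real^'n \<Rightarrow> ereal"
  assumes "has_grad u x g"
  shows "(\<lambda>N. \<Sum>b\<in>Basis. (real (Suc N) * (rval u (x + b /\<^sub>R real (Suc N)) - rval u x)) *\<^sub>R b) \<longlonglongrightarrow> g"
proof -
  have "(\<lambda>N. real (Suc N) * (rval u (x + b /\<^sub>R real (Suc N)) - rval u x)) \<longlonglongrightarrow> g \<bullet> b" for b :: "real^'n"
  proof -
    have "((\<lambda>t. x + t *\<^sub>R b) has_derivative (\<lambda>t. t *\<^sub>R b)) (at 0)"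
      by (auto intro!: derivative_eq_intros)
    moreover have "(rval u has_derivative (\<lambda>h. g \<bullet> h)) (at (x + 0 *\<^sub>R b))"
      using assms by (simp add: has_grad_def)
    ultimately have "((\<lambda>t. rval u (x + t *\<^sub>R b)) has_derivative (\<lambda>t. g \<bullet> (t *\<^sub>R b))) (at 0)"
      by (rule has_derivative_compose)
    then have "((\<lambda>t. rval u (x + t *\<^sub>R b)) has_field_derivative (g \<bullet> b)) (at 0)"
      unfolding has_field_derivative_def by (simp add: mult_commute_abs)
    then have l: "(\<lambda>h. (rval u (x + h *\<^sub>R b) - rval u x) / h) \<midarrow>0\<rightarrow> g \<bullet> b"
      by (simp add: DERIV_def)
    have s: "filterlim (\<lambda>N. inverse (real (Suc N))) (at 0) sequentially"
      unfolding filterlim_at using LIMSEQ_inverse_real_of_nat by simp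
    show ?thesis using filterlim_compose[OF l s] by (simp add: field_simps)
  qed
  then have "(\<lambda>N. \<Sum>b\<in>Basis. (real (Suc N) * (rval u (x + b /\<^sub>R real (Suc N)) - rval u x)) *\<^sub>R b) \<longlonglongrightarrow> (\<Sum>b\<in>Basis. (g \<bullet> b) *\<^sub>R b)"
    by (intro tendsto_sum tendsto_scaleR tendsto_const)
  then show ?thesis by (simp add: euclidean_representation)
qed

lemma grad_integrand_measurable:
  fixes u :: "real^'n \<Rightarrow> ereal"
  assumes u: "u \<in> Conv_sc T" and \<psi>: "continuous_on UNIV \<psi>"
  shows "grad_integrand \<psi> u \<in> borel_measurable lebesgue"
proof -
  define G where "G N x = (\<Sum>b\<in>Basis. (real (Suc N) * (rval u (x + b /\<^sub>R real (Suc N)) - rval u x)) *\<^sub>R b)" for N and x :: "real^'n"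
  define F where "F N x = indicator (dom_fun u) x *\<^sub>R \<psi> (G N x)" for N x
  have [measurable]: "u \<in> borel_measurable borel" "dom_fun u \<in> sets borel" "\<psi> \<in> borel_measurable borel"
    using borel_measurable_Conv_sc[OF u] dom_fun_borel[OF u] borel_measurable_continuous_onI[OF \<psi>] by auto
  have [measurable]: "G N \<in> borel_measurable borel" for N unfolding G_def by measurable
  have "F N \<in> borel_measurable borel" for N unfolding F_def by measurable
  then have "(\<lambda>x. lim (\<lambda>N. F N x)) \<in> borel_measurable borel" by (rule borel_measurable_lim_metric)
  then have m: "(\<lambda>x. lim (\<lambda>N. F N x)) \<in> borel_measurable lebesgue" by (simp add: measurable_completion)
  have "AE x in lebesgue. lim (\<lambda>N. F N x) = grad_integrand \<psi> u x"
    using AE_has_grad[OF u]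
  proof eventually_elim
    case (elim x)
    have "(\<lambda>N. F N x) \<longlonglongrightarrow> grad_integrand \<psi> u x"
    proof (cases "x \<in> dom_fun u")
      case True
      then have "(\<lambda>N. G N x) \<longlonglongrightarrow> grad u x"
        using elim difference_quotients_tendsto_grad unfolding G_def by blast
      then have "(\<lambda>N. \<psi> (G N x)) \<longlonglongrightarrow> \<psi> (grad u x)"
        using \<psi> by (metis UNIV_I continuous_on_eq_continuous_at isCont_tendsto_compose open_UNIV)
      then show ?thesis unfolding F_def grad_integrand_def by (intro tendsto_scaleR tendsto_const)
    qed (simp add: F_def grad_integrand_def)
    then show ?case by (rule limI)
  qed
  \<comment> \<open>The limit of the approximations agrees with the integrand only almost
    everywhere; completeness of \<open>lebesgue\<close> carries measurability over.\<close>
  then show ?thesis by (rule borel_measurable_AE[OF m])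
qed

section \<open>Continuity of the gradient integral\<close>

lemma tendsto_if_subseq_limits:
  fixes X :: "nat \<Rightarrow> 'a::heine_borel"
  assumes b: "bounded (range X)"
    and lim: "\<And>\<sigma> p. strict_mono \<sigma> \<Longrightarrow> (X \<circ> \<sigma>) \<longlonglongrightarrow> p \<Longrightarrow> p = g"
  shows "X \<longlonglongrightarrow> g"
proof (rule ccontr)
  assume "\<not> X \<longlonglongrightarrow> g"
  then obtain e where e: "e > 0" "\<And>N. \<exists>n\<ge>N. dist (X n) g \<ge> e"
    unfolding lim_sequentially by (meson not_less)
  then have inf: "infinite {n. dist (X n) g \<ge> e}" by (simp add: infinite_nat_iff_unbounded_le)
  define \<sigma> where "\<sigma> = enumerate {n. dist (X n) g \<ge> e}"
  have s: "strict_mono \<sigma>" unfolding \<sigma>_def by (rule strict_mono_enumerate[OF inf])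
  have far: "dist (X (\<sigma> n)) g \<ge> e" for n using enumerate_in_set[OF inf, of n] by (simp add: \<sigma>_def)
  have "bounded (range (X \<circ> \<sigma>))" using b by (rule bounded_subset) auto
  then obtain p r where r: "strict_mono r" "((X \<circ> \<sigma>) \<circ> r) \<longlonglongrightarrow> p"
    using bounded_imp_convergent_subsequence by blast
  have "(X \<circ> (\<sigma> \<circ> r)) \<longlonglongrightarrow> p" using r(2) by (simp add: o_assoc)
  then have "p = g" using lim[OF strict_mono_o[OF s r(1)]] by blast
  then have "\<forall>\<^sub>F n in sequentially. dist (((X \<circ> \<sigma>) \<circ> r) n) g < e" using r(2) e(1) by (auto simp: tendsto_iff)
  then obtain n where "dist (((X \<circ> \<sigma>) \<circ> r) n) g < e" by (auto simp: eventually_sequentially)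
  then show False using far[of "r n"] by simp
qed

lemma Conv_sc_sublevel_convex:
  assumes u: "u \<in> Conv_sc T"
  shows "convex {x. u x \<le> ereal t}"
proof -
  have eq: "{x. u x \<le> ereal t} = {x \<in> dom_fun u. rval u x \<le> t}"
    using le_in_dom[of u _ t] ereal_rval[OF u] by (metis (no_types, lifting) Collect_cong ereal_less_eq(3))
  show ?thesis unfolding eq convex_def
  proof (intro ballI allI impI)
    fix x y and a b :: real
    assume x: "x \<in> {x \<in> dom_fun u. rval u x \<le> t}" and y: "y \<in> {x \<in> dom_fun u. rval u x \<le> t}" and ab: "0 \<le> a" "0 \<le> b" "a + b = 1"
    have "a *\<^sub>R x + b *\<^sub>R y \<in> dom_fun u"
      using x y ab Conv_sc_convex_dom[OF u] by (auto intro!: convexD)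
    moreover have "rval u (a *\<^sub>R x + b *\<^sub>R y) \<le> a * rval u x + b * rval u y"
      using x y ab Conv_sc_convex_on[OF u] by (auto simp: convex_on_def)
    moreover have "a * rval u x + b * rval u y \<le> a * t + b * t"
      using x y ab by (intro add_mono mult_left_mono) auto
    moreover have "a * t + b * t = t" using ab by (metis distrib_right mult_1)
    ultimately show "a *\<^sub>R x + b *\<^sub>R y \<in> {x \<in> dom_fun u. rval u x \<le> t}" by auto
  qed
qed

lemma epi_converges_lower:
  assumes "epi_converges us u" "ereal t < u x"
  shows "\<forall>\<^sub>F k in sequentially. ereal t < us k x"
proof -
  have "u x \<le> liminf (\<lambda>k. us k x)" using assms(1) tendsto_const[of x] unfolding epi_converges_def by blast
  then show ?thesis using assms(2) by (intro less_LiminfD) simp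
qed

text \<open>The vertices of a cross-polytope around \<open>x\<close> are approached by points where the \<open>us k\<close> stay
  bounded; a point near \<open>x\<close> outside the sublevel set would be separated from these points.\<close>

lemma epi_converges_locally_bounded:
  fixes u :: "real^'n \<Rightarrow> ereal"
  assumes us: "\<And>k. us k \<in> Conv_sc T" and u: "u \<in> Conv_sc T" and ep: "epi_converges us u"
    and x: "x \<in> interior (dom_fun u)"
  obtains r M where "r > 0" "\<forall>\<^sub>F k in sequentially. \<forall>y\<in>ball x r. us k y \<le> ereal M"
proof -
  obtain e where e: "e > 0" "ball x e \<subseteq> dom_fun u" using x by (auto simp: mem_interior)
  define d where "d = e / 2"
  have d: "d > 0" using e by (simp add: d_def)
  define n where "n = real DIM(real^'n)"
  have n: "n \<ge> 1" unfolding n_def using DIM_positive[where 'a="real^'n"] by linarith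
  define V where "V = (\<lambda>b. x + d *\<^sub>R b) ` Basis \<union> (\<lambda>b. x - d *\<^sub>R b) ` Basis"
  have V: "finite V" "V \<subseteq> dom_fun u"
  proof -
    show "V \<subseteq> dom_fun u" using e d by (force simp: V_def dist_norm d_def)
  qed (simp add: V_def)
  define M where "M = Max ((rval u) ` V) + 1"
  \<comment> \<open>Some axis vector c satisfies |a| \<le> n |a \<bullet> c| for the separating
    normal a, so along a one vertex lies behind x by at least d |a| / n = 4 r |a|. Errors of r at y
    and at the point near the vertex cannot make up for this.\<close>
  define r where "r = d / (4 * n)"
  have r: "r > 0" using d n by (simp add: r_def)
  have "\<forall>v\<in>V. \<exists>xs. \<forall>\<^sub>F k in sequentially. norm (xs k - v) < r \<and> us k (xs k) \<le> ereal M"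
  proof
    fix v assume v: "v \<in> V"
    then have vd: "v \<in> dom_fun u" using V by auto
    obtain xs where xs: "xs \<longlonglongrightarrow> v" "(\<lambda>k. rval (us k) (xs k)) \<longlonglongrightarrow> rval u v"
      "\<forall>\<^sub>F k in sequentially. xs k \<in> dom_fun (us k) \<and> us k (xs k) = ereal (rval (us k) (xs k))"
      using epi_converges_recovery[OF ep u vd] by blast
    have "rval u v < M" using v V by (auto simp: M_def intro: le_less_trans[OF Max_ge])
    then have "\<forall>\<^sub>F k in sequentially. rval (us k) (xs k) < M" using xs(2) by (rule order_tendstoD(2)[rotated])
    moreover have "\<forall>\<^sub>F k in sequentially. norm (xs k - v) < r"
      using xs(1) r by (auto simp: tendsto_iff dist_norm)
    ultimately have "\<forall>\<^sub>F k in sequentially. norm (xs k - v) < r \<and> us k (xs k) \<le> ereal M"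
      using xs(3) by eventually_elim (metis ereal_less_eq(3) less_imp_le)
    then show "\<exists>xs. \<forall>\<^sub>F k in sequentially. norm (xs k - v) < r \<and> us k (xs k) \<le> ereal M" by blast
  qed
  then obtain xs where xs: "\<And>v. v \<in> V \<Longrightarrow> \<forall>\<^sub>F k in sequentially. norm (xs v k - v) < r \<and> us k (xs v k) \<le> ereal M"
    by metis
  then have "\<forall>\<^sub>F k in sequentially. \<forall>v\<in>V. norm (xs v k - v) < r \<and> us k (xs v k) \<le> ereal M"
    using V(1) by (simp add: eventually_ball_finite)
  then have "\<forall>\<^sub>F k in sequentially. \<forall>y\<in>ball x r. us k y \<le> ereal M"
  proof eventually_elim
    case (elim k)
    show ?case
    proof (rule ballI, rule ccontr)
      fix y assume y: "y \<in> ball x r" and "\<not> us k y \<le> ereal M"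
      then have "y \<notin> {y. us k y \<le> ereal M}" by simp
      then obtain a b where ab: "a \<bullet> y < b" "\<And>z. us k z \<le> ereal M \<Longrightarrow> a \<bullet> z > b"
        using separating_hyperplane_closed_point[OF Conv_sc_sublevel_convex[OF us] Conv_sc_closed[OF us]]
        by (metis (mono_tags, lifting) mem_Collect_eq)
      have "\<exists>c\<in>Basis. norm a \<le> n * \<bar>a \<bullet> c\<bar>"
      proof (rule ccontr)
        assume "\<not> ?thesis"
        then have "\<bar>a \<bullet> c\<bar> < norm a / n" if "c \<in> Basis" for c
          using that n by (force simp: field_simps)
        then have "(\<Sum>c\<in>Basis. \<bar>a \<bullet> c\<bar>) < (\<Sum>c\<in>(Basis::(real^'n) set). norm a / n)"
          by (intro sum_strict_mono) auto
        also have "\<dots> = norm a" using n by (simp add: n_def)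
        finally show False using norm_le_l1[of a] by simp
      qed
      then obtain c where c: "c \<in> Basis" "norm a \<le> n * \<bar>a \<bullet> c\<bar>" by blast
      define v where "v = (if a \<bullet> c \<ge> 0 then x - d *\<^sub>R c else x + d *\<^sub>R c)"
      have v: "v \<in> V" using c by (auto simp: v_def V_def)
      have av: "a \<bullet> v = a \<bullet> x - d * \<bar>a \<bullet> c\<bar>" by (simp add: v_def algebra_simps)
      have "d * norm a \<le> d * (n * \<bar>a \<bullet> c\<bar>)" using c d by simp
      then have "4 * (norm a * r) \<le> d * \<bar>a \<bullet> c\<bar>" using n by (simp add: r_def field_simps)
      moreover have "a \<bullet> (xs v k - v) \<le> norm a * r"
        by (rule order_trans[OF norm_cauchy_schwarz mult_left_mono]) (use elim v in \<open>auto simp: less_imp_le\<close>)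
      moreover have "a \<bullet> (x - y) \<le> norm a * r"
        by (rule order_trans[OF norm_cauchy_schwarz mult_left_mono]) (use y in \<open>auto simp: dist_norm\<close>)
      moreover have "b < a \<bullet> xs v k" using ab(2) elim v by blast
      moreover have "0 \<le> norm a * r" using r by simp
      ultimately show False using ab(1) av by (simp add: inner_diff_right)
    qed
  qed
  then show ?thesis using that r by blast
qed

text \<open>Local boundedness bounds the gradients. Passing to the limit in the subgradient
  inequality along recovery sequences shows that each of their limit points is a subgradient of u at
  x, and at a point of differentiability there is only one.\<close>

lemma epi_converges_grad:
  fixes u :: "real^'n \<Rightarrow> ereal"
  assumes us: "\<And>k. us k \<in> Conv_sc T" and u: "u \<in> Conv_sc T" and ep: "epi_converges us u"
    and g: "has_grad u x g" and gk: "\<And>k. x \<in> dom_fun (us k) \<Longrightarrow> has_grad (us k) x (grad (us k) x)"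
  shows "\<forall>\<^sub>F k in sequentially. x \<in> dom_fun (us k)" "(\<lambda>k. grad (us k) x) \<longlonglongrightarrow> g"
proof -
  have xi: "x \<in> interior (dom_fun u)" "x \<in> dom_fun u" using g has_grad_in_dom by (auto simp: has_grad_def)
  obtain r M where rM: "r > 0" "\<forall>\<^sub>F k in sequentially. \<forall>y\<in>ball x r. us k y \<le> ereal M"
    using epi_converges_locally_bounded[OF us u ep xi(1)] by blast
  show dom: "\<forall>\<^sub>F k in sequentially. x \<in> dom_fun (us k)"
    using rM(2) by eventually_elim (use rM(1) in \<open>auto intro: le_in_dom\<close>)
  have low: "\<forall>\<^sub>F k in sequentially. rval (us k) x > rval u x - e" if "e > 0" for e
  proof -
    have "ereal (rval u x - e) < u x" using ereal_rval[OF u xi(2)] that by (metis diff_gt_0_iff_gt diff_strict_left_mono ereal_less(2) less_ereal.simps(1) diff_0_right)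
    from epi_converges_lower[OF ep this] dom show ?thesis
      by eventually_elim (metis ereal_rval[OF us] less_ereal.simps(1))
  qed
  define B where "B = 2 * (M - rval u x + 1) / r"
  have "\<forall>\<^sub>F k in sequentially. norm (grad (us k) x) \<le> B"
    using rM(2) dom low[OF zero_less_one]
  proof eventually_elim
    case (elim k)
    let ?g = "grad (us k) x"
    \<comment> \<open>A step of length r/2 along the gradient, which raises the affine minorant by
      r/2 times its norm. If the gradient is 0, then y = x since inverse 0 = 0.\<close>
    define y where "y = x + (r/2) *\<^sub>R (?g /\<^sub>R norm ?g)"
    have "norm (y - x) \<le> r/2" using rM(1) by (cases "?g = 0") (simp_all add: y_def)
    then have "y \<in> ball x r" using rM(1) by (simp add: dist_norm norm_minus_commute)
    then have y: "us k y \<le> ereal M" using elim by auto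
    then have yd: "y \<in> dom_fun (us k)" by (rule le_in_dom)
    have "rval (us k) x + ?g \<bullet> (y - x) \<le> rval (us k) y"
      by (rule has_grad_subgradient[OF us gk[OF elim(2)] yd])
    moreover have "rval (us k) y \<le> M" using y ereal_rval[OF us yd] by (metis ereal_less_eq(3))
    moreover have "?g \<bullet> (y - x) = (r/2) * norm ?g"
      by (cases "?g = 0") (simp_all add: y_def dot_square_norm power2_eq_square)
    ultimately have "(r/2) * norm ?g \<le> M - rval u x + 1" using elim(3) by linarith
    then show ?case using rM(1) by (simp add: B_def field_simps)
  qed
  then obtain N where N: "\<And>k. k \<ge> N \<Longrightarrow> norm (grad (us k) x) \<le> B" by (auto simp: eventually_sequentially)
  have "bounded (range (\<lambda>k. grad (us (k + N)) x))"
    using N by (auto simp: bounded_iff intro!: exI[of _ B])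
  then have "(\<lambda>k. grad (us (k + N)) x) \<longlonglongrightarrow> g"
  proof (rule tendsto_if_subseq_limits)
    fix \<sigma> p assume s: "strict_mono \<sigma>" and p: "((\<lambda>k. grad (us (k + N)) x) \<circ> \<sigma>) \<longlonglongrightarrow> p"
    define \<tau> where "\<tau> k = \<sigma> k + N" for k
    have t: "strict_mono \<tau>" using s by (simp add: strict_mono_def \<tau>_def)
    have p: "(\<lambda>k. grad (us (\<tau> k)) x) \<longlonglongrightarrow> p" using p by (simp add: o_def \<tau>_def)
    show "p = g"
    proof (rule has_grad_unique_subgradient[OF g])
      fix y assume y: "y \<in> dom_fun u"
      obtain ys where ys: "ys \<longlonglongrightarrow> y" "(\<lambda>k. rval (us k) (ys k)) \<longlonglongrightarrow> rval u y"
        "\<forall>\<^sub>F k in sequentially. ys k \<in> dom_fun (us k) \<and> us k (ys k) = ereal (rval (us k) (ys k))"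
        using epi_converges_recovery[OF ep u y] by blast
      show "rval u x + p \<bullet> (y - x) \<le> rval u y"
      proof (rule field_le_epsilon)
        fix e :: real assume e: "e > 0"
        have "\<forall>\<^sub>F k in sequentially. rval u x - e + grad (us k) x \<bullet> (ys k - x) \<le> rval (us k) (ys k)"
          using low[OF e] dom ys(3)
        proof eventually_elim
          case (elim k)
          then show ?case using has_grad_subgradient[OF us gk[OF elim(2)], of "ys k"] by linarith
        qed
        then have "\<forall>\<^sub>F k in sequentially. rval u x - e + grad (us (\<tau> k)) x \<bullet> (ys (\<tau> k) - x) \<le> rval (us (\<tau> k)) (ys (\<tau> k))"
          by (rule eventually_subseq[OF t])
        moreover have "(\<lambda>k. rval u x - e + grad (us (\<tau> k)) x \<bullet> (ys (\<tau> k) - x)) \<longlonglongrightarrow> rval u x - e + p \<bullet> (y - x)"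
          using LIMSEQ_subseq_LIMSEQ[OF ys(1) t] p by (intro tendsto_intros) (simp_all add: o_def)
        moreover have "(\<lambda>k. rval (us (\<tau> k)) (ys (\<tau> k))) \<longlonglongrightarrow> rval u y"
          using LIMSEQ_subseq_LIMSEQ[OF ys(2) t] by (simp add: o_def)
        ultimately have "rval u x - e + p \<bullet> (y - x) \<le> rval u y"
          by (intro tendsto_le[OF sequentially_bot])
        then show "rval u x + p \<bullet> (y - x) \<le> rval u y + e" by simp
      qed
    qed
  qed
  then show "(\<lambda>k. grad (us k) x) \<longlonglongrightarrow> g" by (rule LIMSEQ_offset)
qed

text \<open>The values \<open>us k x\<close> tend to infinity, while the values along a recovery
  sequence for some point of the domain stay bounded; an affine minorant that touches at x must be
  steep to bridge the gap.\<close>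

lemma epi_converges_grad_outside:
  fixes u :: "real^'n \<Rightarrow> ereal"
  assumes us: "\<And>k. us k \<in> Conv_sc T" and u: "u \<in> Conv_sc T" and ep: "epi_converges us u"
    and x: "x \<notin> dom_fun u"
  shows "\<forall>\<^sub>F k in sequentially. \<forall>g. has_grad (us k) x g \<longrightarrow> norm g > r"
proof -
  obtain x0 where x0: "x0 \<in> dom_fun u" using dom_fun_nonempty[OF u] by blast
  obtain ys where ys: "ys \<longlonglongrightarrow> x0" "(\<lambda>k. rval (us k) (ys k)) \<longlonglongrightarrow> rval u x0"
        "\<forall>\<^sub>F k in sequentially. ys k \<in> dom_fun (us k) \<and> us k (ys k) = ereal (rval (us k) (ys k))"
    using epi_converges_recovery[OF ep u x0] by blast
  define D where "D = norm (x0 - x) + 1"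
  define m where "m = rval u x0 + 1"
  have "\<forall>\<^sub>F k in sequentially. norm (ys k - x) < D"
    using order_tendstoD(2)[OF tendsto_norm[OF tendsto_diff[OF ys(1) tendsto_const]], of x D]
    by (simp add: D_def)
  moreover have "\<forall>\<^sub>F k in sequentially. rval (us k) (ys k) < m"
    using order_tendstoD(2)[OF ys(2), of m] by (simp add: m_def)
  moreover have "\<forall>\<^sub>F k in sequentially. ereal (m + \<bar>r\<bar> * D) < us k x"
    using epi_converges_lower[OF ep] not_in_dom[OF x] by simp
  ultimately show ?thesis using ys(3)
  proof eventually_elim
    case (elim k)
    show ?case
    proof (intro allI impI, rule ccontr)
      fix g assume g: "has_grad (us k) x g" and "\<not> r < norm g"
      then have ng: "norm g \<le> \<bar>r\<bar>" by simp
      have "rval (us k) x + g \<bullet> (ys k - x) \<le> rval (us k) (ys k)"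
        using has_grad_subgradient[OF us g] elim by blast
      moreover have "- (g \<bullet> (ys k - x)) \<le> norm g * norm (ys k - x)"
        using Cauchy_Schwarz_ineq2[of g "ys k - x"] by linarith
      moreover have "norm g * norm (ys k - x) \<le> \<bar>r\<bar> * D" using ng elim by (intro mult_mono) auto
      moreover have "m + \<bar>r\<bar> * D < rval (us k) x"
        using elim ereal_rval[OF us has_grad_in_dom[OF g]] by (metis less_ereal.simps(1))
      ultimately show False using elim by linarith
    qed
  qed
qed

text \<open>Compactness makes the pointwise lower bound uniform: violating points along a
  subsequence would accumulate at a point of S where u is too small.\<close>

lemma epi_converges_sphere:
  fixes u :: "real^'n \<Rightarrow> ereal"
  assumes ep: "epi_converges us u" and S: "compact S" and A: "\<And>y. y \<in> S \<Longrightarrow> u y > ereal A"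
  shows "\<forall>\<^sub>F k in sequentially. \<forall>y\<in>S. us k y > ereal A"
proof (rule ccontr)
  assume "\<not> ?thesis"
  then have inf: "infinite {k. \<exists>y\<in>S. us k y \<le> ereal A}"
    by (simp add: eventually_sequentially infinite_nat_iff_unbounded_le not_less)
  define \<sigma> where "\<sigma> = enumerate {k. \<exists>y\<in>S. us k y \<le> ereal A}"
  have s: "strict_mono \<sigma>" unfolding \<sigma>_def by (rule strict_mono_enumerate[OF inf])
  have "\<exists>y\<in>S. us (\<sigma> k) y \<le> ereal A" for k using enumerate_in_set[OF inf, of k] by (simp add: \<sigma>_def)
  then obtain ys where ys: "\<And>k. ys k \<in> S" "\<And>k. us (\<sigma> k) (ys k) \<le> ereal A" by metis
  obtain y r where y: "y \<in> S" "strict_mono r" "(ys \<circ> r) \<longlonglongrightarrow> y"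
    using S ys(1) unfolding compact_def by blast
  have "u y \<le> ereal A"
    by (rule epi_converges_subseq_le[OF ep strict_mono_o[OF s y(2)] y(3)]) (use ys(2) in simp)
  then show False using A[OF y(1)] by simp
qed

text \<open>Uniform coercivity: by convexity, large values on a sphere force steep gradients outside it.\<close>

lemma epi_converges_grad_large:
  fixes u :: "real^'n \<Rightarrow> ereal"
  assumes us: "\<And>k. us k \<in> Conv_sc T" and u: "u \<in> Conv_sc T" and ep: "epi_converges us u"
  obtains R where "\<forall>\<^sub>F k in sequentially. \<forall>x g. has_grad (us k) x g \<longrightarrow> norm x > R \<longrightarrow> norm g > r"
proof -
  obtain x0 where x0: "x0 \<in> dom_fun u" using dom_fun_nonempty[OF u] by blast
  obtain ys where ys: "ys \<longlonglongrightarrow> x0" "(\<lambda>k. rval (us k) (ys k)) \<longlonglongrightarrow> rval u x0"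
        "\<forall>\<^sub>F k in sequentially. ys k \<in> dom_fun (us k) \<and> us k (ys k) = ereal (rval (us k) (ys k))"
    using epi_converges_recovery[OF ep u x0] by blast
  define m where "m = rval u x0 + 1"
  define q where "q = \<bar>r\<bar> + 1"
  obtain R0 where R0: "R0 > 0" "\<And>y. y \<in> dom_fun u \<Longrightarrow> norm y \<ge> R0 \<Longrightarrow> rval u y \<ge> (q + 1) * norm y"
    using Conv_sc_coercive[OF u] by blast
  \<comment> \<open>The terms R0 + |x0| move the sphere around x0 into the region where u grows with
    slope q + 1. The other terms are chosen so that the surplus slope 1 pays for m: (q + 1) (\<rho>
    - |x0|) exceeds m + q (\<rho> + 1).\<close>
  define \<rho> where "\<rho> = R0 + norm x0 + \<bar>m\<bar> + 2 + (q + 1) * norm x0 + q"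
  have q: "q \<ge> 1" by (simp add: q_def)
  have \<rho>: "\<rho> \<ge> 1" "\<rho> \<ge> R0 + norm x0" using R0(1) q by (auto simp: \<rho>_def)
  \<comment> \<open>Points of the sphere are within \<rho> + 1 of \<open>ys k\<close>, as
    \<open>ys k\<close> is eventually within 1 of the centre; rising from below m to above A over
    this distance takes a slope larger than q.\<close>
  define A where "A = m + q * (\<rho> + 1)"
  have "\<forall>\<^sub>F k in sequentially. \<forall>y\<in>sphere x0 \<rho>. us k y > ereal A"
  proof (rule epi_converges_sphere[OF ep compact_sphere])
    fix y assume y: "y \<in> sphere x0 \<rho>"
    show "ereal A < u y"
    proof (cases "y \<in> dom_fun u")
      case True
      have "\<rho> \<le> norm y + norm x0" using y norm_triangle_ineq4[of x0 y] by (simp add: dist_norm)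
      then have ny: "norm y \<ge> \<rho> - norm x0" by simp
      then have "rval u y \<ge> (q + 1) * norm y" using R0(2)[OF True] \<rho> by simp
      moreover have "(q + 1) * norm y \<ge> (q + 1) * (\<rho> - norm x0)" using ny q by simp
      moreover have "(q + 1) * (\<rho> - norm x0) = q * (\<rho> + 1) + (\<rho> - q - (q+1) * norm x0)" by (simp add: algebra_simps)
      moreover have "\<rho> - q - (q+1) * norm x0 > m" using R0(1) norm_ge_zero[of x0] unfolding \<rho>_def by linarith
      ultimately have "A < rval u y" by (simp add: A_def)
      then show ?thesis using ereal_rval[OF u True] by (metis less_ereal.simps(1))
    qed (simp add: not_in_dom)
  qed
  moreover have "\<forall>\<^sub>F k in sequentially. dist (ys k) x0 < 1" using ys(1) by (auto simp: tendsto_iff)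
  moreover have "\<forall>\<^sub>F k in sequentially. rval (us k) (ys k) < m"
    using order_tendstoD(2)[OF ys(2), of m] by (simp add: m_def)
  ultimately have "\<forall>\<^sub>F k in sequentially. \<forall>x g. has_grad (us k) x g \<longrightarrow> norm x > \<rho> + norm x0 \<longrightarrow> norm g > r"
    using ys(3)
  proof eventually_elim
    case (elim k)
    show ?case
    proof (intro allI impI)
      fix x g assume g: "has_grad (us k) x g" and "norm x > \<rho> + norm x0"
      then have xr: "dist x x0 > \<rho>" using norm_triangle_ineq2[of x x0] by (simp add: dist_norm)
      have yd: "ys k \<in> dom_fun (us k)" and xd: "x \<in> dom_fun (us k)" using elim has_grad_in_dom[OF g] by auto
      let ?v = "x - ys k"
      \<comment> \<open>The segment from \<open>ys k\<close>, inside the sphere, to x, outside of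
        it, crosses the sphere.\<close>
      have "\<exists>s\<ge>0. s \<le> 1 \<and> dist (ys k + s *\<^sub>R ?v) x0 = \<rho>"
        by (rule IVT') (use elim(2) \<rho> xr in \<open>auto intro!: continuous_intros\<close>)
      then obtain s where s: "0 \<le> s" "s \<le> 1" "dist (ys k + s *\<^sub>R ?v) x0 = \<rho>" by blast
      then have s0: "s > 0" using elim(2) \<rho>(1) by (cases "s = 0") auto
      let ?y = "ys k + s *\<^sub>R ?v"
      have yA: "us k ?y > ereal A" using elim(1) s(3) by (simp add: dist_commute)
      have eqy: "?y = (1 - s) *\<^sub>R ys k + s *\<^sub>R x" by (simp add: algebra_simps)
      have "?y \<in> dom_fun (us k)"
        unfolding eqy using s by (intro convexD_alt[OF Conv_sc_convex_dom[OF us] yd xd]) auto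
      then have "A < rval (us k) ?y" using yA ereal_rval[OF us] by (metis less_ereal.simps(1))
      also have "\<dots> \<le> (1 - s) * rval (us k) (ys k) + s * rval (us k) x"
        unfolding eqy using s yd xd by (intro convex_onD[OF Conv_sc_convex_on[OF us]]) auto
      finally have "A < rval (us k) (ys k) + s * (rval (us k) x - rval (us k) (ys k))"
        by (simp add: algebra_simps)
      then have 1: "q * (\<rho> + 1) < s * (rval (us k) x - rval (us k) (ys k))"
        using elim(3) by (simp add: A_def)
      have "rval (us k) x + g \<bullet> (ys k - x) \<le> rval (us k) (ys k)" by (rule has_grad_subgradient[OF us g yd])
      then have "rval (us k) x - rval (us k) (ys k) \<le> g \<bullet> ?v" by (simp add: inner_diff_right)
      also have "\<dots> \<le> norm g * norm ?v" by (rule norm_cauchy_schwarz)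
      finally have "s * (rval (us k) x - rval (us k) (ys k)) \<le> s * (norm g * norm ?v)" using s by (intro mult_left_mono)
      also have "\<dots> = norm g * norm (s *\<^sub>R ?v)" using s by simp
      also have "\<dots> \<le> norm g * (\<rho> + 1)"
      proof (rule mult_left_mono)
        have "norm (s *\<^sub>R ?v) \<le> dist ?y x0 + dist (ys k) x0"
          using norm_triangle_ineq4[of "?y - x0" "ys k - x0"] by (simp add: dist_norm)
        then show "norm (s *\<^sub>R ?v) \<le> \<rho> + 1" using s elim(2) by simp
      qed simp
      finally have "q * (\<rho> + 1) < norm g * (\<rho> + 1)" using 1 by simp
      then have "q < norm g" using \<rho>(1) by simp
      then show "r < norm g" by (simp add: q_def)
    qed
  qed
  then show ?thesis by (rule that)
qed

lemma Cc_bounds: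
  fixes \<psi> :: "'a::euclidean_space \<Rightarrow> 'b::real_normed_vector"
  assumes "Cc \<psi>"
  obtains r B where "\<And>y. norm y > r \<Longrightarrow> \<psi> y = 0" "\<And>y. norm (\<psi> y) \<le> B" "B \<ge> 0"
proof -
  let ?K = "closure {x. \<psi> x \<noteq> 0}"
  have K: "compact ?K" "continuous_on UNIV \<psi>" using assms by (auto simp: Cc_def)
  obtain r where r: "\<And>y. y \<in> ?K \<Longrightarrow> norm y \<le> r" using compact_imp_bounded[OF K(1)] by (auto simp: bounded_iff)
  have "compact (\<psi> ` ?K)" using K continuous_on_subset by (blast intro: compact_continuous_image)
  then obtain B where B: "\<And>y. y \<in> ?K \<Longrightarrow> norm (\<psi> y) \<le> B"
    using compact_imp_bounded[of "\<psi> ` ?K"] by (force simp: bounded_iff)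
  have in_K: "\<psi> y \<noteq> 0 \<Longrightarrow> y \<in> ?K" for y using closure_subset[of "{x. \<psi> x \<noteq> 0}"] by auto
  show ?thesis
  proof (rule that[of r "max B 0"])
    show "\<psi> y = 0" if "norm y > r" for y using r in_K that by force
    show "norm (\<psi> y) \<le> max B 0" for y using B[of y] in_K[of y] by (cases "\<psi> y = 0") auto
  qed simp
qed

lemma grad_integrand_bound:
  assumes "\<And>y. norm y > r \<Longrightarrow> \<psi> y = 0" "\<And>y. norm (\<psi> y) \<le> B" "B \<ge> 0"
    and "\<And>g. has_grad u x g \<Longrightarrow> norm x > R \<Longrightarrow> norm g > r"
    and "x \<in> dom_fun u \<Longrightarrow> has_grad u x (grad u x)"
  shows "norm (grad_integrand \<psi> u x) \<le> indicator (cball 0 R) x * B"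
  using assms by (cases "x \<in> dom_fun u"; cases "norm x > R") (auto simp: grad_integrand_def)

text \<open>The uniform steepness far out holds only for late indices, so the dominating function
  \<open>indicator (cball 0 R) x * B\<close> is available only eventually, and integrability is
  stated in this form.\<close>

lemma
  fixes u :: "real^'n \<Rightarrow> ereal"
  assumes \<psi>: "Cc \<psi>" and us: "\<And>k. us k \<in> Conv_sc T" and u: "u \<in> Conv_sc T" and ep: "epi_converges us u"
  shows grad_integral_tendsto: "(\<lambda>k. grad_integral \<psi> (us k)) \<longlonglongrightarrow> grad_integral \<psi> u"
    and eventually_integrable_grad_integrand:
      "\<forall>\<^sub>F k in sequentially. integrable lebesgue (grad_integrand \<psi> (us k))"
proof -
  obtain r B where rB: "\<And>y. norm y > r \<Longrightarrow> \<psi> y = 0" "\<And>y. norm (\<psi> y) \<le> B" "B \<ge> 0"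
    using Cc_bounds[OF \<psi>] by blast
  have cont: "continuous_on UNIV \<psi>" using \<psi> by (simp add: Cc_def)
  obtain R where "\<forall>\<^sub>F k in sequentially. \<forall>x g. has_grad (us k) x g \<longrightarrow> norm x > R \<longrightarrow> norm g > r"
    using epi_converges_grad_large[OF us u ep] by blast
  then obtain N where N: "\<And>k x g. k \<ge> N \<Longrightarrow> has_grad (us k) x g \<Longrightarrow> norm x > R \<Longrightarrow> norm g > r"
    by (auto simp: eventually_sequentially)
  have AEk: "AE x in lebesgue. \<forall>k. x \<in> dom_fun (us k) \<longrightarrow> has_grad (us k) x (grad (us k) x)"
    using AE_has_grad[OF us] by (simp add: AE_all_countable)
  have fin: "integrable lebesgue (\<lambda>x. indicator (cball (0::real^'n) R) x * B)"
    using emeasure_compact_finite[OF compact_cball[of "0::real^'n" R]]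
    by (intro integrable_mult_left integrable_real_indicator) auto
  have bd: "AE x in lebesgue. norm (grad_integrand \<psi> (us k) x) \<le> indicator (cball 0 R) x * B" if "k \<ge> N" for k
    using AEk by eventually_elim (rule grad_integrand_bound[OF rB N[OF that]]; blast)
  have lim: "AE x in lebesgue. (\<lambda>k. grad_integrand \<psi> (us k) x) \<longlonglongrightarrow> grad_integrand \<psi> u x"
    using AEk AE_has_grad[OF u]
  proof eventually_elim
    case (elim x)
    show ?case
    proof (cases "x \<in> dom_fun u")
      case True
      have g: "has_grad u x (grad u x)" using elim True by blast
      have d: "\<forall>\<^sub>F k in sequentially. x \<in> dom_fun (us k)" and l: "(\<lambda>k. grad (us k) x) \<longlonglongrightarrow> grad u x"
        using epi_converges_grad[OF us u ep g] elim(1) by blast+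
      have "(\<lambda>k. \<psi> (grad (us k) x)) \<longlonglongrightarrow> \<psi> (grad u x)"
        using cont l by (metis UNIV_I continuous_on_eq_continuous_at isCont_tendsto_compose open_UNIV)
      moreover have "\<forall>\<^sub>F k in sequentially. \<psi> (grad (us k) x) = grad_integrand \<psi> (us k) x"
        using d by eventually_elim (simp add: grad_integrand_def)
      ultimately have "(\<lambda>k. grad_integrand \<psi> (us k) x) \<longlonglongrightarrow> \<psi> (grad u x)"
        by (rule Lim_transform_eventually)
      then show ?thesis using True by (simp add: grad_integrand_def)
    next
      case False
      have "\<forall>\<^sub>F k in sequentially. grad_integrand \<psi> (us k) x = 0"
        using epi_converges_grad_outside[OF us u ep False, of r]
      proof eventually_elim
        case (elim k)
        then show ?case using \<open>\<forall>k. x \<in> dom_fun (us k) \<longrightarrow> has_grad (us k) x (grad (us k) x)\<close> rB(1)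
          by (cases "x \<in> dom_fun (us k)") (auto simp: grad_integrand_def)
      qed
      then show ?thesis using False by (simp add: grad_integrand_def tendsto_eventually)
    qed
  qed
  have meas: "grad_integrand \<psi> u \<in> borel_measurable lebesgue" "\<And>k. grad_integrand \<psi> (us k) \<in> borel_measurable lebesgue"
    using grad_integrand_measurable[OF _ cont] us u by blast+
  have "(\<lambda>k. LINT x|lebesgue. grad_integrand \<psi> (us (k + N)) x) \<longlonglongrightarrow> (LINT x|lebesgue. grad_integrand \<psi> u x)"
  proof (rule integral_dominated_convergence[OF _ _ fin])
    show "AE x in lebesgue. (\<lambda>k. grad_integrand \<psi> (us (k + N)) x) \<longlonglongrightarrow> grad_integrand \<psi> u x"
      using lim by eventually_elim (rule LIMSEQ_ignore_initial_segment)
  qed (use meas bd in auto)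
  then show "(\<lambda>k. grad_integral \<psi> (us k)) \<longlonglongrightarrow> grad_integral \<psi> u"
    unfolding grad_integral_eq by (rule LIMSEQ_offset)
  have "integrable lebesgue (grad_integrand \<psi> (us k))" if "k \<ge> N" for k
  proof (rule Bochner_Integration.integrable_bound[OF fin meas(2)])
    show "AE x in lebesgue. norm (grad_integrand \<psi> (us k) x) \<le> norm (indicator (cball 0 R) x * B)"
      using bd[OF that] rB(3) by (auto simp: indicator_def)
  qed
  then show "\<forall>\<^sub>F k in sequentially. integrable lebesgue (grad_integrand \<psi> (us k))"
    by (auto simp: eventually_sequentially)
qed

text \<open>Eventual integrability along the constant sequence u is integrability for u.\<close>

lemma integrable_grad_integrand:
  assumes "Cc \<psi>" "u \<in> Conv_sc T"
  shows "integrable lebesgue (grad_integrand \<psi> u)"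
  using eventually_integrable_grad_integrand[OF assms(1) _ assms(2) epi_converges_const[OF assms(2)]] assms(2)
  by (auto simp: eventually_sequentially)

lemma epi_continuous_grad_integral: "Cc \<psi> \<Longrightarrow> epi_continuous (Conv_sc T) (grad_integral \<psi>)"
  unfolding epi_continuous_def using grad_integral_tendsto by blast

section \<open>The gradient integral as a valuation\<close>

text \<open>A subgradient of the lower function at a contact point is also a subgradient of the
  upper one.\<close>

lemma has_grad_touching:
  assumes a: "a \<in> Conv_sc T" and b: "b \<in> Conv_sc T" and le: "\<And>y. a y \<le> b y" and eq: "a x = b x"
    and p: "has_grad a x p" and q: "has_grad b x q"
  shows "p = q"
proof (rule has_grad_unique_subgradient[OF q])
  fix y assume y: "y \<in> dom_fun b"
  then have ya: "y \<in> dom_fun a" using le[of y] by (auto simp: dom_fun_def)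
  have "rval a y \<le> rval b y" using le[of y] ereal_rval[OF a ya] ereal_rval[OF b y] by (metis ereal_less_eq(3))
  then show "rval b x + p \<bullet> (y - x) \<le> rval b y" using has_grad_subgradient[OF a p ya] eq by simp
qed

lemma grad_integrand_touching:
  assumes a: "a \<in> Conv_sc T" and b: "b \<in> Conv_sc T" and le: "\<And>y. a y \<le> b y" and eq: "a x = b x"
    and "x \<in> dom_fun a \<longrightarrow> has_grad a x (grad a x)" "x \<in> dom_fun b \<longrightarrow> has_grad b x (grad b x)"
  shows "grad_integrand \<psi> a x = grad_integrand \<psi> b x"
proof -
  have iff: "x \<in> dom_fun a \<longleftrightarrow> x \<in> dom_fun b" using eq by (simp add: dom_fun_def)
  have "grad a x = grad b x" if "x \<in> dom_fun a"
    by (rule has_grad_touching[OF a b le eq]) (use assms(5,6) iff that in blast)+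
  then show ?thesis using iff by (auto simp: grad_integrand_def indicator_def)
qed

text \<open>At almost every x the maximum touches the larger and the minimum touches the smaller of
  u and w, so the integrands agree in pairs; no description of the set where u = w is
  required.\<close>

lemma is_valuation_grad_integral:
  fixes T :: "('n::finite) itself"
  assumes \<psi>: "Cc (\<psi> :: real^'n \<Rightarrow> real^'n)"
  shows "is_valuation (Conv_sc T) (grad_integral \<psi>)"
  unfolding is_valuation_def
proof (intro ballI impI)
  fix u w :: "real^'n \<Rightarrow> ereal"
  let ?M = "\<lambda>x. max (u x) (w x)" and ?m = "\<lambda>x. min (u x) (w x)"
  assume c: "u \<in> Conv_sc T" "w \<in> Conv_sc T" "?M \<in> Conv_sc T" "?m \<in> Conv_sc T"
  have ae: "AE x in lebesgue. grad_integrand \<psi> ?M x + grad_integrand \<psi> ?m x = grad_integrand \<psi> u x + grad_integrand \<psi> w x"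
    using AE_has_grad[OF c(1)] AE_has_grad[OF c(2)] AE_has_grad[OF c(3)] AE_has_grad[OF c(4)]
  proof eventually_elim
    case (elim x)
    show ?case
    proof (cases "u x \<le> w x")
      case True
      then have "grad_integrand \<psi> w x = grad_integrand \<psi> ?M x" "grad_integrand \<psi> ?m x = grad_integrand \<psi> u x"
        using elim c by (auto intro!: grad_integrand_touching)
      then show ?thesis by simp
    next
      case False
      then have "grad_integrand \<psi> u x = grad_integrand \<psi> ?M x" "grad_integrand \<psi> ?m x = grad_integrand \<psi> w x"
        using elim c by (auto intro!: grad_integrand_touching)
      then show ?thesis by simp
    qed
  qed
  have i: "integrable lebesgue (grad_integrand \<psi> v)" if "v \<in> Conv_sc T" for v
    using integrable_grad_integrand[OF \<psi> that] .
  have m: "grad_integrand \<psi> v \<in> borel_measurable lebesgue" if "v \<in> Conv_sc T" for v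
    using i[OF that] by (rule borel_measurable_integrable)
  show "grad_integral \<psi> ?M + grad_integral \<psi> ?m = grad_integral \<psi> u + grad_integral \<psi> w"
    unfolding grad_integral_eq
      Bochner_Integration.integral_add[OF i[OF c(1)] i[OF c(2)], symmetric]
      Bochner_Integration.integral_add[OF i[OF c(3)] i[OF c(4)], symmetric]
    by (intro integral_cong_AE borel_measurable_add m c ae)
qed

section \<open>Invariance under similarities: translations, dilations and orthogonal maps\<close>

lemma Conv_sc_affine:
  fixes u :: "real^'n \<Rightarrow> ereal" and f :: "real^'n \<Rightarrow> real^'n"
  assumes u: "u \<in> Conv_sc T" and f: "linear f" and nf: "\<And>x. norm (f x) = s * norm x" and s: "s > 0" and l: "l > 0"
  shows "(\<lambda>x. ereal l * u (f x + b) + ereal c) \<in> Conv_sc T"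
proof (rule Conv_scI)
  let ?v = "\<lambda>x. ereal l * u (f x + b) + ereal c"
  have "inj f" using f nf s by (simp add: linear_injective_0) (metis less_numeral_extra(3) mult_eq_0_iff norm_eq_zero)
  then have "surj f" using f linear_injective_imp_surjective by blast
  have cf: "continuous_on UNIV (\<lambda>x. f x + b)"
    using f by (intro continuous_intros linear_continuous_on) (simp add: linear_conv_bounded_linear)
  have dom: "dom_fun ?v = {x. f x + b \<in> dom_fun u}"
  proof -
    have "?v x < \<infinity> \<longleftrightarrow> u (f x + b) < \<infinity>" for x using l by (cases "u (f x + b)") auto
    then show ?thesis by (simp add: dom_fun_def)
  qed
  have rv: "rval ?v x = l * rval u (f x + b) + c" if "x \<in> dom_fun ?v" for x
  proof -
    have "ereal (rval u (f x + b)) = u (f x + b)" using that ereal_rval[OF u] unfolding dom by blast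
    then show ?thesis by (cases "u (f x + b)") auto
  qed
  obtain y where "y \<in> dom_fun u" using dom_fun_nonempty[OF u] by blast
  moreover obtain x where "f x = y - b" using \<open>surj f\<close> by (metis surjD)
  ultimately have "f x + b \<in> dom_fun u" by simp
  then show "\<exists>x. x \<in> dom_fun ?v" unfolding dom by blast
  show "?v x \<noteq> -\<infinity>" for x using Conv_sc_not_MInf[OF u, of "f x + b"] l by (cases "u (f x + b)") auto
  show "closed {x. ?v x \<le> ereal t}" for t
  proof -
    have "?v x \<le> ereal t \<longleftrightarrow> u (f x + b) \<le> ereal ((t - c) / l)" for x
      using Conv_sc_not_MInf[OF u, of "f x + b"] l by (cases "u (f x + b)") (auto simp: field_simps)
    then have "{x. ?v x \<le> ereal t} = UNIV \<inter> (\<lambda>x. f x + b) -` {y. u y \<le> ereal ((t - c) / l)}" by auto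
    then show ?thesis using continuous_closed_preimage[OF cf closed_UNIV Conv_sc_closed[OF u]] by metis
  qed
  show "convex_on (dom_fun ?v) (rval ?v)"
    unfolding convex_on_def
  proof (intro conjI ballI allI impI)
    have eqf: "f (p *\<^sub>R x + q *\<^sub>R y) + b = p *\<^sub>R (f x + b) + q *\<^sub>R (f y + b)" if "p + q = 1" for x y and p q :: real
    proof -
      have "b = (p + q) *\<^sub>R b" using that by simp
      then have "f (p *\<^sub>R x + q *\<^sub>R y) + b = p *\<^sub>R f x + q *\<^sub>R f y + (p + q) *\<^sub>R b"
        by (simp add: linear_add[OF f] linear_scale[OF f])
      then show ?thesis by (simp add: algebra_simps)
    qed
    show cv: "convex (dom_fun ?v)"
      unfolding convex_def dom using convexD[OF Conv_sc_convex_dom[OF u]] by (auto simp: eqf)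
    fix x y and p q :: real assume x: "x \<in> dom_fun ?v" and y: "y \<in> dom_fun ?v" and pq: "0 \<le> p" "0 \<le> q" "p + q = 1"
    have xy: "p *\<^sub>R x + q *\<^sub>R y \<in> dom_fun ?v" using cv x y pq by (simp add: convexD)
    have "rval u (p *\<^sub>R (f x + b) + q *\<^sub>R (f y + b)) \<le> p * rval u (f x + b) + q * rval u (f y + b)"
      using Conv_sc_convex_on[OF u] x y pq unfolding convex_on_def dom by blast
    then have "l * rval u (p *\<^sub>R (f x + b) + q *\<^sub>R (f y + b)) + c \<le> l * (p * rval u (f x + b) + q * rval u (f y + b)) + (p + q) * c"
      using l pq by simp
    then show "rval ?v (p *\<^sub>R x + q *\<^sub>R y) \<le> p * rval ?v x + q * rval ?v y"
      unfolding rv[OF xy] rv[OF x] rv[OF y] unfolding eqf[OF pq(3)] by (simp add: algebra_simps)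
  qed
  show "\<exists>R. \<forall>x\<in>dom_fun ?v. R \<le> norm x \<longrightarrow> C * norm x \<le> rval ?v x" for C
  proof -
    \<comment> \<open>Chosen so that l * K * s = |C| + 1; the surplus slope 1 absorbs the constants
      that stem from b and c.\<close>
    define K where "K = (\<bar>C\<bar> + 1) / (s * l)"
    have K: "K \<ge> 0" using s l by (simp add: K_def)
    obtain R where R: "R > 0" "\<And>y. y \<in> dom_fun u \<Longrightarrow> norm y \<ge> R \<Longrightarrow> rval u y \<ge> K * norm y"
      using Conv_sc_coercive[OF u] by blast
    show ?thesis
    proof (intro exI[of _ "max ((R + norm b) / s) (l * K * norm b + \<bar>c\<bar>)"] ballI impI)
      fix x assume x: "x \<in> dom_fun ?v" and n: "max ((R + norm b) / s) (l * K * norm b + \<bar>c\<bar>) \<le> norm x"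
      have nb: "norm (f x + b) \<ge> s * norm x - norm b"
        using norm_triangle_ineq4[of "f x + b" b] nf[of x] by simp
      have "R + norm b \<le> s * norm x" using n s by (simp add: field_simps)
      then have "norm (f x + b) \<ge> R" using nb by simp
      then have "rval u (f x + b) \<ge> K * norm (f x + b)" using R(2) x by (simp add: dom)
      moreover have "K * norm (f x + b) \<ge> K * (s * norm x - norm b)" using nb K by (rule mult_left_mono)
      ultimately have "l * rval u (f x + b) \<ge> l * (K * (s * norm x - norm b))" using l by simp
      moreover have "l * (K * (s * norm x - norm b)) = (\<bar>C\<bar> + 1) * norm x - l * K * norm b"
        using s l by (simp add: K_def field_simps)
      ultimately have "rval ?v x \<ge> (\<bar>C\<bar> + 1) * norm x - l * K * norm b - \<bar>c\<bar>" unfolding rv[OF x] by linarith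
      moreover have "C * norm x \<le> \<bar>C\<bar> * norm x" by (intro mult_right_mono) auto
      ultimately show "C * norm x \<le> rval ?v x" using n by (simp add: algebra_simps)
    qed
  qed
qed

text \<open>Epi-multiplication, translation and vertical shift in one operation: a single formula
  with factor l ^ n then expresses both homogeneity and epi-translation invariance.\<close>

definition scale_fun :: "real \<Rightarrow> real^'n \<Rightarrow> real \<Rightarrow> (real^'n \<Rightarrow> ereal) \<Rightarrow> real^'n \<Rightarrow> ereal" where
  "scale_fun l x0 c u = (\<lambda>x. ereal l * u ((x - x0) /\<^sub>R l) + ereal c)"

lemma scale_fun_Conv_sc:
  assumes "u \<in> Conv_sc T" "l > 0"
  shows "scale_fun l x0 c u \<in> Conv_sc T"
proof -
  have "(\<lambda>x. ereal l * u (x /\<^sub>R l + (- x0 /\<^sub>R l)) + ereal c) \<in> Conv_sc T"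
    by (rule Conv_sc_affine[OF assms(1), where s = "1 / l"])
       (use assms(2) in \<open>auto simp: linear_iff algebra_simps divide_inverse\<close>)
  then show ?thesis by (simp add: scale_fun_def scaleR_diff_right)
qed

lemma dom_scale_fun: "l > 0 \<Longrightarrow> x \<in> dom_fun (scale_fun l x0 c u) \<longleftrightarrow> (x - x0) /\<^sub>R l \<in> dom_fun u"
  unfolding dom_fun_def scale_fun_def by (cases "u ((x - x0) /\<^sub>R l)") auto

lemma scale_fun_inverse:
  assumes "l > 0"
  shows "scale_fun (1/l) (- x0 /\<^sub>R l) (- c / l) (scale_fun l x0 c u) = u"
proof
  fix x
  have e: "((x - - x0 /\<^sub>R l) /\<^sub>R (1 / l) - x0) /\<^sub>R l = x" using assms by (simp add: algebra_simps)
  show "scale_fun (1/l) (- x0 /\<^sub>R l) (- c / l) (scale_fun l x0 c u) x = u x"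
    unfolding scale_fun_def e using assms by (cases "u x") (auto simp: field_simps)
qed

lemma has_grad_scale_fun_aux:
  assumes u: "u \<in> Conv_sc T" and l: "l > 0" and g: "has_grad u ((x - x0) /\<^sub>R l) g"
  shows "has_grad (scale_fun l x0 c u) x g"
proof -
  define \<phi> where "\<phi> = (\<lambda>x. (x - x0) /\<^sub>R l)"
  let ?I = "\<phi> -` interior (dom_fun u)"
  have op: "open ?I" unfolding \<phi>_def by (intro open_vimage) (auto intro!: continuous_intros)
  have sub: "?I \<subseteq> dom_fun (scale_fun l x0 c u)"
    using interior_subset[of "dom_fun u"] dom_scale_fun[OF l, of _ x0 c u] by (auto simp: \<phi>_def)
  have x: "x \<in> ?I" using g by (simp add: has_grad_def \<phi>_def)
  have xi: "x \<in> interior (dom_fun (scale_fun l x0 c u))" using interior_maximal[OF sub op] x by blast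
  have d: "(\<phi> has_derivative (\<lambda>h. h /\<^sub>R l)) (at x)" unfolding \<phi>_def by (auto intro!: derivative_eq_intros)
  have "(rval u has_derivative (\<lambda>h. g \<bullet> h)) (at (\<phi> x))" using g by (simp add: has_grad_def \<phi>_def)
  from has_derivative_compose[OF d this]
  have "((\<lambda>x. l * rval u (\<phi> x) + c) has_derivative (\<lambda>h. l * (g \<bullet> (h /\<^sub>R l)))) (at x)"
    by (auto intro!: derivative_eq_intros)
  then have "((\<lambda>x. l * rval u (\<phi> x) + c) has_derivative (\<lambda>h. g \<bullet> h)) (at x)"
    using l by (simp add: mult.assoc[symmetric])
  then have "(rval (scale_fun l x0 c u) has_derivative (\<lambda>h. g \<bullet> h)) (at x)"
  proof (rule has_derivative_transform_within_open[OF _ op x])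
    fix y assume "y \<in> ?I"
    then have "\<phi> y \<in> dom_fun u" using interior_subset by auto
    from ereal_rval[OF u this] show "l * rval u (\<phi> y) + c = rval (scale_fun l x0 c u) y"
      unfolding scale_fun_def \<phi>_def by (cases "u ((y - x0) /\<^sub>R l)") auto
  qed
  then show ?thesis using xi by (simp add: has_grad_def)
qed

text \<open>The backward direction is the forward direction applied to the inverse scaling.
  Gradients are carried along unchanged, since the factors l and 1/l cancel; hence the degree n
  comes from the change of volume alone.\<close>

lemma has_grad_scale_fun:
  assumes u: "u \<in> Conv_sc T" and l: "l > 0"
  shows "has_grad (scale_fun l x0 c u) x g \<longleftrightarrow> has_grad u ((x - x0) /\<^sub>R l) g"
proof
  assume "has_grad (scale_fun l x0 c u) x g"
  moreover have "((x - x0) /\<^sub>R l - - x0 /\<^sub>R l) /\<^sub>R (1 / l) = x" using l by (simp add: algebra_simps)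
  ultimately have "has_grad (scale_fun l x0 c u) (((x - x0) /\<^sub>R l - - x0 /\<^sub>R l) /\<^sub>R (1 / l)) g" by simp
  then have "has_grad (scale_fun (1/l) (- x0 /\<^sub>R l) (- c / l) (scale_fun l x0 c u)) ((x - x0) /\<^sub>R l) g"
    using l by (intro has_grad_scale_fun_aux[OF scale_fun_Conv_sc[OF u]]) auto
  then show "has_grad u ((x - x0) /\<^sub>R l) g" by (simp only: scale_fun_inverse[OF l])
qed (rule has_grad_scale_fun_aux[OF u l])

lemma grad_scale_fun:
  assumes "u \<in> Conv_sc T" "l > 0"
  shows "grad (scale_fun l x0 c u) x = grad u ((x - x0) /\<^sub>R l)"
  using has_grad_scale_fun[OF assms] has_grad_grad grad_eq_0 by metis

lemma lebesgue_integral_scale: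
  fixes f :: "'a::euclidean_space \<Rightarrow> 'b::{banach, second_countable_topology}"
  assumes f: "f \<in> borel_measurable lebesgue" and l: "l > 0"
  shows "(LINT x|lebesgue. f ((x - x0) /\<^sub>R l)) = l ^ DIM('a) *\<^sub>R (LINT x|lebesgue. f x)"
proof -
  have T: "(\<lambda>x. t + (\<Sum>j\<in>Basis. (c * (x \<bullet> j)) *\<^sub>R j)) = (\<lambda>x. t + c *\<^sub>R x)" for c and t :: 'a
    unfolding scaleR_scaleR[symmetric] scaleR_sum_right[symmetric] euclidean_representation ..
  have m: "(\<lambda>x. t + c *\<^sub>R x) \<in> lebesgue \<rightarrow>\<^sub>M lebesgue" if "c \<noteq> 0" for c and t :: 'a
    using lebesgue_affine_measurable[of "\<lambda>_. c" t] that unfolding T by simp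
  define h where "h x = f ((x - x0) /\<^sub>R l)" for x
  have "(\<lambda>x. f ((- x0 /\<^sub>R l) + (1/l) *\<^sub>R x)) \<in> borel_measurable lebesgue"
    using m[of "1/l" "- x0 /\<^sub>R l"] l by (intro measurable_compose[OF _ f]) auto
  moreover have "(- x0 /\<^sub>R l) + (1/l) *\<^sub>R x = (x - x0) /\<^sub>R l" for x by (simp add: algebra_simps divide_inverse)
  ultimately have h: "h \<in> borel_measurable lebesgue" unfolding h_def[abs_def] by simp
  have eq: "lebesgue = density (distr lebesgue lebesgue (\<lambda>x. x0 + l *\<^sub>R x)) (\<lambda>_. ennreal (l ^ DIM('a)))"
    using lebesgue_affine_euclidean[of "\<lambda>_. l" x0] l unfolding T by simp
  have "(LINT x|lebesgue. h x) = (LINT x|density (distr lebesgue lebesgue (\<lambda>x. x0 + l *\<^sub>R x)) (\<lambda>_. ennreal (l ^ DIM('a))). h x)"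
    using eq by simp
  also have "\<dots> = (LINT x|distr lebesgue lebesgue (\<lambda>x. x0 + l *\<^sub>R x). l ^ DIM('a) *\<^sub>R h x)"
    using h l by (intro integral_density) auto
  also have "\<dots> = (LINT x|lebesgue. l ^ DIM('a) *\<^sub>R h (x0 + l *\<^sub>R x))"
    using h l m[of l x0] by (intro integral_distr) auto
  also have "\<dots> = l ^ DIM('a) *\<^sub>R (LINT x|lebesgue. f x)" using l by (simp add: h_def)
  finally show ?thesis by (simp add: h_def)
qed

lemma grad_integral_scale_fun:
  fixes u :: "real^'n \<Rightarrow> ereal"
  assumes \<psi>: "Cc \<psi>" and u: "u \<in> Conv_sc T" and l: "l > 0"
  shows "grad_integral \<psi> (scale_fun l x0 c u) = l ^ CARD('n) *\<^sub>R grad_integral \<psi> u"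
proof -
  have "grad_integrand \<psi> (scale_fun l x0 c u) = (\<lambda>x. grad_integrand \<psi> u ((x - x0) /\<^sub>R l))"
    by (rule ext) (simp add: grad_integrand_def indicator_def dom_scale_fun[OF l] grad_scale_fun[OF u l])
  then show ?thesis
    unfolding grad_integral_eq
    using lebesgue_integral_scale[OF borel_measurable_integrable[OF integrable_grad_integrand[OF \<psi> u]] l] by simp
qed

lemma epi_translation_invariant_grad_integral:
  fixes T :: "('n::finite) itself"
  assumes \<psi>: "Cc (\<psi> :: real^'n \<Rightarrow> real^'n)"
  shows "epi_translation_invariant (Conv_sc T) (grad_integral \<psi>)"
  unfolding epi_translation_invariant_def
proof (intro ballI allI)
  fix u :: "real^'n \<Rightarrow> ereal" and x0 and c :: real assume u: "u \<in> Conv_sc T"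
  have "scale_fun 1 x0 c u = (\<lambda>y. u (y - x0) + ereal c)" by (simp add: scale_fun_def flip: one_ereal_def)
  then show "grad_integral \<psi> (\<lambda>y. u (y - x0) + ereal c) = grad_integral \<psi> u"
    using grad_integral_scale_fun[OF \<psi> u, of 1 x0 c] by simp
qed

lemma epi_mult_eq_scale_fun: "epi_mult l u = scale_fun l 0 0 u"
  by (simp add: epi_mult_def scale_fun_def)

lemma epi_homogeneous_grad_integral:
  fixes T :: "('n::finite) itself"
  assumes \<psi>: "Cc (\<psi> :: real^'n \<Rightarrow> real^'n)"
  shows "epi_homogeneous (Conv_sc T) (real CARD('n)) (grad_integral \<psi>)"
  unfolding epi_homogeneous_def
  using grad_integral_scale_fun[OF \<psi>, of _ _ _ 0 0]
  by (auto simp: epi_mult_eq_scale_fun powr_realpow)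

theorem top_degree_valuation_grad_integral:
  assumes \<psi>: "Cc (\<psi> :: real^'n \<Rightarrow> real^'n)"
  shows "top_degree_valuation TYPE('n) (grad_integral \<psi>)"
  unfolding top_degree_valuation_def
  using epi_continuous_grad_integral[OF \<psi>] is_valuation_grad_integral[OF \<psi>]
    epi_translation_invariant_grad_integral[OF \<psi>] epi_homogeneous_grad_integral[OF \<psi>] by blast

text \<open>A functional is a total map with arbitrary values outside \<open>Conv_sc\<close>, so an
  integral representation is an equality on \<open>Conv_sc\<close> only. The properties transfer
  because \<open>Conv_sc\<close> is closed under translations, shifts and
  epi-multiplication.\<close>

lemma top_degree_valuation_cong:
  assumes z: "top_degree_valuation TYPE('n) z" and eq: "\<And>u. u \<in> Conv_sc TYPE('n::finite) \<Longrightarrow> z' u = z u"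
  shows "top_degree_valuation TYPE('n) z'"
proof -
  have tr: "(\<lambda>y. u (y - x0) + ereal c) \<in> Conv_sc TYPE('n)" if "u \<in> Conv_sc TYPE('n)" for u x0 c
    using scale_fun_Conv_sc[OF that, of 1 x0 c] by (simp add: scale_fun_def flip: one_ereal_def)
  have sc: "epi_mult l u \<in> Conv_sc TYPE('n)" if "u \<in> Conv_sc TYPE('n)" "l > 0" for u l
    using scale_fun_Conv_sc[OF that, of 0 0] by (simp add: epi_mult_eq_scale_fun)
  have "epi_continuous (Conv_sc TYPE('n)) z'"
    using z eq unfolding top_degree_valuation_def epi_continuous_def by simp
  moreover have "is_valuation (Conv_sc TYPE('n)) z'"
    using z eq unfolding top_degree_valuation_def is_valuation_def by simp
  moreover have "epi_translation_invariant (Conv_sc TYPE('n)) z'"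
    using z eq tr unfolding top_degree_valuation_def epi_translation_invariant_def by simp
  moreover have "epi_homogeneous (Conv_sc TYPE('n)) (real CARD('n)) z'"
    using z eq sc unfolding top_degree_valuation_def epi_homogeneous_def by simp
  ultimately show ?thesis by (simp add: top_degree_valuation_def)
qed

section \<open>Valuations on boxes\<close>

text \<open>Both conditions are imposed on the whole space, so restrictions to all boxes and
  blow-ups at all points and scales stay within the class with the same L.\<close>

definition Lip_convex :: "real \<Rightarrow> ('a::real_normed_vector \<Rightarrow> real) \<Rightarrow> bool" where
  "Lip_convex L f \<longleftrightarrow> convex_on UNIV f \<and> (\<forall>x y. \<bar>f x - f y\<bar> \<le> L * norm (x - y))"

lemma Lip_convexD:
  assumes "Lip_convex L f"
  shows "convex_on UNIV f" "\<bar>f x - f y\<bar> \<le> L * norm (x - y)"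
  using assms by (auto simp: Lip_convex_def)

lemma Lip_convex_continuous:
  assumes "Lip_convex L (f :: 'a::real_normed_vector \<Rightarrow> real)"
  shows "continuous_on S f"
proof -
  have "(max L 0)-lipschitz_on S f"
  proof (rule lipschitz_onI)
    fix x y
    have "\<bar>f x - f y\<bar> \<le> L * norm (x - y)" by (rule Lip_convexD[OF assms])
    also have "\<dots> \<le> max L 0 * norm (x - y)" by (intro mult_right_mono) auto
    finally show "dist (f x) (f y) \<le> max L 0 * dist x y" by (simp add: dist_norm)
  qed simp
  then show ?thesis by (rule lipschitz_on_continuous_on)
qed

lemma Lip_convex_linear: "Lip_convex (norm y) (\<lambda>x. y \<bullet> x)"
proof -
  have "\<bar>y \<bullet> x - y \<bullet> x'\<bar> \<le> norm y * norm (x - x')" for x x'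
    unfolding inner_diff_right[symmetric] by (rule Cauchy_Schwarz_ineq2)
  then show ?thesis by (auto simp: Lip_convex_def convex_on_def inner_add_right)
qed

text \<open>The blow-up of f at p, normalized to vanish at 0. Since it keeps the Lipschitz constant,
  all blow-ups of f belong to one family that is compact over a given box.\<close>

definition resc :: "('a::real_vector \<Rightarrow> real) \<Rightarrow> 'a \<Rightarrow> real \<Rightarrow> 'a \<Rightarrow> real" where
  "resc f p s x = (f (p + s *\<^sub>R x) - f p) / s"

lemma Lip_convex_resc:
  assumes f: "Lip_convex L f" and s: "s > 0"
  shows "Lip_convex L (resc f p s)"
  unfolding Lip_convex_def convex_on_def
proof (intro conjI ballI allI impI convex_UNIV)
  fix x y
  have "resc f p s x - resc f p s y = (f (p + s *\<^sub>R x) - f (p + s *\<^sub>R y)) / s"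
    by (simp add: resc_def diff_divide_distrib)
  then have "\<bar>resc f p s x - resc f p s y\<bar> = \<bar>f (p + s *\<^sub>R x) - f (p + s *\<^sub>R y)\<bar> / s"
    using s by (simp add: abs_divide)
  also have "\<dots> \<le> L * norm ((p + s *\<^sub>R x) - (p + s *\<^sub>R y)) / s"
    using s by (intro divide_right_mono Lip_convexD[OF f]) auto
  also have "(p + s *\<^sub>R x) - (p + s *\<^sub>R y) = s *\<^sub>R (x - y)" by (simp add: scaleR_diff_right)
  also have "L * norm (s *\<^sub>R (x - y)) / s = L * norm (x - y)" using s by simp
  finally show "\<bar>resc f p s x - resc f p s y\<bar> \<le> L * norm (x - y)" .
next
  fix x y and a b :: real assume ab: "0 \<le> a" "0 \<le> b" "a + b = 1"
  have "a *\<^sub>R (p + s *\<^sub>R x) + b *\<^sub>R (p + s *\<^sub>R y) = (a + b) *\<^sub>R p + s *\<^sub>R (a *\<^sub>R x + b *\<^sub>R y)"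
    by (simp add: scaleR_add_right scaleR_add_left mult.commute)
  then have e: "p + s *\<^sub>R (a *\<^sub>R x + b *\<^sub>R y) = a *\<^sub>R (p + s *\<^sub>R x) + b *\<^sub>R (p + s *\<^sub>R y)"
    using ab(3) by simp
  have "f (p + s *\<^sub>R (a *\<^sub>R x + b *\<^sub>R y)) - f p \<le> a * f (p + s *\<^sub>R x) + b * f (p + s *\<^sub>R y) - (a + b) * f p"
    using Lip_convexD(1)[OF f] ab unfolding e convex_on_def by simp
  then have "resc f p s (a *\<^sub>R x + b *\<^sub>R y) \<le> (a * f (p + s *\<^sub>R x) + b * f (p + s *\<^sub>R y) - (a + b) * f p) / s"
    unfolding resc_def using s by (intro divide_right_mono) auto
  also have "\<dots> = a * resc f p s x + b * resc f p s y"
    by (simp add: resc_def diff_divide_distrib add_divide_distrib distrib_right right_diff_distrib)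
  finally show "resc f p s (a *\<^sub>R x + b *\<^sub>R y) \<le> a * resc f p s x + b * resc f p s y" .
qed

lemma resc_0[simp]: "resc f p s 0 = 0"
  by (simp add: resc_def)

lemma resc_linear: "s > 0 \<Longrightarrow> resc (\<lambda>x. y \<bullet> x) p s = (\<lambda>x. y \<bullet> x)"
  by (auto simp: resc_def inner_add_right)

lemma epi_converges_restr:
  fixes f :: "nat \<Rightarrow> 'a::real_normed_vector \<Rightarrow> real"
  assumes A: "closed A" and g: "continuous_on A g"
    and unif: "\<And>e. e > 0 \<Longrightarrow> \<forall>\<^sub>F k in sequentially. \<forall>x\<in>A. \<bar>f k x - g x\<bar> < e"
  shows "epi_converges (\<lambda>k. restr A (f k)) (restr A g)"
proof (rule epi_convergesI)
  fix x xs t and \<sigma> :: "nat \<Rightarrow> nat"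
  assume xs: "xs \<longlonglongrightarrow> x" and s: "strict_mono \<sigma>" and le: "\<And>k. restr A (f (\<sigma> k)) (xs k) \<le> ereal t"
  have inA: "xs k \<in> A" for k using le[of k] by (auto simp: restr_def split: if_splits)
  then have xA: "x \<in> A" using closed_sequentially[OF A _ xs] by blast
  have gl: "(\<lambda>k. g (xs k)) \<longlonglongrightarrow> g x" using g inA xA xs by (auto simp: continuous_on_sequentially o_def)
  have "g x \<le> t"
  proof (rule field_le_epsilon)
    fix e :: real assume e: "e > 0"
    have "\<forall>\<^sub>F k in sequentially. \<forall>x\<in>A. \<bar>f (\<sigma> k) x - g x\<bar> < e"
      by (rule eventually_subseq[OF s unif[OF e]])
    then have "\<forall>\<^sub>F k in sequentially. g (xs k) \<le> t + e"
    proof eventually_elim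
      case (elim k)
      then have "\<bar>f (\<sigma> k) (xs k) - g (xs k)\<bar> < e" using inA by blast
      moreover have "f (\<sigma> k) (xs k) \<le> t" using le[of k] inA[of k] by (simp add: restr_def)
      ultimately show ?case by linarith
    qed
    then show "g x \<le> t + e" using tendsto_upperbound[OF gl] by simp
  qed
  then show "restr A g x \<le> ereal t" using xA by (simp add: restr_def)
next
  fix x assume x: "x \<in> dom_fun (restr A g)"
  then have "(\<lambda>k. f k x) \<longlonglongrightarrow> g x"
    unfolding tendsto_iff dist_real_def
  proof (intro allI impI)
    fix e :: real assume "e > 0"
    from unif[OF this] show "\<forall>\<^sub>F k in sequentially. \<bar>f k x - g x\<bar> < e"
      by eventually_elim (use x in auto)
  qed
  then have "(\<lambda>k. restr A (f k) x) \<longlonglongrightarrow> restr A g x" using x by (simp add: restr_def)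
  then show "\<exists>xs. xs \<longlonglongrightarrow> x \<and> limsup (\<lambda>k. restr A (f k) (xs k)) \<le> restr A g x"
    using lim_imp_Limsup[OF sequentially_bot] by (intro exI[of _ "\<lambda>_. x"]) fastforce
qed

section \<open>Cutting boxes into cells\<close>

definition upd :: "real^'n \<Rightarrow> 'n \<Rightarrow> real \<Rightarrow> real^'n" where
  "upd a i c = (\<chi> j. if j = i then c else a $ j)"

lemma upd_nth[simp]: "upd a i c $ j = (if j = i then c else a $ j)"
  by (simp add: upd_def)

lemma mem_cbox_upd:
  fixes a b :: "real^'n"
  shows mem_cbox_upd_right: "c \<le> b $ i \<Longrightarrow> x \<in> cbox a (upd b i c) \<longleftrightarrow> x \<in> cbox a b \<and> x $ i \<le> c"
    and mem_cbox_upd_left: "a $ i \<le> c \<Longrightarrow> x \<in> cbox (upd a i c) b \<longleftrightarrow> x \<in> cbox a b \<and> c \<le> x $ i"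
proof -
  assume c: "c \<le> b $ i"
  have "x $ j \<le> (if j = i then c else b $ j) \<longleftrightarrow> x $ j \<le> b $ j \<and> (j = i \<longrightarrow> x $ i \<le> c)" for j
    using c by (cases "j = i") auto
  then show "x \<in> cbox a (upd b i c) \<longleftrightarrow> x \<in> cbox a b \<and> x $ i \<le> c"
    unfolding mem_box_cart upd_nth by blast
next
  assume c: "a $ i \<le> c"
  have "(if j = i then c else a $ j) \<le> x $ j \<longleftrightarrow> a $ j \<le> x $ j \<and> (j = i \<longrightarrow> c \<le> x $ i)" for j
    using c by (cases "j = i") auto
  then show "x \<in> cbox (upd a i c) b \<longleftrightarrow> x \<in> cbox a b \<and> c \<le> x $ i"
    unfolding mem_box_cart upd_nth by blast
qed

lemma cbox_cut:
  fixes a b :: "real^'n"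
  assumes c: "a $ i \<le> c" "c \<le> b $ i"
  shows cbox_cut_Int: "cbox a (upd b i c) \<inter> cbox (upd a i c) b = cbox (upd a i c) (upd b i c)"
    and cbox_cut_Un: "cbox a (upd b i c) \<union> cbox (upd a i c) b = cbox a b"
proof -
  show "cbox a (upd b i c) \<inter> cbox (upd a i c) b = cbox (upd a i c) (upd b i c)"
    using mem_cbox_upd_right[OF c(2)] mem_cbox_upd_left[OF c(1)] by blast
  show "cbox a (upd b i c) \<union> cbox (upd a i c) b = cbox a b"
    using mem_cbox_upd_right[where a = a, OF c(2)] mem_cbox_upd_left[where b = b, OF c(1)] linear[of _ c] by blast
qed

text \<open>Boxes are cut into congruent cells with side vector \<open>w\<close>; coordinates in \<open>Z\<close> are degenerate
  and \<open>Q\<close> is the set of admissible cell corners.\<close>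

lemma grid_bound:
  fixes F :: "real^'n \<Rightarrow> real^'n \<Rightarrow> 'v::real_normed_vector"
  assumes w: "\<And>i. i \<in> Z \<Longrightarrow> w $ i = 0" "\<And>i. i \<notin> Z \<Longrightarrow> w $ i > 0"
    and add: "\<And>a b i c. (\<And>j. j \<in> Z \<Longrightarrow> a $ j = b $ j) \<Longrightarrow> (\<And>j. j \<notin> Z \<Longrightarrow> a $ j < b $ j) \<Longrightarrow> i \<notin> Z
       \<Longrightarrow> a $ i < c \<Longrightarrow> c < b $ i \<Longrightarrow> F a b = F a (upd b i c) + F (upd a i c) b"
    and Q: "\<And>q i. q \<in> Q \<Longrightarrow> upd q i (q $ i + w $ i) \<in> Q"
    and cell: "\<And>q. q \<in> Q \<Longrightarrow> norm (F q (q + w)) \<le> e"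
    and m: "\<And>i. m i \<ge> 1" "\<And>i. i \<in> Z \<Longrightarrow> m i = 1" and q: "q \<in> Q"
  shows "norm (F q (q + (\<chi> i. real (m i) * w $ i))) \<le> e * real (\<Prod>i\<in>UNIV. m i)"
  using m q
proof (induction "\<Sum>i\<in>UNIV. m i" arbitrary: m q rule: less_induct)
  case less
  show ?case
  proof (cases "\<forall>i. m i = 1")
    case True
    then have "(\<chi> i. real (m i) * w $ i) = w" by (simp add: vec_eq_iff)
    then show ?thesis using True cell[OF less.prems(3)] by simp
  next
    case False
    then obtain i where "m i \<noteq> 1" by blast
    then have mi: "m i \<ge> 2" using less.prems(1)[of i] by linarith
    then have iZ: "i \<notin> Z" using less.prems(2)[of i] by auto
    have wi: "w $ i > 0" using w(2)[OF iZ] .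
    define c where "c = q $ i + w $ i"
    \<comment> \<open>A layer one cell thick is cut off in a direction with at least two cells; the
      layer m1 and the rest m2 both have a smaller sum of cell counts.\<close>
    define m1 where "m1 = m(i := 1)"
    define m2 where "m2 = m(i := m i - 1)"
    have s: "(\<Sum>j\<in>UNIV. m j) = m i + (\<Sum>j\<in>UNIV - {i}. m j)" by (simp add: sum.remove[of _ i])
    have s1: "(\<Sum>j\<in>UNIV. m1 j) = 1 + (\<Sum>j\<in>UNIV - {i}. m j)" by (simp add: sum.remove[of _ i] m1_def)
    have s2: "(\<Sum>j\<in>UNIV. m2 j) = m i - 1 + (\<Sum>j\<in>UNIV - {i}. m j)" by (simp add: sum.remove[of _ i] m2_def)
    have p: "(\<Prod>j\<in>UNIV. m j) = m i * (\<Prod>j\<in>UNIV - {i}. m j)" by (simp add: prod.remove[of _ i])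
    have p1: "(\<Prod>j\<in>UNIV. m1 j) = (\<Prod>j\<in>UNIV - {i}. m j)" by (simp add: prod.remove[of _ i] m1_def)
    have p2: "(\<Prod>j\<in>UNIV. m2 j) = (m i - 1) * (\<Prod>j\<in>UNIV - {i}. m j)" by (simp add: prod.remove[of _ i] m2_def)
    have "m i = Suc (m i - 1)" using mi by simp
    then have pp: "(\<Prod>j\<in>UNIV. m j) = (\<Prod>j\<in>UNIV. m1 j) + (\<Prod>j\<in>UNIV. m2 j)"
      unfolding p p1 p2 by (metis mult_Suc)
    let ?b = "q + (\<chi> i. real (m i) * w $ i)"
    have F: "F q ?b = F q (upd ?b i c) + F (upd q i c) ?b"
    proof (rule add[OF _ _ iZ])
      show "j \<in> Z \<Longrightarrow> q $ j = ?b $ j" for j using w(1) by simp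
      show "j \<notin> Z \<Longrightarrow> q $ j < ?b $ j" for j using w(2)[of j] less.prems(1)[of j] by simp
      show "q $ i < c" using wi by (simp add: c_def)
      have "1 * w $ i < real (m i) * w $ i" using wi mi by (intro mult_strict_right_mono) auto
      then show "c < ?b $ i" by (simp add: c_def)
    qed
    have b1: "upd ?b i c = q + (\<chi> i. real (m1 i) * w $ i)" by (simp add: vec_eq_iff m1_def c_def)
    have b2: "?b = upd q i c + (\<chi> i. real (m2 i) * w $ i)"
      using mi by (simp add: vec_eq_iff m2_def c_def of_nat_diff algebra_simps)
    have n1: "norm (F q (q + (\<chi> i. real (m1 i) * w $ i))) \<le> e * real (\<Prod>i\<in>UNIV. m1 i)"
      using less.prems iZ s s1 mi by (intro less.hyps) (auto simp: m1_def)
    have n2: "norm (F (upd q i c) (upd q i c + (\<chi> i. real (m2 i) * w $ i))) \<le> e * real (\<Prod>i\<in>UNIV. m2 i)"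
    proof (rule less.hyps)
      show "(\<Sum>i\<in>UNIV. m2 i) < (\<Sum>i\<in>UNIV. m i)" using s s2 mi by simp
      have "1 \<le> m i - 1" using mi by linarith
      then show "1 \<le> m2 j" for j using less.prems(1)[of j] unfolding m2_def fun_upd_def by presburger
      show "j \<in> Z \<Longrightarrow> m2 j = 1" for j using less.prems(2)[of j] iZ by (auto simp: m2_def)
      show "upd q i c \<in> Q" unfolding c_def by (rule Q[OF less.prems(3)])
    qed
    have "norm (F q ?b) \<le> norm (F q (upd ?b i c)) + norm (F (upd q i c) ?b)"
      unfolding F by (rule norm_triangle_ineq)
    also have "\<dots> \<le> e * real (\<Prod>i\<in>UNIV. m1 i) + e * real (\<Prod>i\<in>UNIV. m2 i)"
      using n1 n2 unfolding b1[symmetric] b2[symmetric] by (rule add_mono)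
    also have "\<dots> = e * real (\<Prod>i\<in>UNIV. m i)" unfolding pp by (simp add: distrib_left)
    finally show ?thesis .
  qed
qed

section \<open>Bounds, vanishing and additivity of a top degree valuation on boxes\<close>

locale top_degree =
  fixes z :: "(real^'n \<Rightarrow> ereal) \<Rightarrow> real^'n"
  assumes z: "top_degree_valuation TYPE('n) z"
begin

lemma z_scale_fun:
  assumes u: "u \<in> Conv_sc TYPE('n)" and l: "l > 0"
  shows "z (scale_fun l x0 c u) = l ^ CARD('n) *\<^sub>R z u"
proof -
  have e: "epi_mult l u \<in> Conv_sc TYPE('n)"
    using scale_fun_Conv_sc[OF assms, of 0 0] by (simp add: epi_mult_eq_scale_fun)
  have "scale_fun l x0 c u = (\<lambda>y. epi_mult l u (y - x0) + ereal c)" by (simp add: scale_fun_def epi_mult_def)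
  then have "z (scale_fun l x0 c u) = z (epi_mult l u)"
    using z e unfolding top_degree_valuation_def epi_translation_invariant_def by simp
  also have "\<dots> = l powr real CARD('n) *\<^sub>R z u"
    using z u l unfolding top_degree_valuation_def epi_homogeneous_def by simp
  finally show ?thesis using l by (simp add: powr_realpow)
qed

lemma z_tendsto:
  assumes "\<And>k. us k \<in> Conv_sc TYPE('n)" "u \<in> Conv_sc TYPE('n)" "epi_converges us u"
  shows "(\<lambda>k. z (us k)) \<longlonglongrightarrow> z u"
  using z assms unfolding top_degree_valuation_def epi_continuous_def by blast

definition zbox :: "(real^'n \<Rightarrow> real) \<Rightarrow> real^'n \<Rightarrow> real^'n \<Rightarrow> real^'n" where
  "zbox f a b = z (restr (cbox a b) f)"

lemma restr_box_Conv_sc: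
  assumes "Lip_convex L f" "\<And>i. a $ i \<le> b $ i"
  shows "restr (cbox a b) f \<in> Conv_sc TYPE('n)"
proof (rule restr_Conv_sc)
  show "cbox a b \<noteq> {}" using assms(2) by (auto simp: interval_ne_empty_cart)
  show "convex_on (cbox a b) f" using Lip_convexD(1)[OF assms(1)] by (rule convex_on_subset) auto
qed (auto intro: Lip_convex_continuous[OF assms(1)])

text \<open>Minimum and maximum of the restrictions to two half boxes are the restrictions to their
  union and to their intersection, the common face.\<close>

lemma zbox_cut:
  assumes f: "Lip_convex L f" and ab: "\<And>j. a $ j \<le> b $ j" and c: "a $ i \<le> c" "c \<le> b $ i"
  shows "zbox f a b + zbox f (upd a i c) (upd b i c) = zbox f a (upd b i c) + zbox f (upd a i c) b"
proof -
  let ?A = "cbox a (upd b i c)" and ?B = "cbox (upd a i c) b"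
  have M: "(\<lambda>x. max (restr ?A f x) (restr ?B f x)) = restr (cbox (upd a i c) (upd b i c)) f"
    unfolding cbox_cut_Int[OF c, symmetric] by (auto simp: restr_def)
  have m: "(\<lambda>x. min (restr ?A f x) (restr ?B f x)) = restr (cbox a b) f"
    unfolding cbox_cut_Un[OF c, symmetric] by (auto simp: restr_def)
  have C: "restr ?A f \<in> Conv_sc TYPE('n)" "restr ?B f \<in> Conv_sc TYPE('n)"
    "restr (cbox (upd a i c) (upd b i c)) f \<in> Conv_sc TYPE('n)" "restr (cbox a b) f \<in> Conv_sc TYPE('n)"
    using ab c by (auto intro!: restr_box_Conv_sc[OF f])
  have "is_valuation (Conv_sc TYPE('n)) z" using z by (simp add: top_degree_valuation_def)
  from this[unfolded is_valuation_def, rule_format, OF C(1,2), unfolded M m, OF C(3,4)]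
  show ?thesis by (simp add: zbox_def add.commute)
qed

lemma zbox_scale:
  assumes f: "Lip_convex L f" and d: "\<And>i. d $ i \<ge> 0" and s: "s > 0"
  shows "zbox f p (p + s *\<^sub>R d) = s ^ CARD('n) *\<^sub>R zbox (resc f p s) 0 d"
proof -
  have C: "restr (cbox 0 d) (resc f p s) \<in> Conv_sc TYPE('n)"
    using d by (intro restr_box_Conv_sc[OF Lip_convex_resc[OF f s]]) auto
  have mem: "(x - p) /\<^sub>R s \<in> cbox 0 d \<longleftrightarrow> x \<in> cbox p (p + s *\<^sub>R d)" for x
    using s by (simp add: mem_box_cart field_simps zero_le_divide_iff)
  have "restr (cbox p (p + s *\<^sub>R d)) f = scale_fun s p (f p) (restr (cbox 0 d) (resc f p s))"
    unfolding scale_fun_def restr_def mem using s by (auto simp: resc_def)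
  then show ?thesis unfolding zbox_def using z_scale_fun[OF C s] by simp
qed

text \<open>Functions violating every bound have, by Arzela-Ascoli, a subsequence that converges
  uniformly on the box. The limit is convex, so its restriction is admissible; uniform convergence
  there implies epi-convergence, and continuity of \<open>z\<close> contradicts the growth.\<close>

lemma zbox_bounded:
  assumes d: "\<And>i. d $ i \<ge> 0"
  shows "\<exists>M\<ge>0. \<forall>f. Lip_convex L f \<longrightarrow> f 0 = 0 \<longrightarrow> norm (zbox f 0 d) \<le> M"
proof (rule ccontr)
  assume "\<not> ?thesis"
  then have "\<exists>f. Lip_convex L f \<and> f 0 = 0 \<and> norm (zbox f 0 d) > real k" for k
    by (metis not_le of_nat_0_le_iff)
  then obtain f where f: "\<And>k. Lip_convex L (f k)" "\<And>k. f k 0 = 0" "\<And>k. norm (zbox (f k) 0 d) > real k" by metis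
  let ?A = "cbox 0 d"
  have A: "compact ?A" "?A \<noteq> {}" using d by (auto simp: interval_ne_empty_cart)
  \<comment> \<open>A positive Lipschitz constant, to be used as a divisor in the proof of
    equicontinuity.\<close>
  define L' where "L' = max L 1"
  have L': "\<bar>f k x - f k y\<bar> \<le> L' * norm (x - y)" "L' > 0" for k x y
    using Lip_convexD(2)[OF f(1), of k x y] mult_right_mono[of L L' "norm (x - y)"] by (auto simp: L'_def)
  obtain B where B: "\<And>x. x \<in> ?A \<Longrightarrow> norm x \<le> B" using compact_imp_bounded[OF A(1)] by (auto simp: bounded_iff)
  obtain g r where g: "continuous_on ?A g" "strict_mono (r::nat\<Rightarrow>nat)"
      "\<And>e. 0 < e \<Longrightarrow> \<exists>N. \<forall>n x. n \<ge> N \<and> x \<in> ?A \<longrightarrow> norm (f (r n) x - g x) < e"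
  proof (rule Arzela_Ascoli[OF A(1), of f "L' * B"])
    show "norm (f n x) \<le> L' * B" if "x \<in> ?A" for n x
    proof -
      have "norm (f n x) \<le> L' * norm x" using L'(1)[of n x 0] f(2) by simp
      also have "\<dots> \<le> L' * B" using B[OF that] L'(2) by simp
      finally show ?thesis .
    qed
    show "\<exists>d>0. \<forall>n y. y \<in> ?A \<and> norm (x - y) < d \<longrightarrow> norm (f n x - f n y) < e" if "e > 0" for x e
    proof (intro exI[of _ "e / L'"] conjI allI impI)
      fix n y assume "y \<in> ?A \<and> norm (x - y) < e / L'"
      then have "L' * norm (x - y) < e" using L'(2) by (simp add: field_simps)
      then show "norm (f n x - f n y) < e" using L'(1)[of n x y] by simp
    qed (use that L'(2) in simp)
  qed blast
  have unif: "\<forall>\<^sub>F k in sequentially. \<forall>x\<in>?A. \<bar>f (r k) x - g x\<bar> < e" if "e > 0" for e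
    using g(3)[OF that] by (auto simp: eventually_sequentially)
  have lim: "(\<lambda>k. f (r k) x) \<longlonglongrightarrow> g x" if "x \<in> ?A" for x
    unfolding tendsto_iff dist_real_def
  proof (intro allI impI)
    fix e :: real assume "e > 0"
    from unif[OF this] show "\<forall>\<^sub>F k in sequentially. \<bar>f (r k) x - g x\<bar> < e"
      by eventually_elim (use that in auto)
  qed
  have cA: "convex ?A" by simp
  have "convex_on ?A g"
    unfolding convex_on_def
  proof (intro conjI ballI allI impI cA)
    fix x y and a b :: real assume x: "x \<in> ?A" and y: "y \<in> ?A" and ab: "0 \<le> a" "0 \<le> b" "a + b = 1"
    have xy: "a *\<^sub>R x + b *\<^sub>R y \<in> ?A" using convexD[OF cA x y ab] .
    show "g (a *\<^sub>R x + b *\<^sub>R y) \<le> a * g x + b * g y"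
    proof (rule tendsto_le[OF sequentially_bot _ lim[OF xy]])
      show "(\<lambda>k. a * f (r k) x + b * f (r k) y) \<longlonglongrightarrow> a * g x + b * g y"
        by (intro tendsto_intros lim x y)
      show "\<forall>\<^sub>F k in sequentially. f (r k) (a *\<^sub>R x + b *\<^sub>R y) \<le> a * f (r k) x + b * f (r k) y"
        using Lip_convexD(1)[OF f(1)] ab unfolding convex_on_def by auto
    qed
  qed
  then have gC: "restr ?A g \<in> Conv_sc TYPE('n)" by (rule restr_Conv_sc[OF A _ g(1)])
  have fC: "restr ?A (f (r k)) \<in> Conv_sc TYPE('n)" for k using d by (intro restr_box_Conv_sc[OF f(1)]) auto
  have "(\<lambda>k. z (restr ?A (f (r k)))) \<longlonglongrightarrow> z (restr ?A g)"
    by (rule z_tendsto[OF fC gC epi_converges_restr[OF compact_imp_closed[OF A(1)] g(1) unif]])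
  then have "Bseq (\<lambda>k. zbox (f (r k)) 0 d)" unfolding zbox_def by (rule convergent_imp_Bseq[OF convergentI])
  then obtain M where M: "\<And>k. norm (zbox (f (r k)) 0 d) \<le> M" by (auto simp: Bseq_def)
  obtain k where k: "M < real k" using reals_Archimedean2 by blast
  have "real k \<le> real (r k)" using seq_suble[OF g(2)] by simp
  then show False using M[of k] f(3)[of "r k"] k by linarith
qed

text \<open>A degenerate box with \<open>k < n\<close> nondegenerate sides splits into \<open>N ^ k\<close> cells, each of which
  contributes only \<open>O(N ^ (- n))\<close> by homogeneity.\<close>

lemma zbox_degenerate:
  assumes f: "Lip_convex L f" and ab: "\<And>i. a $ i \<le> b $ i" and deg: "\<exists>i. a $ i = b $ i"
  shows "zbox f a b = 0"
  using ab deg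
proof (induction "card {i. a $ i < b $ i}" arbitrary: a b rule: less_induct)
  case less
  define Z where "Z = {i. a $ i = b $ i}"
  have nZ: "i \<notin> Z \<longleftrightarrow> a $ i < b $ i" for i using less.prems(1)[of i] by (auto simp: Z_def)
  have cU: "- Z = {i. a $ i < b $ i}" using nZ by auto
  have "Z \<noteq> {}" using less.prems(2) by (auto simp: Z_def)
  then have "- Z \<noteq> UNIV" by auto
  then have ck: "card (- Z) < CARD('n)" by (intro psubset_card_mono) auto
  \<comment> \<open>A box with the same degenerate directions Z can be cut in a direction outside Z:
    the common face has one nondegenerate side fewer, so it contributes 0 by induction.\<close>
  have add: "zbox f a' b' = zbox f a' (upd b' i c) + zbox f (upd a' i c) b'"
    if a': "\<And>j. j \<in> Z \<Longrightarrow> a' $ j = b' $ j" "\<And>j. j \<notin> Z \<Longrightarrow> a' $ j < b' $ j" and i: "i \<notin> Z" and c: "a' $ i < c" "c < b' $ i"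
    for a' b' i c
  proof -
    have le: "a' $ j \<le> b' $ j" for j using a'(1)[of j] a'(2)[of j] by (cases "j \<in> Z") auto
    have "{j. upd a' i c $ j < upd b' i c $ j} \<subset> {i. a $ i < b $ i}"
      unfolding cU[symmetric] using a' i by (auto simp: less_le)
    then have "zbox f (upd a' i c) (upd b' i c) = 0"
      by (intro less.hyps psubset_card_mono) (auto simp: le)
    then show ?thesis using zbox_cut[OF f le, of i c] c by simp
  qed
  obtain M where M: "M \<ge> 0" "\<And>f. Lip_convex L f \<Longrightarrow> f 0 = 0 \<Longrightarrow> norm (zbox f 0 (b - a)) \<le> M"
    using zbox_bounded[of "b - a" L] less.prems(1) by auto
  have bound: "norm (zbox f a b) \<le> M * (1 / real (Suc N))" for N
  proof -
    let ?s = "1 / real (Suc N)"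
    define w where "w = ?s *\<^sub>R (b - a)"
    define m where "m i = (if i \<in> Z then 1 else Suc N)" for i
    have cell: "norm (zbox f q (q + w)) \<le> ?s ^ CARD('n) * M" for q
    proof -
      have "zbox f q (q + w) = ?s ^ CARD('n) *\<^sub>R zbox (resc f q ?s) 0 (b - a)"
        unfolding w_def using less.prems(1) by (intro zbox_scale[OF f]) auto
      moreover have "norm (zbox (resc f q ?s) 0 (b - a)) \<le> M"
        by (rule M(2)[OF Lip_convex_resc[OF f]]) auto
      ultimately show ?thesis by (simp add: mult_left_mono divide_right_mono)
    qed
    have "norm (zbox f a (a + (\<chi> i. real (m i) * w $ i))) \<le> (?s ^ CARD('n) * M) * real (\<Prod>i\<in>UNIV. m i)"
    proof (rule grid_bound[where F = "zbox f" and Z = Z and Q = UNIV])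
      show "i \<in> Z \<Longrightarrow> w $ i = 0" for i by (simp add: w_def Z_def)
      show "i \<notin> Z \<Longrightarrow> 0 < w $ i" for i using nZ by (simp add: w_def)
      show "zbox f a' b' = zbox f a' (upd b' i c) + zbox f (upd a' i c) b'"
        if "\<And>j. j \<in> Z \<Longrightarrow> a' $ j = b' $ j" "\<And>j. j \<notin> Z \<Longrightarrow> a' $ j < b' $ j" "i \<notin> Z" "a' $ i < c" "c < b' $ i"
        for a' b' i c using that by (rule add)
      show "norm (zbox f q (q + w)) \<le> ?s ^ CARD('n) * M" for q by (rule cell)
    qed (simp_all add: m_def)
    moreover have "a + (\<chi> i. real (m i) * w $ i) = b"
      by (auto simp: vec_eq_iff m_def w_def Z_def)
    moreover have "(\<Prod>i\<in>UNIV. m i) = Suc N ^ card (- Z)"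
    proof -
      have "(\<Prod>i\<in>UNIV. m i) = (\<Prod>i\<in>- Z. m i)"
        by (rule prod.mono_neutral_right) (auto simp: m_def)
      then show ?thesis by (simp add: m_def)
    qed
    ultimately have "norm (zbox f a b) \<le> (?s ^ CARD('n) * M) * real (Suc N) ^ card (- Z)" by simp
    also have "\<dots> \<le> (?s ^ CARD('n) * M) * real (Suc N) ^ (CARD('n) - 1)"
      using M(1) ck by (intro mult_left_mono power_increasing mult_nonneg_nonneg) auto
    also have "\<dots> = M * ?s * (?s * real (Suc N)) ^ (CARD('n) - 1)"
    proof -
      have "?s ^ CARD('n) = ?s * ?s ^ (CARD('n) - 1)" by (metis power_eq_if zero_less_card_finite less_not_refl2)
      then show ?thesis by (simp only: power_mult_distrib mult_ac)
    qed
    also have "\<dots> = M * ?s" by simp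
    finally show ?thesis .
  qed
  have "(\<lambda>N. M * (1 / real (Suc N))) \<longlonglongrightarrow> M * 0"
    using LIMSEQ_inverse_real_of_nat by (intro tendsto_mult tendsto_const) (simp add: inverse_eq_divide)
  from LIMSEQ_le_const[OF this, of "norm (zbox f a b)"] have "norm (zbox f a b) \<le> M * 0"
    using bound by blast
  then show ?case by simp
qed

lemma zbox_additive:
  assumes f: "Lip_convex L f" and ab: "\<And>j. a $ j \<le> b $ j" and c: "a $ i < c" "c < b $ i"
  shows "zbox f a b = zbox f a (upd b i c) + zbox f (upd a i c) b"
proof -
  have "zbox f (upd a i c) (upd b i c) = 0" by (rule zbox_degenerate[OF f]) (auto simp: ab)
  then show ?thesis using zbox_cut[OF f ab, of i c] c by simp
qed

end

section \<open>Representation over cubes\<close>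

lemma set_lebesgue_integral_box_cut:
  fixes \<phi> :: "real^'n \<Rightarrow> 'b::{banach, second_countable_topology}"
  assumes i: "\<And>a b. set_integrable lebesgue (cbox a b) \<phi>" and c: "a $ i \<le> c" "c \<le> b $ i"
  shows "(LINT x:cbox a b|lebesgue. \<phi> x) =
    (LINT x:cbox a (upd b i c)|lebesgue. \<phi> x) + (LINT x:cbox (upd a i c) b|lebesgue. \<phi> x)"
proof -
  have "negligible (cbox (upd a i c) (upd b i c))"
    by (auto simp: negligible_interval interval_eq_empty_cart)
  then have "AE x in lebesgue. x \<notin> cbox (upd a i c) (upd b i c)"
    by (intro AE_not_in) (simp add: negligible_iff_null_sets)
  then have "AE x in lebesgue. \<not> (x \<in> cbox a (upd b i c) \<and> x \<in> cbox (upd a i c) b)"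
    unfolding cbox_cut_Int[OF c, symmetric] by simp
  then show ?thesis unfolding cbox_cut_Un[OF c, symmetric]
    by (rule set_integral_Un_AE) (auto intro: i)
qed

section \<open>Lattice cells and blow-ups at lattice points\<close>

definition grid :: "real \<Rightarrow> real^'n \<Rightarrow> real^'n" where
  "grid N x = (\<chi> i. of_int \<lfloor>N * x $ i\<rfloor> / N)"

lemma grid_le: "N > 0 \<Longrightarrow> norm (grid N x - x) \<le> real CARD('n) / N" for x :: "real^'n"
proof -
  assume N: "N > 0"
  have "norm (grid N x - x) \<le> (\<Sum>i\<in>UNIV. \<bar>(grid N x - x) $ i\<bar>)" by (rule norm_le_l1_cart)
  also have "\<dots> \<le> (\<Sum>i\<in>(UNIV::'n set). 1 / N)"
  proof (rule sum_mono)
    fix i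
    have "(grid N x - x) $ i = (of_int \<lfloor>N * x $ i\<rfloor> - N * x $ i) / N" using N by (simp add: grid_def field_simps)
    moreover have "\<bar>of_int \<lfloor>N * x $ i\<rfloor> - N * x $ i\<bar> \<le> 1" by linarith
    ultimately show "\<bar>(grid N x - x) $ i\<bar> \<le> 1 / N" using N by (simp add: abs_divide divide_right_mono)
  qed
  finally show ?thesis by simp
qed

text \<open>Stated for the open cell: points on an upper face round to the corner of a neighbouring
  cell. Faces are null sets, so integrals do not notice.\<close>

lemma grid_in_box:
  fixes q :: "real^'n"
  assumes N: "N > 0" and q: "\<And>i. N * q $ i \<in> \<int>" and x: "x \<in> box q (q + (1/N) *\<^sub>R vec 1)"
  shows "grid N x = q"
  unfolding vec_eq_iff
proof
  fix i
  obtain k where k: "N * q $ i = of_int k" using q[of i] by (auto elim: Ints_cases)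
  have "q $ i < x $ i" "x $ i < q $ i + 1 / N" using x by (auto simp: mem_box_cart)
  then have "N * q $ i < N * x $ i" "N * x $ i < N * (q $ i + 1 / N)" using N by auto
  then have "of_int k < N * x $ i" "N * x $ i < of_int k + 1" using N k by (auto simp: distrib_left)
  then have "\<lfloor>N * x $ i\<rfloor> = k" by (simp add: floor_eq_iff)
  then show "grid N x $ i = q $ i" using k N by (simp add: grid_def field_simps)
qed

text \<open>Since \<open>grid N\<close> has countable range, a preimage under the composition is a
  countable union of fibres of \<open>grid N\<close>, and these are Borel. The values of
  \<open>z\<close> on the cells enter as H.\<close>

lemma grid_comp_measurable: "(\<lambda>x. H (grid N x)) \<in> borel_measurable borel" for H :: "real^'n \<Rightarrow> 'b::topological_space"
proof (rule measurableI)
  fix S :: "'b set"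
  have c: "countable (range (grid N :: real^'n \<Rightarrow> real^'n))"
  proof (rule countable_subset)
    show "range (grid N) \<subseteq> range (\<lambda>j::'n \<Rightarrow> int. \<chi> i. of_int (j i) / N)" by (auto simp: grid_def)
  qed simp
  have m: "(grid N :: real^'n \<Rightarrow> real^'n) \<in> borel_measurable borel"
  proof (rule borel_measurable_euclidean_space[THEN iffD2], rule ballI)
    fix b :: "real^'n" assume "b \<in> Basis"
    then obtain i where b: "b = axis i 1" by (auto simp: Basis_vec_def)
    have "(\<lambda>x::real^'n. of_int \<lfloor>N * x $ i\<rfloor> / N) \<in> borel_measurable borel" by measurable
    then show "(\<lambda>x. grid N x \<bullet> b) \<in> borel_measurable borel"
      by (simp add: b inner_axis grid_def)
  qed
  have "(\<lambda>x. H (grid N x)) -` S \<inter> space borel = (\<Union>q\<in>{q \<in> range (grid N). H q \<in> S}. grid N -` {q} \<inter> space borel)"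
    by auto
  also have "\<dots> \<in> sets borel"
  proof (rule sets.countable_UN'')
    show "countable {q \<in> range (grid N). H q \<in> S}" using c by (rule countable_subset[rotated]) auto
    show "grid N -` {q} \<inter> space borel \<in> sets borel" for q :: "real^'n" by (rule measurable_sets[OF m]) simp
  qed
  finally show "(\<lambda>x. H (grid N x)) -` S \<inter> space borel \<in> sets borel" .
qed simp

text \<open>The blow-ups are centred at lattice points q near x and not at x itself, but |q - x| is
  of the order of the scale s. Differentiability at x thus gives f (q + s y) and f q with errors
  o(s), uniformly in y, which survives division by s.\<close>

lemma resc_grid_tendsto:
  fixes f :: "real^'n \<Rightarrow> real"
  assumes d: "(f has_derivative (\<lambda>h. g \<bullet> h)) (at x)" and e: "e > 0"
  shows "\<forall>\<^sub>F k in sequentially. \<forall>y\<in>cbox 0 (vec 1). \<bar>resc f (grid (real (Suc k)) x) (1 / real (Suc k)) y - g \<bullet> y\<bar> < e"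
proof -
  define n where "n = real CARD('n)"
  have n: "n \<ge> 1" by (simp add: n_def Suc_leI)
  \<comment> \<open>The two expansions contribute errors 2 n e' s and n e' s, which add up to less
    than 4 n e' s = e s.\<close>
  define e' where "e' = e / (4 * n)"
  have e': "e' > 0" "4 * n * e' = e" using e n by (auto simp: e'_def)
  obtain \<delta> where \<delta>: "\<delta> > 0" "\<And>y. norm (y - x) < \<delta> \<Longrightarrow> norm (f y - f x - g \<bullet> (y - x)) \<le> e' * norm (y - x)"
    using d e'(1) unfolding has_derivative_at_alt by blast
  have "(\<lambda>k. 2 * n * (1 / real (Suc k))) \<longlonglongrightarrow> 2 * n * 0"
    using LIMSEQ_inverse_real_of_nat by (intro tendsto_mult tendsto_const) (simp add: inverse_eq_divide)
  then have "\<forall>\<^sub>F k in sequentially. 2 * n * (1 / real (Suc k)) < \<delta>"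
    using \<delta>(1) by (intro order_tendstoD(2)[of _ "2 * n * 0"]) auto
  then show ?thesis
  proof eventually_elim
    case (elim k)
    define s where "s = 1 / real (Suc k)"
    have s: "s > 0" by (simp add: s_def)
    let ?q = "grid (real (Suc k)) x"
    have qx: "norm (?q - x) \<le> n * s" using grid_le[of "real (Suc k)" x] by (simp add: n_def s_def)
    show ?case
    proof
      fix y :: "real^'n" assume "y \<in> cbox 0 (vec 1)"
      then have y: "\<bar>y $ i\<bar> \<le> 1" for i by (auto simp: mem_box_cart abs_le_iff intro: order_trans[of _ 0])
      have "norm y \<le> (\<Sum>i\<in>UNIV. \<bar>y $ i\<bar>)" by (rule norm_le_l1_cart)
      also have "\<dots> \<le> (\<Sum>i\<in>(UNIV::'n set). 1)" by (rule sum_mono) (rule y)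
      finally have ny: "norm y \<le> n" by (simp add: n_def)
      have "norm ((?q + s *\<^sub>R y) - x) \<le> norm (?q - x) + norm (s *\<^sub>R y)"
        by (metis add_diff_eq add.commute norm_triangle_ineq diff_add_eq)
      also have "\<dots> \<le> n * s + s * n" using qx ny s by (intro add_mono) auto
      finally have qy: "norm ((?q + s *\<^sub>R y) - x) \<le> 2 * n * s" by simp
      have "2 * n * s < \<delta>" using elim by (simp add: s_def)
      moreover have "n * s \<le> 2 * n * s" using n s by simp
      ultimately have "norm ((?q + s *\<^sub>R y) - x) < \<delta>" "norm (?q - x) < \<delta>" using qx qy by linarith+
      then have a: "\<bar>f (?q + s *\<^sub>R y) - f x - g \<bullet> ((?q + s *\<^sub>R y) - x)\<bar> \<le> e' * norm ((?q + s *\<^sub>R y) - x)"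
         "\<bar>f ?q - f x - g \<bullet> (?q - x)\<bar> \<le> e' * norm (?q - x)" using \<delta>(2) by auto
      have b: "e' * norm ((?q + s *\<^sub>R y) - x) \<le> e' * (2 * n * s)" "e' * norm (?q - x) \<le> e' * (n * s)"
        using qx qy e'(1) by (auto intro: mult_left_mono)
      have "g \<bullet> ((?q + s *\<^sub>R y) - x) - g \<bullet> (?q - x) = s * (g \<bullet> y)"
        by (simp add: inner_diff_right inner_add_right)
      then have "\<bar>f (?q + s *\<^sub>R y) - f ?q - s * (g \<bullet> y)\<bar> \<le> e' * (2 * n * s) + e' * (n * s)"
        using a b by linarith
      also have "\<dots> = 3 * n * e' * s" by simp
      also have "\<dots> < e * s" using e' n s by (intro mult_strict_right_mono) auto
      finally have "\<bar>f (?q + s *\<^sub>R y) - f ?q - s * (g \<bullet> y)\<bar> < e * s" .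
      moreover have "resc f ?q s y - g \<bullet> y = (f (?q + s *\<^sub>R y) - f ?q - s * (g \<bullet> y)) / s"
        using s by (simp add: resc_def diff_divide_distrib)
      ultimately show "\<bar>resc f ?q (1 / real (Suc k)) y - g \<bullet> y\<bar> < e"
        unfolding s_def[symmetric] using s by (simp add: abs_divide divide_less_eq)
    qed
  qed
qed

context top_degree
begin

lemma zbox_tendsto:
  assumes f: "\<And>k. Lip_convex (L k) (f k)" and g: "Lip_convex M g" and ab: "\<And>i. a $ i \<le> b $ i"
    and unif: "\<And>e. e > 0 \<Longrightarrow> \<forall>\<^sub>F k in sequentially. \<forall>x\<in>cbox a b. \<bar>f k x - g x\<bar> < e"
  shows "(\<lambda>k. zbox (f k) a b) \<longlonglongrightarrow> zbox g a b"
  unfolding zbox_def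
  by (rule z_tendsto[OF restr_box_Conv_sc[OF f ab] restr_box_Conv_sc[OF g ab] epi_converges_restr[OF _ _ unif]])
    (auto intro: Lip_convex_continuous[OF g])

definition psi :: "real^'n \<Rightarrow> real^'n" where
  "psi y = zbox (\<lambda>x. y \<bullet> x) 0 (vec 1)"

lemma continuous_psi: "continuous_on UNIV psi"
  unfolding continuous_on_sequentially
proof (intro allI ballI impI)
  fix ys :: "nat \<Rightarrow> real^'n" and y assume "(\<forall>k. ys k \<in> UNIV) \<and> ys \<longlonglongrightarrow> y"
  then have y: "ys \<longlonglongrightarrow> y" by simp
  obtain B where B: "\<And>x. x \<in> cbox 0 (vec 1 :: real^'n) \<Longrightarrow> norm x \<le> B"
    using bounded_cbox[of "0::real^'n" "vec 1"] by (auto simp: bounded_iff)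
  show "(psi \<circ> ys) \<longlonglongrightarrow> psi y"
    unfolding psi_def o_def
  proof (rule zbox_tendsto[OF Lip_convex_linear Lip_convex_linear])
    fix e :: real assume e: "e > 0"
    have B1: "\<bar>B\<bar> + 1 > 0" by simp
    have "\<forall>\<^sub>F k in sequentially. norm (ys k - y) < e / (\<bar>B\<bar> + 1)"
      using y e B1 unfolding tendsto_iff dist_norm by (simp add: divide_pos_pos)
    then show "\<forall>\<^sub>F k in sequentially. \<forall>x\<in>cbox 0 (vec 1). \<bar>ys k \<bullet> x - y \<bullet> x\<bar> < e"
    proof eventually_elim
      case (elim k)
      show ?case
      proof
        fix x :: "real^'n" assume x: "x \<in> cbox 0 (vec 1)"
        have "\<bar>ys k \<bullet> x - y \<bullet> x\<bar> \<le> norm (ys k - y) * norm x"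
          unfolding inner_diff_left[symmetric] by (rule Cauchy_Schwarz_ineq2)
        also have "\<dots> \<le> norm (ys k - y) * (\<bar>B\<bar> + 1)" using B[OF x] by (intro mult_left_mono) auto
        also have "\<dots> < e" using elim B1 by (simp add: pos_less_divide_eq)
        finally show "\<bar>ys k \<bullet> x - y \<bullet> x\<bar> < e" .
      qed
    qed
  qed simp
qed

text \<open>The sides may be different multiples of h; the proof that \<open>psi\<close> has bounded
  support needs boxes that are long in one direction and thin in the others.\<close>

lemma zbox_linear:
  assumes h: "h > 0" and m: "\<And>i. m i \<ge> 1"
  shows "zbox (\<lambda>x. y \<bullet> x) q (q + (\<chi> i. real (m i) * h)) = (h ^ CARD('n) * real (\<Prod>i\<in>UNIV. m i)) *\<^sub>R psi y"
proof -
  define w :: "real^'n" where "w = h *\<^sub>R vec 1"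
  define P where "P a b = (\<Prod>j\<in>UNIV. (b $ j - a $ j))" for a b :: "real^'n"
  have P: "P a b = P a (upd b i c) + P (upd a i c) b" for a b i c
  proof -
    define r where "r = (\<Prod>j\<in>UNIV - {i}. (b $ j - a $ j))"
    have "P a b = (b $ i - a $ i) * r" "P a (upd b i c) = (c - a $ i) * r" "P (upd a i c) b = (b $ i - c) * r"
      unfolding P_def r_def by (simp_all add: prod.remove[of UNIV i])
    then show ?thesis by (simp add: left_diff_distrib)
  qed
  \<comment> \<open>With e = 0 the grid estimate becomes an identity: the difference of two additive
    box functions vanishes if it vanishes on each cell.\<close>
  have "norm (zbox (\<lambda>x. y \<bullet> x) q (q + (\<chi> i. real (m i) * w $ i)) - P q (q + (\<chi> i. real (m i) * w $ i)) *\<^sub>R psi y) \<le> 0 * real (\<Prod>i\<in>UNIV. m i)"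
  proof (rule grid_bound[where F = "\<lambda>a b. zbox (\<lambda>x. y \<bullet> x) a b - P a b *\<^sub>R psi y" and Z = "{}" and Q = UNIV])
    fix a b :: "real^'n" and i c assume ab: "\<And>j. j \<notin> {} \<Longrightarrow> a $ j < b $ j" and c: "a $ i < c" "c < b $ i"
    have "zbox (\<lambda>x. y \<bullet> x) a b = zbox (\<lambda>x. y \<bullet> x) a (upd b i c) + zbox (\<lambda>x. y \<bullet> x) (upd a i c) b"
      by (rule zbox_additive[OF Lip_convex_linear _ c]) (use ab in \<open>auto intro: less_imp_le\<close>)
    then show "zbox (\<lambda>x. y \<bullet> x) a b - P a b *\<^sub>R psi y = zbox (\<lambda>x. y \<bullet> x) a (upd b i c) - P a (upd b i c) *\<^sub>R psi y + (zbox (\<lambda>x. y \<bullet> x) (upd a i c) b - P (upd a i c) b *\<^sub>R psi y)"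
      unfolding P[of a b i c] by (simp add: scaleR_left_distrib)
  next
    fix q :: "real^'n"
    have "zbox (\<lambda>x. y \<bullet> x) q (q + w) = h ^ CARD('n) *\<^sub>R psi y"
      unfolding w_def psi_def using zbox_scale[OF Lip_convex_linear, of "vec 1" h y q] h by (simp add: resc_linear)
    moreover have "P q (q + w) = h ^ CARD('n)" by (simp add: P_def w_def)
    ultimately show "norm (zbox (\<lambda>x. y \<bullet> x) q (q + w) - P q (q + w) *\<^sub>R psi y) \<le> 0" by simp
  qed (use h m in \<open>auto simp: w_def\<close>)
  moreover have "P q (q + (\<chi> i. real (m i) * w $ i)) = h ^ CARD('n) * real (\<Prod>i\<in>UNIV. m i)"
    by (simp add: P_def w_def prod.distrib)
  ultimately show ?thesis by (simp add: w_def)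
qed

text \<open>A step function whose value on a cell is \<open>z\<close> of the blow-up of f there. Its
  integral over each cell of the lattice equals \<open>zbox f\<close> of the cell exactly, before
  any limit is taken.\<close>

definition cell_fun :: "(real^'n \<Rightarrow> real) \<Rightarrow> nat \<Rightarrow> real^'n \<Rightarrow> real^'n" where
  "cell_fun f k x = zbox (resc f (grid (real (Suc k)) x) (1 / real (Suc k))) 0 (vec 1)"

lemma cell_fun_measurable: "cell_fun f k \<in> borel_measurable borel"
  unfolding cell_fun_def using grid_comp_measurable[of "\<lambda>q. zbox (resc f q (1 / real (Suc k))) 0 (vec 1)"] by simp

lemma cell_fun_bounded:
  assumes f: "Lip_convex L f"
  obtains M where "M \<ge> 0" "\<And>k x. norm (cell_fun f k x) \<le> M"
proof -
  obtain M where M: "M \<ge> 0" "\<And>f. Lip_convex L f \<Longrightarrow> f 0 = 0 \<Longrightarrow> norm (zbox f 0 (vec 1)) \<le> M"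
    using zbox_bounded[of "vec 1" L] by auto
  show ?thesis
    by (rule that[OF M(1)], unfold cell_fun_def, rule M(2)[OF Lip_convex_resc[OF f]]) auto
qed

lemma set_integrable_cell_fun:
  assumes f: "Lip_convex L f"
  shows "set_integrable lebesgue (cbox a b) (cell_fun f k)"
proof -
  obtain M where M: "M \<ge> 0" "\<And>k x. norm (cell_fun f k x) \<le> M" using cell_fun_bounded[OF f] by blast
  have fin: "integrable lebesgue (\<lambda>x. indicator (cbox a b) x * M)"
    using emeasure_compact_finite[OF compact_cbox[of a b]]
    by (intro integrable_mult_left integrable_real_indicator) auto
  show ?thesis unfolding set_integrable_def
  proof (rule Bochner_Integration.integrable_bound[OF fin])
    have "(\<lambda>x. indicator (cbox a b) x *\<^sub>R cell_fun f k x) \<in> borel_measurable borel"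
      using cell_fun_measurable by measurable
    then show "(\<lambda>x. indicator (cbox a b) x *\<^sub>R cell_fun f k x) \<in> borel_measurable lebesgue"
      by (simp add: measurable_completion)
  qed (use M in \<open>auto simp: indicator_def\<close>)
qed

lemma cell_fun_integral_cell:
  assumes f: "Lip_convex L f" and q: "\<And>i. real (Suc k) * q $ i \<in> \<int>"
  shows "(LINT x:cbox q (q + (1 / real (Suc k)) *\<^sub>R vec 1)|lebesgue. cell_fun f k x) = zbox f q (q + (1 / real (Suc k)) *\<^sub>R vec 1)"
proof -
  let ?s = "1 / real (Suc k)"
  let ?C = "cbox q (q + ?s *\<^sub>R vec 1)"
  define c where "c = zbox (resc f q ?s) 0 (vec 1)"
  have "frontier ?C \<in> null_sets lebesgue"
    using negligible_convex_frontier[of ?C] by (simp add: negligible_iff_null_sets)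
  then have "AE x in lebesgue. x \<notin> frontier ?C" by (rule AE_not_in)
  then have ae: "AE x in lebesgue. indicator ?C x *\<^sub>R cell_fun f k x = indicator ?C x *\<^sub>R c"
  proof eventually_elim
    case (elim x)
    then show ?case
      using grid_in_box[OF _ q, of x] by (cases "x \<in> ?C") (auto simp: frontier_def interior_cbox cell_fun_def c_def)
  qed
  have i: "set_integrable lebesgue ?C (cell_fun f k)" by (rule set_integrable_cell_fun[OF f])
  have fin: "integrable lebesgue (\<lambda>x. indicator ?C x *\<^sub>R c)"
    using emeasure_compact_finite[OF compact_cbox[of q "q + ?s *\<^sub>R vec 1"]]
    by (intro integrable_scaleR_left integrable_real_indicator) auto
  have "(LINT x:?C|lebesgue. cell_fun f k x) = (LINT x|lebesgue. indicator ?C x *\<^sub>R c)"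
    unfolding set_lebesgue_integral_def
    by (rule integral_cong_AE[OF _ _ ae])
      (use borel_measurable_integrable[OF i[unfolded set_integrable_def]] borel_measurable_integrable[OF fin] in auto)
  also have "\<dots> = measure lebesgue ?C *\<^sub>R c"
    using emeasure_compact_finite[OF compact_cbox[of q "q + ?s *\<^sub>R vec 1"]] by (subst integral_scaleR_left) auto
  also have "measure lebesgue ?C = ?s ^ CARD('n)"
    using content_cbox_cart[of q "q + ?s *\<^sub>R vec 1"] by (simp add: interval_ne_empty_cart)
  also have "?s ^ CARD('n) *\<^sub>R c = zbox f q (q + ?s *\<^sub>R vec 1)"
    unfolding c_def by (rule zbox_scale[OF f, symmetric]) auto
  finally show ?thesis .
qed

text \<open>Both sides are additive under cuts and agree on lattice cells. The half side R is an
  integer so that the corners of the cube belong to the lattice of mesh 1/(k+1) for every k.\<close>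

lemma cell_fun_integral:
  assumes f: "Lip_convex L f" and R: "R \<ge> (1::nat)"
  shows "(LINT x:cbox (vec (- real R)) (vec (real R))|lebesgue. cell_fun f k x) = zbox f (vec (- real R)) (vec (real R))"
proof -
  let ?s = "1 / real (Suc k)"
  define w :: "real^'n" where "w = ?s *\<^sub>R vec 1"
  \<comment> \<open>A side of length 2 R contains 2 R (k+1) cells of side 1/(k+1).\<close>
  define m where "m = (\<lambda>i::'n. 2 * R * Suc k)"
  define q :: "real^'n" where "q = vec (- real R)"
  have "norm (zbox f q (q + (\<chi> i. real (m i) * w $ i)) - (LINT x:cbox q (q + (\<chi> i. real (m i) * w $ i))|lebesgue. cell_fun f k x)) \<le> 0 * real (\<Prod>i\<in>UNIV. m i)"
  proof (rule grid_bound[where F = "\<lambda>a b. zbox f a b - (LINT x:cbox a b|lebesgue. cell_fun f k x)"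
        and Z = "{}" and Q = "{q. \<forall>i. real (Suc k) * q $ i \<in> \<int>}"])
    fix a b :: "real^'n" and i c assume ab: "\<And>j. j \<notin> {} \<Longrightarrow> a $ j < b $ j" and c: "a $ i < c" "c < b $ i"
    have "zbox f a b = zbox f a (upd b i c) + zbox f (upd a i c) b"
      by (rule zbox_additive[OF f _ c]) (use ab in \<open>auto intro: less_imp_le\<close>)
    moreover have "(LINT x:cbox a b|lebesgue. cell_fun f k x) = (LINT x:cbox a (upd b i c)|lebesgue. cell_fun f k x) + (LINT x:cbox (upd a i c) b|lebesgue. cell_fun f k x)"
      using c by (intro set_lebesgue_integral_box_cut set_integrable_cell_fun[OF f]) auto
    ultimately show "zbox f a b - (LINT x:cbox a b|lebesgue. cell_fun f k x) = zbox f a (upd b i c) - (LINT x:cbox a (upd b i c)|lebesgue. cell_fun f k x) + (zbox f (upd a i c) b - (LINT x:cbox (upd a i c) b|lebesgue. cell_fun f k x))"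
      by simp
  next
    fix q :: "real^'n" assume "q \<in> {q. \<forall>i. real (Suc k) * q $ i \<in> \<int>}"
    then show "norm (zbox f q (q + w) - (LINT x:cbox q (q + w)|lebesgue. cell_fun f k x)) \<le> 0"
      unfolding w_def using cell_fun_integral_cell[OF f, of k q] by simp
  next
    fix q :: "real^'n" and i assume q: "q \<in> {q. \<forall>i. real (Suc k) * q $ i \<in> \<int>}"
    have "real (Suc k) * (q $ i + ?s) = real (Suc k) * q $ i + 1" by (simp add: field_simps)
    then have "real (Suc k) * (q $ i + ?s) \<in> \<int>" using q by simp
    then show "upd q i (q $ i + w $ i) \<in> {q. \<forall>i. real (Suc k) * q $ i \<in> \<int>}" using q by (simp add: w_def)
  next
    have "real (Suc k) * - real R = of_int (- (int (Suc k) * int R))" by simp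
    then have "real (Suc k) * - real R \<in> \<int>" by (metis Ints_of_int)
    then show "q \<in> {q. \<forall>i. real (Suc k) * q $ i \<in> \<int>}" by (simp add: q_def)
  qed (use R in \<open>auto simp: w_def m_def\<close>)
  moreover have "q + (\<chi> i. real (m i) * w $ i) = vec (real R)"
    by (simp add: vec_eq_iff q_def m_def w_def field_simps)
  ultimately show ?thesis by (simp add: q_def)
qed

theorem zbox_eq_grad_integral:
  assumes f: "Lip_convex L f" and R: "R \<ge> (1::nat)"
  defines "B \<equiv> cbox (vec (- real R)) (vec (real R) :: real^'n)"
  shows "z (restr B f) = grad_integral psi (restr B f)"
proof -
  have C: "restr B f \<in> Conv_sc TYPE('n)" unfolding B_def by (rule restr_box_Conv_sc[OF f]) auto
  obtain M where M: "M \<ge> 0" "\<And>k x. norm (cell_fun f k x) \<le> M" using cell_fun_bounded[OF f] by blast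
  have fin: "integrable lebesgue (\<lambda>x. indicator B x * M)"
    using emeasure_compact_finite[OF compact_cbox] unfolding B_def
    by (intro integrable_mult_left integrable_real_indicator) auto
  have lim: "(\<lambda>k. cell_fun f k x) \<longlonglongrightarrow> psi g" if g: "has_grad (restr B f) x g" for x g
  proof -
    have x: "x \<in> interior B" using g by (simp add: has_grad_def)
    have "(rval (restr B f) has_derivative (\<lambda>h. g \<bullet> h)) (at x)" using g by (simp add: has_grad_def)
    then have "(f has_derivative (\<lambda>h. g \<bullet> h)) (at x)"
      by (rule has_derivative_transform_within_open[OF _ open_interior x])
        (use interior_subset[of B] in auto)
    from resc_grid_tendsto[OF this] show ?thesis
      unfolding cell_fun_def psi_def
      by (intro zbox_tendsto[OF Lip_convex_resc[OF f] Lip_convex_linear]) auto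
  qed
  have "(\<lambda>k. LINT x|lebesgue. indicator B x *\<^sub>R cell_fun f k x) \<longlonglongrightarrow> (LINT x|lebesgue. grad_integrand psi (restr B f) x)"
  proof (rule integral_dominated_convergence[OF _ _ fin])
    show "grad_integrand psi (restr B f) \<in> borel_measurable lebesgue"
      by (rule grad_integrand_measurable[OF C continuous_psi])
    show "(\<lambda>x. indicator B x *\<^sub>R cell_fun f k x) \<in> borel_measurable lebesgue" for k
      using borel_measurable_integrable[OF set_integrable_cell_fun[OF f, unfolded set_integrable_def]] unfolding B_def by blast
    show "AE x in lebesgue. (\<lambda>k. indicator B x *\<^sub>R cell_fun f k x) \<longlonglongrightarrow> grad_integrand psi (restr B f) x"
      using AE_has_grad[OF C]
    proof eventually_elim
      case (elim x)
      then show ?case using lim[of x "grad (restr B f) x"]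
        by (cases "x \<in> B") (auto simp: grad_integrand_def)
    qed
    show "AE x in lebesgue. norm (indicator B x *\<^sub>R cell_fun f k x) \<le> indicator B x * M" for k
      using M by (auto simp: indicator_def)
  qed
  \<comment> \<open>The integrals do not depend on k, so their limit is their common value.\<close>
  moreover have "(LINT x|lebesgue. indicator B x *\<^sub>R cell_fun f k x) = z (restr B f)" for k
    using cell_fun_integral[OF f R, of k] by (simp add: set_lebesgue_integral_def B_def zbox_def)
  ultimately have "(\<lambda>k::nat. z (restr B f)) \<longlonglongrightarrow> grad_integral psi (restr B f)" by (simp add: grad_integral_eq)
  then show ?thesis by (simp add: LIMSEQ_const_iff)
qed

end

section \<open>Representation on the whole space\<close>

lemma vec_norm_component:
  obtains i where "norm (y :: real^'n) \<le> real CARD('n) * \<bar>y $ i\<bar>"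
proof -
  have "\<exists>i. norm y \<le> real CARD('n) * \<bar>y $ i\<bar>"
  proof (rule ccontr)
    assume "\<not> ?thesis"
    then have "\<bar>y $ i\<bar> < norm y / real CARD('n)" for i by (simp add: not_le pos_less_divide_eq mult.commute)
    then have "(\<Sum>i\<in>UNIV. \<bar>y $ i\<bar>) < (\<Sum>i\<in>(UNIV::'n set). norm y / real CARD('n))"
      by (intro sum_strict_mono) auto
    then show False using norm_le_l1_cart[of y] by simp
  qed
  then show ?thesis using that by blast
qed

context top_degree
begin

text \<open>Otherwise linear functions with slopes \<open>y k\<close> tending to infinity, restricted to boxes in the
  orthants of \<open>y k\<close> that are thin except in the direction of the largest coordinate of \<open>y k\<close>,
  epi-converge to the indicator of a point, although the long sides can be chosen to keep \<open>z\<close> large.\<close>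

lemma psi_bounded_support: "\<exists>r. \<forall>y. norm y > r \<longrightarrow> psi y = 0"
proof (rule ccontr)
  assume "\<not> ?thesis"
  then have "\<exists>y. norm y > real (Suc k) \<and> psi y \<noteq> 0" for k by blast
  then obtain y where y: "\<And>k. norm (y k) > real (Suc k)" "\<And>k. psi (y k) \<noteq> 0" by metis
  define n where "n = real CARD('n)"
  have n: "n \<ge> 1" by (simp add: n_def Suc_leI)
  have "\<exists>i. norm (y k) \<le> n * \<bar>y k $ i\<bar>" for k unfolding n_def by (metis vec_norm_component)
  then obtain i where i: "\<And>k. norm (y k) \<le> n * \<bar>y k $ i k\<bar>" by metis
  define h where "h k = 1 / real (Suc k)" for k
  have h: "h k > 0" for k by (simp add: h_def)
  \<comment> \<open>The values \<open>psi (y k)\<close> may be arbitrarily small; a row of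
    sufficiently many cells, each contributing h ^ n \<open>psi (y k)\<close>, raises the total norm
    to at least 1.\<close>
  have "\<exists>m\<ge>1. 1 \<le> real m * (h k ^ CARD('n) * norm (psi (y k)))" for k
  proof -
    have pos: "0 < h k ^ CARD('n) * norm (psi (y k))" using h y(2) by simp
    obtain N where "1 < real N * (h k ^ CARD('n) * norm (psi (y k)))"
      using reals_Archimedean3[OF pos] by blast
    then show ?thesis by (intro exI[of _ N]) (cases "N = 0", auto)
  qed
  then obtain m where m: "\<And>k. m k \<ge> 1" "\<And>k. 1 \<le> real (m k) * (h k ^ CARD('n) * norm (psi (y k)))" by metis
  define mm where "mm k j = (if j = i k then m k else 1)" for k j
  define side where "side k j = real (mm k j) * h k" for k j
  have side: "side k j > 0" for k j using h m(1)[of k] by (simp add: side_def mm_def)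
  \<comment> \<open>The box has a vertex at 0 and lies in the orthant of \<open>y k\<close>, so y
    \<bullet> x is a sum of nonnegative terms and dominates each of them.\<close>
  define p where "p k = (\<chi> j. if y k $ j \<ge> 0 then 0 else - side k j)" for k
  define A where "A k = cbox (p k) (p k + (\<chi> j. side k j))" for k
  define us where "us k = restr (A k) (\<lambda>x. y k \<bullet> x)" for k
  have zus: "norm (z (us k)) \<ge> 1" for k
  proof -
    have "z (us k) = (h k ^ CARD('n) * real (\<Prod>j\<in>UNIV. mm k j)) *\<^sub>R psi (y k)"
      unfolding us_def A_def zbox_def[symmetric] side_def using m(1)[of k] h by (intro zbox_linear) (auto simp: mm_def)
    moreover have "(\<Prod>j\<in>UNIV. mm k j) = m k" by (simp add: mm_def)
    ultimately show ?thesis using m(2)[of k] h[of k] by (simp add: mult_ac)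
  qed
  have inA: "y k $ j * x $ j = \<bar>y k $ j\<bar> * \<bar>x $ j\<bar>" "\<bar>x $ j\<bar> \<le> side k j" if "x \<in> A k" for x k j
  proof -
    have "p k $ j \<le> x $ j \<and> x $ j \<le> p k $ j + side k j" using that by (simp add: A_def mem_box_cart)
    then show "y k $ j * x $ j = \<bar>y k $ j\<bar> * \<bar>x $ j\<bar>" "\<bar>x $ j\<bar> \<le> side k j"
      by (cases "y k $ j \<ge> 0"; simp add: p_def)+
  qed
  have inner_ge: "\<bar>y k $ j\<bar> * \<bar>x $ j\<bar> \<le> y k \<bullet> x" if "x \<in> A k" for x k j
  proof -
    have "y k \<bullet> x = (\<Sum>j\<in>UNIV. \<bar>y k $ j\<bar> * \<bar>x $ j\<bar>)" using inA(1)[OF that] by (simp add: inner_vec_def)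
    then show ?thesis using member_le_sum[of j UNIV "\<lambda>j. \<bar>y k $ j\<bar> * \<bar>x $ j\<bar>"] by simp
  qed
  have C: "us k \<in> Conv_sc TYPE('n)" for k
    unfolding us_def A_def by (rule restr_box_Conv_sc[OF Lip_convex_linear]) (use side in \<open>auto intro: less_imp_le\<close>)
  have z0: "Lip_convex 0 (\<lambda>_::real^'n. 0)" by (simp add: Lip_convex_def convex_on_def)
  let ?u = "restr (cbox 0 0) (\<lambda>_. 0) :: real^'n \<Rightarrow> ereal"
  have C0: "?u \<in> Conv_sc TYPE('n)" by (rule restr_box_Conv_sc[OF z0]) simp
  have "z ?u = 0" using zbox_degenerate[OF z0, of 0 0] by (simp add: zbox_def)
  have "epi_converges us ?u"
  proof (rule epi_convergesI)
    fix x xs t and \<sigma> :: "nat \<Rightarrow> nat"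
    assume xs: "xs \<longlonglongrightarrow> x" and s: "strict_mono \<sigma>" and le: "\<And>k. us (\<sigma> k) (xs k) \<le> ereal t"
    have xA: "xs k \<in> A (\<sigma> k)" and yt: "y (\<sigma> k) \<bullet> xs k \<le> t" for k
      using le[of k] by (auto simp: us_def restr_def split: if_splits)
    have "0 \<le> \<bar>y (\<sigma> 0) $ i 0\<bar> * \<bar>xs 0 $ i 0\<bar>" by simp
    then have t: "t \<ge> 0" using inner_ge[OF xA[of 0], where j = "i 0"] yt[of 0] by linarith
    \<comment> \<open>Thin directions are controlled by the side length 1/(k+1). In the long
      direction the level t divided by the slope bounds the coordinate, and the slope is at least
      |y| / n > (k+1) / n.\<close>
    have comp: "\<bar>xs k $ j\<bar> \<le> (1 + t * n) * (1 / real (Suc k))" for k j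
    proof -
      have kk: "1 / real (Suc (\<sigma> k)) \<le> 1 / real (Suc k)"
        using seq_suble[OF s, of k] by (simp add: frac_le)
      have "\<bar>xs k $ j\<bar> \<le> (1 + t * n) * (1 / real (Suc (\<sigma> k)))"
      proof (cases "j = i (\<sigma> k)")
        case True
        let ?Y = "\<bar>y (\<sigma> k) $ j\<bar>"
        have "real (Suc (\<sigma> k)) \<le> n * ?Y" using y(1)[of "\<sigma> k"] i[of "\<sigma> k"] True by simp
        then have "real (Suc (\<sigma> k)) * \<bar>xs k $ j\<bar> \<le> n * ?Y * \<bar>xs k $ j\<bar>" by (rule mult_right_mono) simp
        also have "\<dots> \<le> n * t" using inner_ge[OF xA[of k], where j = j] yt[of k] n by (simp add: mult.assoc)
        also have "\<dots> \<le> 1 + t * n" by (simp add: mult.commute)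
        finally show ?thesis by (simp add: pos_le_divide_eq mult.commute)
      next
        case False
        then have "\<bar>xs k $ j\<bar> \<le> 1 * (1 / real (Suc (\<sigma> k)))" using inA(2)[OF xA[of k], where j = j] by (simp add: side_def mm_def h_def)
        also have "\<dots> \<le> (1 + t * n) * (1 / real (Suc (\<sigma> k)))" using t n by (intro mult_right_mono) auto
        finally show ?thesis .
      qed
      also have "\<dots> \<le> (1 + t * n) * (1 / real (Suc k))" using kk t n by (intro mult_left_mono) auto
      finally show ?thesis .
    qed
    have "x $ j = 0" for j
    proof -
      have "(\<lambda>k. (1 + t * n) * (1 / real (Suc k))) \<longlonglongrightarrow> (1 + t * n) * 0"
        using LIMSEQ_inverse_real_of_nat by (intro tendsto_mult tendsto_const) (simp add: inverse_eq_divide)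
      then have "(\<lambda>k. xs k $ j) \<longlonglongrightarrow> 0"
        using comp by (intro Lim_null_comparison[of "\<lambda>k. xs k $ j" "\<lambda>k. (1 + t * n) * (1 / real (Suc k))"]) auto
      moreover have "(\<lambda>k. xs k $ j) \<longlonglongrightarrow> x $ j" using xs by (rule tendsto_vec_nth)
      ultimately show ?thesis using LIMSEQ_unique by blast
    qed
    then have "x = 0" by (simp add: vec_eq_iff)
    then show "?u x \<le> ereal t" using t by (simp add: restr_def)
  next
    fix x assume "x \<in> dom_fun ?u"
    then have x: "x = 0" by simp
    have "0 \<in> A k" for k using side[of k] by (auto simp: A_def mem_box_cart p_def less_imp_le)
    then have "us k 0 = 0" for k by (simp add: us_def restr_def)
    then show "\<exists>xs. xs \<longlonglongrightarrow> x \<and> limsup (\<lambda>k. us k (xs k)) \<le> ?u x"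
      unfolding x by (intro exI[of _ "\<lambda>_. 0"]) (simp add: restr_def Limsup_const)
  qed
  from z_tendsto[OF C C0 this] have "(\<lambda>k. norm (z (us k))) \<longlonglongrightarrow> norm (z ?u)" by (rule tendsto_norm)
  then have "1 \<le> norm (z ?u)" by (rule LIMSEQ_le_const) (use zus in blast)
  then show False using \<open>z ?u = 0\<close> by simp
qed

end

lemma CcI:
  fixes \<psi> :: "'a::euclidean_space \<Rightarrow> 'b::real_normed_vector"
  assumes "continuous_on UNIV \<psi>" "\<And>y. norm y > r \<Longrightarrow> \<psi> y = 0"
  shows "Cc \<psi>"
proof -
  have "closure {x. \<psi> x \<noteq> 0} \<subseteq> cball 0 r"
    by (rule closure_minimal) (use assms(2) in \<open>force simp: not_le[symmetric]\<close>)+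
  then have "compact (closure {x. \<psi> x \<noteq> 0})"
    by (metis bounded_cball bounded_subset closed_closure compact_eq_bounded_closed)
  then show ?thesis using assms(1) by (simp add: Cc_def)
qed

lemma (in top_degree) Cc_psi: "Cc psi"
  using psi_bounded_support CcI[OF continuous_psi] by blast

section \<open>Lipschitz regularization by infimal convolution\<close>

lemma Conv_sc_bounded_below:
  fixes u :: "real^'n \<Rightarrow> ereal"
  assumes u: "u \<in> Conv_sc T"
  shows "\<exists>c\<ge>0. \<forall>y\<in>dom_fun u. rval u y \<ge> - c"
proof -
  obtain R where R: "R > 0" "\<And>x. x \<in> dom_fun u \<Longrightarrow> norm x \<ge> R \<Longrightarrow> rval u x \<ge> 0 * norm x"
    using Conv_sc_coercive[OF u] by blast
  \<comment> \<open>Nested compact sublevel sets: if none were empty, a common point would have the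
    value -\<infinity>. Outside the ball, coercivity gives nonnegative values.\<close>
  define F where "F k = cball 0 R \<inter> {x. u x \<le> ereal (- real k)}" for k
  have "\<exists>k. F k = {}"
  proof (rule ccontr)
    assume ne: "\<not> ?thesis"
    have "\<Inter>(range F) \<noteq> {}"
    proof (rule compact_nest)
      show "compact (F k)" for k unfolding F_def by (intro compact_Int_closed compact_cball Conv_sc_closed[OF u])
      show "F k \<noteq> {}" for k using ne by blast
      show "F l \<subseteq> F k" if "k \<le> l" for k l
      proof -
        have "ereal (- real l) \<le> ereal (- real k)" using that by simp
        then show ?thesis unfolding F_def using order_trans by blast
      qed
    qed
    then obtain x where x: "\<And>k. x \<in> F k" by blast
    then have "u x \<le> ereal (- real k)" for k by (simp add: F_def)
    then have le: "u x \<le> ereal (- real k)" for k .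
    have xd: "x \<in> dom_fun u" using le[of 0] by (rule le_in_dom)
    have "rval u x \<le> - real k" for k using le[of k] ereal_rval[OF u xd] by (metis ereal_less_eq(3))
    moreover obtain k where "- rval u x < real k" using reals_Archimedean2 by blast
    ultimately show False by (metis minus_less_iff not_less)
  qed
  then obtain k where k: "F k = {}" by blast
  show ?thesis
  proof (intro exI[of _ "real k"] conjI ballI)
    fix y assume y: "y \<in> dom_fun u"
    show "- real k \<le> rval u y"
    proof (cases "norm y \<ge> R")
      case True
      then show ?thesis using R(2)[OF y] by simp
    next
      case False
      then have "y \<in> cball 0 R" by simp
      then have "\<not> u y \<le> ereal (- real k)" using k by (auto simp: F_def)
      then show ?thesis using ereal_rval[OF u y] by (metis ereal_less_eq(3) linear)
    qed
  qed simp
qed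

text \<open>The Pasch-Hausdorff envelope of u, that is, its infimal convolution with k times the
  norm.\<close>

definition inf_conv :: "('a::real_normed_vector \<Rightarrow> ereal) \<Rightarrow> real \<Rightarrow> 'a \<Rightarrow> real" where
  "inf_conv u k x = (INF y\<in>dom_fun u. rval u y + k * norm (x - y))"

lemma
  fixes u :: "real^'n \<Rightarrow> ereal"
  assumes u: "u \<in> Conv_sc T" and k: "k \<ge> 0"
  shows inf_conv_le: "y \<in> dom_fun u \<Longrightarrow> inf_conv u k x \<le> rval u y + k * norm (x - y)"
    and inf_conv_less: "inf_conv u k x < t \<Longrightarrow> \<exists>y\<in>dom_fun u. rval u y + k * norm (x - y) < t"
    and inf_conv_greatest: "(\<And>y. y \<in> dom_fun u \<Longrightarrow> t \<le> rval u y + k * norm (x - y)) \<Longrightarrow> t \<le> inf_conv u k x"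
proof -
  obtain c where c: "\<And>y. y \<in> dom_fun u \<Longrightarrow> rval u y \<ge> - c" "c \<ge> 0"
    using Conv_sc_bounded_below[OF u] by blast
  have bdd: "bdd_below ((\<lambda>y. rval u y + k * norm (x - y)) ` dom_fun u)"
  proof (rule bdd_belowI2[of _ "-c"])
    show "- c \<le> rval u y + k * norm (x - y)" if "y \<in> dom_fun u" for y
      using c(1)[OF that] mult_nonneg_nonneg[OF k norm_ge_zero[of "x - y"]] by linarith
  qed
  have ne: "dom_fun u \<noteq> {}" using dom_fun_nonempty[OF u] by blast
  show "y \<in> dom_fun u \<Longrightarrow> inf_conv u k x \<le> rval u y + k * norm (x - y)"
    unfolding inf_conv_def by (rule cINF_lower[OF bdd])
  show "\<exists>y\<in>dom_fun u. rval u y + k * norm (x - y) < t" if "inf_conv u k x < t"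
    using that unfolding inf_conv_def cINF_less_iff[OF ne bdd] .
  show "t \<le> inf_conv u k x" if "\<And>y. y \<in> dom_fun u \<Longrightarrow> t \<le> rval u y + k * norm (x - y)"
    unfolding inf_conv_def by (rule cINF_greatest[OF ne that])
qed

lemma Lip_convex_inf_conv:
  fixes u :: "real^'n \<Rightarrow> ereal"
  assumes u: "u \<in> Conv_sc T" and k: "k \<ge> 0"
  shows "Lip_convex k (inf_conv u k)"
  unfolding Lip_convex_def convex_on_def
proof (intro conjI ballI allI impI convex_UNIV)
  have lip: "inf_conv u k x - k * norm (x - y) \<le> inf_conv u k y" for x y
  proof (rule inf_conv_greatest[OF u k])
    fix w assume w: "w \<in> dom_fun u"
    have "norm (x - w) \<le> norm (x - y) + norm (y - w)" using norm_triangle_ineq[of "x - y" "y - w"] by simp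
    then have "k * norm (x - w) \<le> k * norm (x - y) + k * norm (y - w)"
      using mult_left_mono[OF _ k] by (simp add: distrib_left[symmetric])
    then show "inf_conv u k x - k * norm (x - y) \<le> rval u w + k * norm (y - w)"
      using inf_conv_le[OF u k w, of x] by linarith
  qed
  show "\<bar>inf_conv u k x - inf_conv u k y\<bar> \<le> k * norm (x - y)" for x y
    using lip[of x y] lip[of y x] by (simp add: abs_le_iff norm_minus_commute)
next
  fix x y and p q :: real assume pq: "0 \<le> p" "0 \<le> q" "p + q = 1"
  show "inf_conv u k (p *\<^sub>R x + q *\<^sub>R y) \<le> p * inf_conv u k x + q * inf_conv u k y"
  proof (rule field_le_epsilon)
    fix e :: real assume "e > 0"
    then obtain v w where v: "v \<in> dom_fun u" "rval u v + k * norm (x - v) < inf_conv u k x + e"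
        and w: "w \<in> dom_fun u" "rval u w + k * norm (y - w) < inf_conv u k y + e"
      using inf_conv_less[OF u k, of x "inf_conv u k x + e"] inf_conv_less[OF u k, of y "inf_conv u k y + e"] by auto
    have d: "p *\<^sub>R v + q *\<^sub>R w \<in> dom_fun u" using convexD[OF Conv_sc_convex_dom[OF u] v(1) w(1) pq] .
    have r: "rval u (p *\<^sub>R v + q *\<^sub>R w) \<le> p * rval u v + q * rval u w"
      using Conv_sc_convex_on[OF u] v(1) w(1) pq unfolding convex_on_def by blast
    have "(p *\<^sub>R x + q *\<^sub>R y) - (p *\<^sub>R v + q *\<^sub>R w) = p *\<^sub>R (x - v) + q *\<^sub>R (y - w)" by (simp add: algebra_simps)
    then have "norm ((p *\<^sub>R x + q *\<^sub>R y) - (p *\<^sub>R v + q *\<^sub>R w)) \<le> p * norm (x - v) + q * norm (y - w)"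
      using norm_triangle_ineq[of "p *\<^sub>R (x - v)" "q *\<^sub>R (y - w)"] pq by simp
    then have "k * norm ((p *\<^sub>R x + q *\<^sub>R y) - (p *\<^sub>R v + q *\<^sub>R w)) \<le> k * (p * norm (x - v) + q * norm (y - w))"
      using k by (rule mult_left_mono)
    then have "inf_conv u k (p *\<^sub>R x + q *\<^sub>R y) \<le> p * rval u v + q * rval u w + k * (p * norm (x - v) + q * norm (y - w))"
      using inf_conv_le[OF u k d, of "p *\<^sub>R x + q *\<^sub>R y"] r by linarith
    also have "\<dots> = p * (rval u v + k * norm (x - v)) + q * (rval u w + k * norm (y - w))" by (simp add: algebra_simps)
    also have "\<dots> \<le> p * (inf_conv u k x + e) + q * (inf_conv u k y + e)"
      by (rule add_mono[OF mult_left_mono[OF less_imp_le[OF v(2)] pq(1)] mult_left_mono[OF less_imp_le[OF w(2)] pq(2)]])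
    also have "\<dots> = p * inf_conv u k x + q * inf_conv u k y + (p + q) * e" by (simp add: algebra_simps)
    finally show "inf_conv u k (p *\<^sub>R x + q *\<^sub>R y) \<le> p * inf_conv u k x + q * inf_conv u k y + e" using pq by simp
  qed
qed

text \<open>Near-minimizers ys for the envelope at xs satisfy k |xs - ys| \<le> K because u is
  bounded below, so they share the limit of xs, and lower semicontinuity of u applies to them.
  Recovery sequences are constant, as the envelope lies below u on the domain and the cubes
  grow.\<close>

lemma epi_converges_inf_conv:
  fixes u :: "real^'n \<Rightarrow> ereal"
  assumes u: "u \<in> Conv_sc T"
  shows "epi_converges (\<lambda>k. restr (cbox (vec (- real (Suc k))) (vec (real (Suc k)))) (inf_conv u (real (Suc k)))) u"
    (is "epi_converges (\<lambda>k. restr (?B k) (?f k)) u")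
proof (rule epi_convergesI)
  fix x xs t and \<sigma> :: "nat \<Rightarrow> nat"
  assume xs: "xs \<longlonglongrightarrow> x" and s: "strict_mono \<sigma>" and le: "\<And>k. restr (?B (\<sigma> k)) (?f (\<sigma> k)) (xs k) \<le> ereal t"
  obtain c where c: "\<And>y. y \<in> dom_fun u \<Longrightarrow> rval u y \<ge> - c" "c \<ge> 0"
    using Conv_sc_bounded_below[OF u] by blast
  have "?f (\<sigma> k) (xs k) < t + 1 / real (Suc k)" for k
  proof -
    have "?f (\<sigma> k) (xs k) \<le> t" using le[of k] by (auto simp: restr_def split: if_splits)
    moreover have "1 / real (Suc k) > 0" by simp
    ultimately show ?thesis by linarith
  qed
  then have "\<exists>y\<in>dom_fun u. rval u y + real (Suc (\<sigma> k)) * norm (xs k - y) < t + 1 / real (Suc k)" for k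
    by (intro inf_conv_less[OF u]) simp_all
  then have "\<forall>k. \<exists>y. y \<in> dom_fun u \<and> rval u y + real (Suc (\<sigma> k)) * norm (xs k - y) < t + 1 / real (Suc k)"
    by blast
  then obtain ys where ys0: "\<forall>k. ys k \<in> dom_fun u \<and>
      rval u (ys k) + real (Suc (\<sigma> k)) * norm (xs k - ys k) < t + 1 / real (Suc k)"
    by (rule choice[THEN exE])
  have ys: "ys k \<in> dom_fun u"
      "rval u (ys k) + real (Suc (\<sigma> k)) * norm (xs k - ys k) < t + 1 / real (Suc k)" for k
    using ys0[rule_format, of k] by (rule conjunct1, rule conjunct2)
  define K where "K = t + 1 + c"
  have nb: "norm (xs k - ys k) \<le> K * (1 / real (Suc k))" for k
  proof -
    have "real (Suc k) * norm (xs k - ys k) \<le> real (Suc (\<sigma> k)) * norm (xs k - ys k)"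
      using seq_suble[OF s, of k] by (intro mult_right_mono) auto
    also have "\<dots> \<le> K"
    proof -
      have "1 / real (Suc k) \<le> 1" by simp
      then show ?thesis using ys(2)[of k] c(1)[OF ys(1)[of k]] unfolding K_def by linarith
    qed
    finally show ?thesis by (simp add: pos_le_divide_eq mult.commute)
  qed
  have K0: "(\<lambda>k. K * (1 / real (Suc k))) \<longlonglongrightarrow> K * 0"
    using LIMSEQ_inverse_real_of_nat by (intro tendsto_mult tendsto_const) (simp add: inverse_eq_divide)
  then have K0': "(\<lambda>k. K * (1 / real (Suc k))) \<longlonglongrightarrow> 0" by (simp only: mult_zero_right)
  have "(\<lambda>k. xs k - ys k) \<longlonglongrightarrow> 0"
    by (rule Lim_null_comparison[OF always_eventually[OF allI[OF nb]] K0'])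
  from tendsto_diff[OF xs this] have yx: "ys \<longlonglongrightarrow> x" by simp
  have "u x \<le> ereal (t + e)" if e: "e > 0" for e
  proof -
    have "(\<lambda>k. 1 / real (Suc k)) \<longlonglongrightarrow> 0" using LIMSEQ_inverse_real_of_nat by (simp add: inverse_eq_divide)
    then have "\<forall>\<^sub>F k in sequentially. 1 / real (Suc k) < e" using e by (rule order_tendstoD(2))
    then have "\<forall>\<^sub>F k in sequentially. u (ys k) \<le> ereal (t + e)"
    proof eventually_elim
      case (elim k)
      have "0 \<le> real (Suc (\<sigma> k)) * norm (xs k - ys k)" by simp
      then have "rval u (ys k) \<le> t + e" using ys(2)[of k] elim by linarith
      then show ?case using ereal_rval[OF u ys(1)[of k]] by (metis ereal_less_eq(3))
    qed
    \<comment> \<open>Lower semicontinuity of u, obtained from epi-convergence of the constant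
      sequence.\<close>
    then show ?thesis
      by (rule epi_converges_subseq_le[OF epi_converges_const[OF u] strict_mono_id yx])
  qed
  then have "u x \<le> ereal t + ereal e" if "e > 0" for e using that by simp
  then show "u x \<le> ereal t" by (rule ereal_le_epsilon2)
next
  fix x assume x: "x \<in> dom_fun u"
  have "\<forall>\<^sub>F k in sequentially. restr (?B k) (?f k) x \<le> u x"
  proof -
    obtain N where N: "norm x \<le> real N" using real_arch_simple by blast
    have "restr (?B k) (?f k) x \<le> u x" if "k \<ge> N" for k
    proof -
      have "- real (Suc k) \<le> x $ i \<and> x $ i \<le> real (Suc k)" for i
        using component_le_norm_cart[of x i] N that by linarith
      then have "x \<in> ?B k" by (simp only: mem_box_cart vec_component simp_thms)
      then have "restr (?B k) (?f k) x = ereal (?f k x)" by (simp only: restr_def if_True)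
      also have "?f k x \<le> rval u x" using inf_conv_le[OF u _ x, of "real (Suc k)" x] by simp
      then have "ereal (?f k x) \<le> ereal (rval u x)" by (simp only: ereal_less_eq(3))
      also have "ereal (rval u x) = u x" by (rule ereal_rval[OF u x])
      finally show ?thesis .
    qed
    then show ?thesis by (auto simp: eventually_sequentially)
  qed
  then have l: "limsup (\<lambda>k. restr (?B k) (?f k) x) \<le> u x" by (rule Limsup_bounded)
  show "\<exists>xs. xs \<longlonglongrightarrow> x \<and> limsup (\<lambda>k. restr (?B k) (?f k) (xs k)) \<le> u x"
    by (rule exI[of _ "\<lambda>_. x"], rule conjI[OF tendsto_const l])
qed

theorem (in top_degree) z_eq_grad_integral:
  assumes u: "u \<in> Conv_sc TYPE('n)"
  shows "z u = grad_integral psi u"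
proof -
  define us where "us k = restr (cbox (vec (- real (Suc k))) (vec (real (Suc k)))) (inf_conv u (real (Suc k)))" for k
  have L: "Lip_convex (real (Suc k)) (inf_conv u (real (Suc k)))" for k by (rule Lip_convex_inf_conv[OF u]) simp
  have C: "us k \<in> Conv_sc TYPE('n)" for k unfolding us_def by (rule restr_box_Conv_sc[OF L]) auto
  have ep: "epi_converges us u" unfolding us_def by (rule epi_converges_inf_conv[OF u])
  have "z (us k) = grad_integral psi (us k)" for k
    unfolding us_def by (rule zbox_eq_grad_integral[OF L]) simp
  then have "(\<lambda>k. z (us k)) \<longlonglongrightarrow> grad_integral psi u"
    using grad_integral_tendsto[OF Cc_psi C u ep] by simp
  then show ?thesis using z_tendsto[OF C u ep] LIMSEQ_unique by blast
qed

lemma top_degree_valuation_iff: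
  fixes z :: "(real^'n \<Rightarrow> ereal) \<Rightarrow> real^'n"
  shows "top_degree_valuation TYPE('n) z \<longleftrightarrow>
    (\<exists>\<psi>. Cc \<psi> \<and> (\<forall>u\<in>Conv_sc TYPE('n). z u = grad_integral \<psi> u))"
proof
  assume "top_degree_valuation TYPE('n) z"
  then interpret top_degree z by unfold_locales
  show "\<exists>\<psi>. Cc \<psi> \<and> (\<forall>u\<in>Conv_sc TYPE('n). z u = grad_integral \<psi> u)"
    using Cc_psi z_eq_grad_integral by blast
next
  assume "\<exists>\<psi>. Cc \<psi> \<and> (\<forall>u\<in>Conv_sc TYPE('n). z u = grad_integral \<psi> u)"
  then show "top_degree_valuation TYPE('n) z"
    using top_degree_valuation_cong[OF top_degree_valuation_grad_integral] by blast
qed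

section \<open>Equivariance\<close>

declare transpose_matrix_vector [simp del]

lemma matrix_inv_orthogonal:
  fixes A :: "real^'n^'n"
  assumes "orthogonal_matrix A"
  shows "matrix_inv A = transpose A"
proof -
  have A: "transpose A ** A = mat 1" "A ** transpose A = mat 1" using assms by (auto simp: orthogonal_matrix_def)
  have "A ** matrix_inv A = mat 1 \<and> matrix_inv A ** A = mat 1"
    unfolding matrix_inv_def by (rule someI[of _ "transpose A"]) (use A in auto)
  then have "matrix_inv A = (transpose A ** A) ** matrix_inv A" using A by simp
  also have "\<dots> = transpose A" using \<open>A ** matrix_inv A = mat 1 \<and> _\<close> by (simp flip: matrix_mul_assoc)
  finally show ?thesis .
qed

lemma orthogonal_matrix_facts:
  fixes A :: "real^'n^'n"
  assumes "orthogonal_matrix A"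
  shows "transpose A *v (A *v x) = x" "A *v (transpose A *v x) = x" "norm (A *v x) = norm x"
    "norm (transpose A *v x) = norm x" "y \<bullet> (transpose A *v x) = (A *v y) \<bullet> x"
proof -
  have A: "transpose A ** A = mat 1" "A ** transpose A = mat 1" using assms by (auto simp: orthogonal_matrix_def)
  show a: "transpose A *v (A *v x) = x" "A *v (transpose A *v x) = x" for x
    using A by (simp_all add: matrix_vector_mul_assoc)
  show b: "y \<bullet> (transpose A *v x) = (A *v y) \<bullet> x" for x y
    using dot_lmul_matrix[of x A y] by (simp add: inner_commute transpose_matrix_vector)
  have "norm (A *v x) ^ 2 = norm x ^ 2" for x
    using b[of x "A *v x"] a(1)[of x] by (simp add: power2_norm_eq_inner)
  then show c: "norm (A *v x) = norm x" for x by simp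
  show "norm (transpose A *v x) = norm x" using c[of "transpose A *v x"] a(2)[of x] by simp
qed

definition rot :: "real^'n^'n \<Rightarrow> (real^'n \<Rightarrow> ereal) \<Rightarrow> real^'n \<Rightarrow> ereal" where
  "rot A u = (\<lambda>x. u (matrix_inv A *v x))"

lemma rot_Conv_sc:
  assumes A: "orthogonal_matrix A" and u: "u \<in> Conv_sc T"
  shows "rot A u \<in> Conv_sc T"
proof -
  have "(\<lambda>x. ereal 1 * u (transpose A *v x + 0) + ereal 0) \<in> Conv_sc T"
    by (rule Conv_sc_affine[OF u, where s = 1])
      (use orthogonal_matrix_facts(4)[OF A] in \<open>auto intro: matrix_vector_mul_linear\<close>)
  then show ?thesis by (simp add: rot_def matrix_inv_orthogonal[OF A] flip: one_ereal_def zero_ereal_def)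
qed

lemma epi_converges_rot:
  assumes A: "orthogonal_matrix (A :: real^'n^'n)" and ep: "epi_converges us u"
  shows "epi_converges (\<lambda>k. rot A (us k)) (rot A u)"
  unfolding epi_converges_def
proof (intro allI conjI impI)
  have lim: "(\<lambda>k. B *v xs k) \<longlonglongrightarrow> B *v x" if "xs \<longlonglongrightarrow> x" for B :: "real^'n^'n" and xs and x :: "real^'n"
    using that by (rule bounded_linear.tendsto[OF matrix_vector_mul_bounded_linear])
  fix x
  let ?x = "transpose A *v x"
  show "rot A u x \<le> liminf (\<lambda>k. rot A (us k) (xs k))" if "xs \<longlonglongrightarrow> x" for xs
    using ep lim[OF that, of "transpose A"] by (auto simp: rot_def matrix_inv_orthogonal[OF A] epi_converges_def)
  obtain ys where "ys \<longlonglongrightarrow> ?x" "(\<lambda>k. us k (ys k)) \<longlonglongrightarrow> u ?x" using ep unfolding epi_converges_def by blast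
  then show "\<exists>xs. xs \<longlonglongrightarrow> x \<and> (\<lambda>k. rot A (us k) (xs k)) \<longlonglongrightarrow> rot A u x"
    using lim[of ys ?x A]
    by (intro exI[of _ "\<lambda>k. A *v ys k"]) (simp add: rot_def matrix_inv_orthogonal[OF A] orthogonal_matrix_facts[OF A])
qed

lemma top_degree_valuation_rot:
  assumes A: "orthogonal_matrix (A :: real^'n^'n)" and z: "top_degree_valuation TYPE('n) z"
  shows "top_degree_valuation TYPE('n) (\<lambda>u. transpose A *v z (rot A u))"
proof -
  let ?z = "\<lambda>u. transpose A *v z (rot A u)" and ?C = "Conv_sc TYPE('n)"
  have "epi_continuous ?C ?z"
    unfolding epi_continuous_def
  proof (intro allI impI)
    fix us u assume us: "\<forall>k. us k \<in> ?C" "u \<in> ?C" "epi_converges us u"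
    have "(\<lambda>k. z (rot A (us k))) \<longlonglongrightarrow> z (rot A u)"
      by (rule top_degree.z_tendsto[OF top_degree.intro[OF z] _ _ epi_converges_rot[OF A us(3)]])
        (use us rot_Conv_sc[OF A] in auto)
    then show "(\<lambda>k. ?z (us k)) \<longlonglongrightarrow> ?z u"
      by (rule bounded_linear.tendsto[OF matrix_vector_mul_bounded_linear])
  qed
  moreover have "is_valuation ?C ?z"
    unfolding is_valuation_def
  proof (intro ballI impI)
    fix u w :: "real^'n \<Rightarrow> ereal"
    let ?M = "\<lambda>x. max (u x) (w x)" and ?m = "\<lambda>x. min (u x) (w x)"
    assume c: "u \<in> ?C" "w \<in> ?C" "?M \<in> ?C" "?m \<in> ?C"
    have M: "(\<lambda>x. max (rot A u x) (rot A w x)) = rot A ?M" "(\<lambda>x. min (rot A u x) (rot A w x)) = rot A ?m"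
      by (simp_all add: rot_def)
    have "is_valuation ?C z" using z by (simp add: top_degree_valuation_def)
    from this[unfolded is_valuation_def, rule_format, OF c(1,2)[THEN rot_Conv_sc[OF A]], unfolded M, OF c(3,4)[THEN rot_Conv_sc[OF A]]]
    have "z (rot A ?M) + z (rot A ?m) = z (rot A u) + z (rot A w)" .
    then show "?z ?M + ?z ?m = ?z u + ?z w" by (simp only: matrix_vector_right_distrib[symmetric])
  qed
  moreover have "epi_translation_invariant ?C ?z"
    unfolding epi_translation_invariant_def
  proof (intro ballI allI)
    fix u :: "real^'n \<Rightarrow> ereal" and x0 and c :: real assume u: "u \<in> ?C"
    have "rot A (\<lambda>y. u (y - x0) + ereal c) = (\<lambda>y. rot A u (y - A *v x0) + ereal c)"
      by (simp add: rot_def matrix_inv_orthogonal[OF A] matrix_vector_mult_diff_distrib orthogonal_matrix_facts[OF A])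
    then show "?z (\<lambda>y. u (y - x0) + ereal c) = ?z u"
      using z rot_Conv_sc[OF A u] unfolding top_degree_valuation_def epi_translation_invariant_def by simp
  qed
  moreover have "epi_homogeneous ?C (real CARD('n)) ?z"
    unfolding epi_homogeneous_def
  proof (intro ballI allI impI)
    fix u :: "real^'n \<Rightarrow> ereal" and l :: real assume u: "u \<in> ?C" and l: "l > 0"
    have "rot A (epi_mult l u) = epi_mult l (rot A u)"
      by (simp add: rot_def epi_mult_def matrix_vector_mult_scaleR)
    then have "z (rot A (epi_mult l u)) = l powr real CARD('n) *\<^sub>R z (rot A u)"
      using z rot_Conv_sc[OF A u] l unfolding top_degree_valuation_def epi_homogeneous_def by simp
    then show "?z (epi_mult l u) = l powr real CARD('n) *\<^sub>R ?z u" by (simp add: matrix_vector_mult_scaleR)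
  qed
  ultimately show ?thesis by (simp add: top_degree_valuation_def)
qed

text \<open>A ball replaces the cube as test domain because it is invariant under orthogonal maps:
  rotating the function only rotates y.\<close>

definition ball_fun :: "real^'n \<Rightarrow> real^'n \<Rightarrow> ereal" where
  "ball_fun y = restr (cball 0 1) (\<lambda>x. y \<bullet> x)"

lemma ball_fun_Conv_sc: "ball_fun y \<in> Conv_sc TYPE('n)" for y :: "real^'n"
  unfolding ball_fun_def
proof (rule restr_Conv_sc)
  show "convex_on (cball 0 1) (\<lambda>x. y \<bullet> x)"
    using Lip_convexD(1)[OF Lip_convex_linear] by (rule convex_on_subset) auto
qed (auto intro!: continuous_intros)

lemma rot_ball_fun:
  assumes A: "orthogonal_matrix (A :: real^'n^'n)"
  shows "rot A (ball_fun y) = ball_fun (A *v y)"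
  by (rule ext) (simp add: rot_def ball_fun_def restr_def matrix_inv_orthogonal[OF A] orthogonal_matrix_facts[OF A])

lemma grad_integral_ball_fun:
  fixes y :: "real^'n"
  assumes \<psi>: "Cc \<psi>"
  shows "grad_integral \<psi> (ball_fun y) = measure lebesgue (cball (0::real^'n) 1) *\<^sub>R \<psi> y"
proof -
  let ?B = "cball (0::real^'n) 1"
  have gr: "grad (ball_fun y) x = y" if "has_grad (ball_fun y) x (grad (ball_fun y) x)" for x
  proof -
    have x: "x \<in> interior ?B" using that by (simp add: has_grad_def ball_fun_def)
    have "((\<lambda>x. y \<bullet> x) has_derivative (\<lambda>h. y \<bullet> h)) (at x)" by (auto intro!: derivative_eq_intros)
    then have "(rval (ball_fun y) has_derivative (\<lambda>h. y \<bullet> h)) (at x)"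
      by (rule has_derivative_transform_within_open[OF _ open_interior x])
        (use interior_subset[of ?B] in \<open>auto simp: ball_fun_def restr_def\<close>)
    then have "has_grad (ball_fun y) x y" using x by (simp add: has_grad_def ball_fun_def)
    then show ?thesis by (rule has_grad_grad)
  qed
  have dom: "dom_fun (ball_fun y) = ?B" by (simp add: ball_fun_def)
  have ae: "AE x in lebesgue. grad_integrand \<psi> (ball_fun y) x = indicator ?B x *\<^sub>R \<psi> y"
    using AE_has_grad[OF ball_fun_Conv_sc[of y]]
  proof eventually_elim
    case (elim x)
    then show ?case using gr[of x] by (cases "x \<in> ?B") (auto simp: grad_integrand_def dom)
  qed
  have fin: "emeasure lebesgue ?B < \<infinity>" using emeasure_compact_finite[OF compact_cball[of "0::real^'n" 1]] by simp
  then have i: "integrable lebesgue (\<lambda>x. indicator ?B x *\<^sub>R \<psi> y)"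
    by (intro integrable_scaleR_left integrable_real_indicator) auto
  have "grad_integral \<psi> (ball_fun y) = (LINT x|lebesgue. indicator ?B x *\<^sub>R \<psi> y)"
    unfolding grad_integral_eq
    by (rule integral_cong_AE[OF borel_measurable_integrable[OF integrable_grad_integrand[OF \<psi> ball_fun_Conv_sc]] borel_measurable_integrable[OF i] ae])
  also have "\<dots> = measure lebesgue ?B *\<^sub>R \<psi> y" using fin by (subst integral_scaleR_left) auto
  finally show ?thesis .
qed

lemma measure_unit_ball_pos: "measure lebesgue (cball (0::real^'n) 1) > 0"
  using content_cball_pos[of 1 "0::real^'n"] by simp

text \<open>On \<open>ball_fun y\<close> the integral is the volume of the unit ball times \<psi> y,
  so testing equivariance on these functions reads it off for the density.\<close>

lemma equivariant_density:
  fixes \<psi> :: "real^'n \<Rightarrow> real^'n"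
  assumes \<psi>: "Cc \<psi>" and z: "\<And>u. u \<in> Conv_sc TYPE('n) \<Longrightarrow> z u = grad_integral \<psi> u"
    and G: "G \<subseteq> O_matrices" and eq: "equivariant G (Conv_sc TYPE('n)) z" and A: "A \<in> G"
  shows "\<psi> (A *v y) = A *v \<psi> y"
proof -
  have oA: "orthogonal_matrix A" using A G by (auto simp: O_matrices_def)
  have "z (rot A (ball_fun y)) = A *v z (ball_fun y)"
    using eq A ball_fun_Conv_sc[of y] unfolding equivariant_def rot_def by blast
  then have "measure lebesgue (cball (0::real^'n) 1) *\<^sub>R \<psi> (A *v y) = measure lebesgue (cball (0::real^'n) 1) *\<^sub>R (A *v \<psi> y)"
    unfolding rot_ball_fun[OF oA]
    by (simp add: z ball_fun_Conv_sc grad_integral_ball_fun[OF \<psi>] matrix_vector_mult_scaleR)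
  then show ?thesis using measure_unit_ball_pos[where 'n='n] by simp
qed

text \<open>The rotated valuation is again of top degree, hence has a density by
  \<open>top_degree_valuation_iff\<close>, and testing on balls identifies this density: no change of
  variables for orthogonal maps is needed.\<close>

lemma grad_integral_rot:
  fixes \<psi> :: "real^'n \<Rightarrow> real^'n"
  assumes \<psi>: "Cc \<psi>" and A: "orthogonal_matrix A" and eq: "\<And>y. \<psi> (A *v y) = A *v \<psi> y"
    and u: "u \<in> Conv_sc TYPE('n)"
  shows "grad_integral \<psi> (rot A u) = A *v grad_integral \<psi> u"
proof -
  obtain \<phi> where \<phi>: "Cc \<phi>" "\<And>u. u \<in> Conv_sc TYPE('n) \<Longrightarrow> transpose A *v grad_integral \<psi> (rot A u) = grad_integral \<phi> u"
    using top_degree_valuation_rot[OF A top_degree_valuation_grad_integral[OF \<psi>]]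
    unfolding top_degree_valuation_iff by blast
  have "\<phi> y = \<psi> y" for y
  proof -
    have "measure lebesgue (cball (0::real^'n) 1) *\<^sub>R \<phi> y = transpose A *v (measure lebesgue (cball (0::real^'n) 1) *\<^sub>R \<psi> (A *v y))"
      using \<phi>(2)[OF ball_fun_Conv_sc[of y]]
      by (simp add: rot_ball_fun[OF A] grad_integral_ball_fun[OF \<psi>] grad_integral_ball_fun[OF \<phi>(1)])
    also have "\<dots> = measure lebesgue (cball (0::real^'n) 1) *\<^sub>R \<psi> y"
      by (simp add: eq matrix_vector_mult_scaleR orthogonal_matrix_facts[OF A])
    finally show ?thesis using measure_unit_ball_pos[where 'n='n] by simp
  qed
  then have "\<phi> = \<psi>" by blast
  then have "A *v (transpose A *v grad_integral \<psi> (rot A u)) = A *v grad_integral \<psi> u"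
    using \<phi>(2)[OF u] by simp
  then show ?thesis by (simp add: orthogonal_matrix_facts[OF A])
qed

definition radial :: "(real \<Rightarrow> real) \<Rightarrow> real^'n \<Rightarrow> real^'n" where
  "radial \<xi> y = (if y = 0 then 0 else \<xi> (norm y) *\<^sub>R y)"

lemma t_op_eq: "t_op \<xi> = grad_integral (radial \<xi>)"
  by (simp add: t_op_def grad_integral_def radial_def fun_eq_iff)

text \<open>The norm of \<open>radial \<xi> y\<close> is |\<xi>(|y|)| |y| for y \<noteq> 0, so the
  limit condition on \<xi> yields continuity at the origin; elsewhere continuity is inherited from
  \<xi>.\<close>

lemma Cc_radial:
  assumes \<xi>: "Cb_pos \<xi>" and lim: "((\<lambda>t. \<xi> t * t) \<longlongrightarrow> 0) (at_right 0)"
  shows "Cc (radial \<xi> :: real^'n \<Rightarrow> real^'n)"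
proof -
  obtain b where b: "\<And>t. t > b \<Longrightarrow> \<xi> t = 0" and c: "continuous_on {0<..} \<xi>" using \<xi> by (auto simp: Cb_pos_def)
  have "isCont (radial \<xi>) y" for y :: "real^'n"
  proof (cases "y = 0")
    case False
    have "continuous_on (- {0}) (\<lambda>y::real^'n. \<xi> (norm y) *\<^sub>R y)"
      by (intro continuous_intros continuous_on_compose2[OF c]) auto
    then have "continuous_on (- {0::real^'n}) (radial \<xi>)"
      by (rule continuous_on_eq) (auto simp: radial_def)
    moreover have "open (- {0::real^'n})" by (simp add: open_Compl)
    ultimately show ?thesis using False continuous_on_eq_continuous_at by blast
  next
    case True
    have "((\<lambda>y::real^'n. \<xi> (norm y) * norm y) \<longlongrightarrow> 0) (at 0)"
    proof (rule filterlim_compose[OF lim])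
      show "filterlim norm (at_right 0) (at (0::real^'n))"
        unfolding filterlim_at by (auto intro!: tendsto_norm_zero tendsto_ident_at simp: eventually_at_filter)
    qed
    then have "((\<lambda>y::real^'n. norm (radial \<xi> y)) \<longlongrightarrow> 0) (at 0)"
    proof (rule Lim_transform_eventually[OF tendsto_rabs_zero])
      show "\<forall>\<^sub>F y::real^'n in at 0. \<bar>\<xi> (norm y) * norm y\<bar> = norm (radial \<xi> y)"
        by (auto simp: radial_def eventually_at_filter abs_mult)
    qed
    then have "((radial \<xi> :: real^'n \<Rightarrow> real^'n) \<longlongrightarrow> 0) (at 0)" by (rule tendsto_norm_zero_cancel)
    then show ?thesis using True by (simp add: isCont_def radial_def)
  qed
  then have "continuous_on UNIV (radial \<xi> :: real^'n \<Rightarrow> real^'n)" by (simp add: continuous_at_imp_continuous_on)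
  then show ?thesis by (rule CcI[of _ b]) (simp add: radial_def b)
qed

text \<open>Let w be the component of \<psi> y orthogonal to y. An element that fixes y and reverses
  w fixes \<psi> y, hence w, so w = 0 and \<psi> y is a multiple of y. Transitivity then transports
  the factor from the ray through a fixed unit vector e to all directions.\<close>

lemma radial_if_equivariant:
  fixes \<psi> :: "real^'n \<Rightarrow> real^'n"
  assumes \<psi>: "Cc \<psi>" and G: "G \<subseteq> O_matrices" and eq: "\<And>A y. A \<in> G \<Longrightarrow> \<psi> (A *v y) = A *v \<psi> y"
    and tra: "\<And>x y :: real^'n. norm x = norm y \<Longrightarrow> \<exists>A\<in>G. A *v x = y"
    and flp: "\<And>y w :: real^'n. y \<bullet> w = 0 \<Longrightarrow> \<exists>A\<in>G. A *v y = y \<and> A *v w = - w"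
  obtains \<xi> where "Cb_pos \<xi>" "((\<lambda>t. \<xi> t * t) \<longlongrightarrow> 0) (at_right 0)" "\<psi> = radial \<xi>"
proof -
  have ker: "w = 0" if "- w = w" for w :: "real^'n"
    using that by (simp add: vec_eq_iff)
  \<comment> \<open>Every vector is orthogonal to 0, so an element of the group reverses \<psi> 0
    itself.\<close>
  have z0: "\<psi> 0 = 0"
  proof -
    obtain A where A: "A \<in> G" "A *v \<psi> 0 = - \<psi> 0" using flp[of 0 "\<psi> 0"] by auto
    then show ?thesis using eq[OF A(1), of 0] ker by simp
  qed
  have par: "\<psi> y = ((\<psi> y \<bullet> y) / (y \<bullet> y)) *\<^sub>R y" if y: "y \<noteq> 0" for y
  proof -
    define a where "a = (\<psi> y \<bullet> y) / (y \<bullet> y)"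
    define w where "w = \<psi> y - a *\<^sub>R y"
    have "y \<bullet> w = 0" using y by (simp add: w_def a_def inner_diff_right inner_commute)
    then obtain A where A: "A \<in> G" "A *v y = y" "A *v w = - w" using flp by blast
    have "w = \<psi> (A *v y) - a *\<^sub>R (A *v y)" by (simp add: w_def A(2))
    also have "\<dots> = A *v w" by (simp add: w_def eq[OF A(1)] matrix_vector_mult_diff_distrib matrix_vector_mult_scaleR)
    finally have "w = 0" using A(3) ker by simp
    then show ?thesis by (simp add: w_def a_def)
  qed
  define e :: "real^'n" where "e = axis undefined 1"
  have e: "norm e = 1" "e \<bullet> e = 1" by (simp_all add: e_def norm_axis_1 inner_axis_axis)
  have e0: "e \<noteq> 0" using e by auto
  define \<xi> where "\<xi> t = (\<psi> (t *\<^sub>R e) \<bullet> e) / t" for t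
  obtain r B where r: "\<And>y. norm y > r \<Longrightarrow> \<psi> y = 0" "\<And>y. norm (\<psi> y) \<le> B" "B \<ge> 0"
    using Cc_bounds[OF \<psi>] by blast
  have c: "continuous_on UNIV \<psi>" using \<psi> by (simp add: Cc_def)
  have ce: "continuous_on S (\<lambda>t. \<psi> (t *\<^sub>R e) \<bullet> e)" for S
    by (intro continuous_intros continuous_on_compose2[OF c]) auto
  show ?thesis
  proof (rule that)
    have "continuous_on {0<..} \<xi>" unfolding \<xi>_def by (intro continuous_intros ce) auto
    moreover have "\<xi> t = 0" if "t > \<bar>r\<bar>" for t
      using r(1)[of "t *\<^sub>R e"] that e by (simp add: \<xi>_def)
    ultimately show "Cb_pos \<xi>" unfolding Cb_pos_def by blast
    have "isCont (\<lambda>t. \<psi> (t *\<^sub>R e) \<bullet> e) 0"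
      using ce[of UNIV] continuous_on_eq_continuous_at[OF open_UNIV] by blast
    then have "((\<lambda>t. \<psi> (t *\<^sub>R e) \<bullet> e) \<longlongrightarrow> \<psi> (0 *\<^sub>R e) \<bullet> e) (at_right 0)"
      by (rule tendsto_within_subset[OF isContD]) (rule subset_UNIV)
    then have L: "((\<lambda>t. \<psi> (t *\<^sub>R e) \<bullet> e) \<longlongrightarrow> 0) (at_right 0)"
      by (simp only: scaleR_zero_left z0 inner_zero_left)
    have "\<forall>\<^sub>F t in at_right 0. \<psi> (t *\<^sub>R e) \<bullet> e = \<xi> t * t"
      using eventually_at_right_less[of "0::real"] by eventually_elim (simp add: \<xi>_def)
    with L show "((\<lambda>t. \<xi> t * t) \<longlongrightarrow> 0) (at_right 0)" by (rule Lim_transform_eventually)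
    show "\<psi> = radial \<xi>"
    proof
      fix y
      show "\<psi> y = radial \<xi> y"
      proof (cases "y = 0")
        case False
        define t where "t = norm y"
        have t: "t > 0" using False by (simp add: t_def)
        have "norm (t *\<^sub>R e) = norm y" using e by (simp add: t_def)
        then obtain A where A: "A \<in> G" "A *v (t *\<^sub>R e) = y" using tra by blast
        have "\<psi> (t *\<^sub>R e) = \<xi> t *\<^sub>R (t *\<^sub>R e)"
          using par[of "t *\<^sub>R e"] t e0 e by (simp add: \<xi>_def)
        then have "\<psi> y = \<xi> t *\<^sub>R y" using eq[OF A(1), of "t *\<^sub>R e"] A(2)
          by (simp only: matrix_vector_mult_scaleR[of A "\<xi> t"])
        then show ?thesis using False by (simp add: radial_def t_def)
      qed (simp add: z0 radial_def)
    qed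
  qed
qed

lemma equivariant_iff_t_op:
  fixes z :: "(real^'n \<Rightarrow> ereal) \<Rightarrow> real^'n"
  assumes z: "top_degree_valuation TYPE('n) z" and G: "G \<subseteq> O_matrices"
    and tra: "\<And>x y :: real^'n. norm x = norm y \<Longrightarrow> \<exists>A\<in>G. A *v x = y"
    and flp: "\<And>y w :: real^'n. y \<bullet> w = 0 \<Longrightarrow> \<exists>A\<in>G. A *v y = y \<and> A *v w = - w"
  shows "equivariant G (Conv_sc TYPE('n)) z \<longleftrightarrow>
    (\<exists>\<xi>. Cb_pos \<xi> \<and> ((\<lambda>t. \<xi> t * t) \<longlongrightarrow> 0) (at_right 0) \<and> (\<forall>u\<in>Conv_sc TYPE('n). z u = t_op \<xi> u))"
proof
  assume eq: "equivariant G (Conv_sc TYPE('n)) z"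
  obtain \<psi> where \<psi>: "Cc \<psi>" "\<And>u. u \<in> Conv_sc TYPE('n) \<Longrightarrow> z u = grad_integral \<psi> u"
    using z unfolding top_degree_valuation_iff by blast
  obtain \<xi> where "Cb_pos \<xi>" "((\<lambda>t. \<xi> t * t) \<longlongrightarrow> 0) (at_right 0)" "\<psi> = radial \<xi>"
    using radial_if_equivariant[OF \<psi>(1) G equivariant_density[OF \<psi> G eq] tra flp] by blast
  then show "\<exists>\<xi>. Cb_pos \<xi> \<and> ((\<lambda>t. \<xi> t * t) \<longlongrightarrow> 0) (at_right 0) \<and> (\<forall>u\<in>Conv_sc TYPE('n). z u = t_op \<xi> u)"
    using \<psi>(2) unfolding t_op_eq by blast
next
  assume "\<exists>\<xi>. Cb_pos \<xi> \<and> ((\<lambda>t. \<xi> t * t) \<longlongrightarrow> 0) (at_right 0) \<and> (\<forall>u\<in>Conv_sc TYPE('n). z u = t_op \<xi> u)"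
  then obtain \<xi> where \<xi>: "Cb_pos \<xi>" "((\<lambda>t. \<xi> t * t) \<longlongrightarrow> 0) (at_right 0)"
      "\<And>u. u \<in> Conv_sc TYPE('n) \<Longrightarrow> z u = grad_integral (radial \<xi>) u"
    unfolding t_op_eq by blast
  show "equivariant G (Conv_sc TYPE('n)) z"
    unfolding equivariant_def
  proof (intro ballI)
    fix u :: "real^'n \<Rightarrow> ereal" and A assume u: "u \<in> Conv_sc TYPE('n)" and "A \<in> G"
    then have A: "orthogonal_matrix A" using G by (auto simp: O_matrices_def)
    have "A *v y = 0 \<longleftrightarrow> y = 0" for y using orthogonal_matrix_facts(3)[OF A, of y] by (metis norm_eq_zero)
    then have "radial \<xi> (A *v y) = A *v radial \<xi> y" for y
      by (simp add: radial_def orthogonal_matrix_facts(3)[OF A] matrix_vector_mult_scaleR)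
    then have "z (rot A u) = A *v z u"
      using grad_integral_rot[OF Cc_radial[OF \<xi>(1,2)] A _ u] \<xi>(3) rot_Conv_sc[OF A] u by simp
    then show "z (\<lambda>x. u (matrix_inv A *v x)) = A *v z u" by (simp add: rot_def)
  qed
qed

section \<open>Transitivity and flips in O(n) and SO(n)\<close>

definition reflection :: "'a::real_inner \<Rightarrow> 'a \<Rightarrow> 'a" where
  "reflection e x = x - (2 * (e \<bullet> x)) *\<^sub>R e"

lemma orthogonal_transformation_reflection:
  assumes "norm e = 1"
  shows "orthogonal_transformation (reflection e)"
proof -
  have "e \<bullet> e = 1" using assms by (simp add: dot_square_norm)
  then show ?thesis
    unfolding orthogonal_transformation_def
    by (auto simp: reflection_def linear_iff algebra_simps inner_commute)
qed

lemma orthogonal_transformation_matrix_vector: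
  fixes f :: "real^'n \<Rightarrow> real^'n"
  assumes "orthogonal_transformation f"
  shows "orthogonal_matrix (matrix f)" "matrix f *v x = f x"
  using assms by (auto simp: orthogonal_transformation_matrix matrix_works linear_matrix_vector_mul_eq[symmetric])

lemma O_matrices_transitive:
  assumes "norm (x :: real^'n) = norm y"
  shows "\<exists>A\<in>O_matrices. A *v x = y"
proof -
  obtain f where "orthogonal_transformation f" "f x = y" using orthogonal_transformation_exists[OF assms] by blast
  then show ?thesis using orthogonal_transformation_matrix_vector[of f] by (auto simp: O_matrices_def)
qed

lemma O_matrices_flip:
  assumes "(y :: real^'n) \<bullet> w = 0"
  shows "\<exists>A\<in>O_matrices. A *v y = y \<and> A *v w = - w"
proof (cases "w = 0")
  case True
  then show ?thesis by (intro bexI[of _ "mat 1"]) (auto simp: O_matrices_def orthogonal_matrix_def)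
next
  case False
  define e where "e = w /\<^sub>R norm w"
  have e: "norm e = 1" "w = norm w *\<^sub>R e" using False by (auto simp: e_def)
  have ee: "e \<bullet> e = 1" using e by (simp add: dot_square_norm)
  have "e \<bullet> y = 0" using assms by (simp add: e_def inner_commute)
  then have y: "reflection e y = y" by (simp add: reflection_def)
  have "reflection e (norm w *\<^sub>R e) = norm w *\<^sub>R e - (2 * norm w) *\<^sub>R e"
    by (simp only: reflection_def inner_scaleR_right ee mult_1_right)
  also have "\<dots> = (norm w - 2 * norm w) *\<^sub>R e" by (rule scaleR_left_diff_distrib[symmetric])
  also have "norm w - 2 * norm w = - norm w" by simp
  finally have "reflection e (norm w *\<^sub>R e) = - (norm w *\<^sub>R e)" by (simp only: scaleR_minus_left)
  then have "reflection e w = - w" unfolding e(2)[symmetric] .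
  then show ?thesis using y orthogonal_transformation_matrix_vector[OF orthogonal_transformation_reflection[OF e(1)]]
    by (intro bexI[of _ "matrix (reflection e)"]) (auto simp: O_matrices_def)
qed

lemma SO_matrices_transitive:
  assumes "CARD('n) \<ge> 3" "norm (x :: real^'n) = norm y"
  shows "\<exists>A\<in>SO_matrices. A *v x = y"
proof -
  have "2 \<le> CARD('n)" using assms(1) by simp
  then obtain f where "orthogonal_transformation f" "det (matrix f) = 1" "f x = y"
    using rotation_exists[OF _ assms(2)] by blast
  then show ?thesis using orthogonal_transformation_matrix_vector[of f] by (auto simp: SO_matrices_def)
qed

text \<open>For \<open>n \<ge> 3\<close> there is room for a half-turn: it is the square of a quarter-turn, which is a
  product of two reflections, so that its determinant is one.\<close>

lemma SO_matrices_flip: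
  assumes n: "CARD('n) \<ge> 3" and yw: "(y :: real^'n) \<bullet> w = 0"
  shows "\<exists>A\<in>SO_matrices. A *v y = y \<and> A *v w = - w"
proof (cases "w = 0")
  case True
  then show ?thesis by (intro bexI[of _ "mat 1"]) (auto simp: SO_matrices_def orthogonal_matrix_def)
next
  case False
  define e where "e = w /\<^sub>R norm w"
  have e: "norm e = 1" "w = norm w *\<^sub>R e" using False by (auto simp: e_def)
  have ye: "e \<bullet> y = 0" using yw by (simp add: e_def inner_commute)
  \<comment> \<open>The third dimension enters here: y and w span at most a plane, which leaves a
    direction v orthogonal to both.\<close>
  have "dim {y, w} \<le> card {y, w}" by (rule dim_le_card') simp
  also have "\<dots> \<le> 2" by (simp add: card_insert_if)
  finally have "dim {y, w} < DIM(real^'n)" using n by simp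
  then obtain v where v: "v \<noteq> 0" "\<And>x. x \<in> span {y, w} \<Longrightarrow> orthogonal v x"
    using orthogonal_to_subspace_exists by blast
  have vy: "v \<bullet> y = 0" "v \<bullet> w = 0" using v(2)[of y] v(2)[of w] by (auto simp: span_base orthogonal_def)
  define e' where "e' = v /\<^sub>R norm v"
  have e': "norm e' = 1" "e' \<bullet> y = 0" "e' \<bullet> e = 0" using v(1) vy by (auto simp: e'_def e_def)
  \<comment> \<open>The reflection in d exchanges e and - e'. Followed by the reflection in e it
    becomes a quarter-turn of the plane spanned by e and e', and y, orthogonal to this plane, stays
    fixed.\<close>
  define d where "d = (1 / sqrt 2) *\<^sub>R (e + e')"
  have ee: "e \<bullet> e = 1" "e' \<bullet> e' = 1" "e \<bullet> e' = 0" using e(1) e' by (auto simp: dot_square_norm inner_commute)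
  have s2: "(1 / sqrt 2) * (1 / sqrt 2) = (1/2::real)" by simp
  have dd: "d \<bullet> d = 1" by (simp add: d_def inner_add_left inner_add_right ee e'(3))
  then have nd: "norm d = 1" by (simp add: norm_eq_sqrt_inner)
  have rd: "reflection d x = x - (e \<bullet> x + e' \<bullet> x) *\<^sub>R (e + e')" for x
  proof -
    have "2 * (d \<bullet> x) * (1 / sqrt 2) = e \<bullet> x + e' \<bullet> x"
      by (simp add: d_def inner_add_left)
    then show ?thesis by (simp add: reflection_def d_def)
  qed
  define J where "J = reflection e \<circ> reflection d"
  have J: "orthogonal_transformation J"
    unfolding J_def by (intro orthogonal_transformation_compose orthogonal_transformation_reflection e(1) nd)
  have "reflection d y = y" "reflection e y = y" by (simp_all only: rd) (simp_all add: ye e'(2) reflection_def)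
  then have Jy: "J y = y" by (simp add: J_def)
  have "reflection d e = - e'" "reflection d e' = - e" unfolding rd by (simp_all add: ee e'(3))
  moreover have "reflection e (- e') = - e'" "reflection e (- e) = e"
    using scaleR_2[of e] by (simp_all add: reflection_def ee)
  ultimately have Je: "J e = - e'" and Je': "J e' = e" by (simp_all add: J_def)
  have lin: "linear J" using J by (simp add: orthogonal_transformation_def)
  have JJ: "orthogonal_transformation (J \<circ> J)" by (intro orthogonal_transformation_compose J)
  have JJw: "(J \<circ> J) w = - w"
  proof -
    have "(J \<circ> J) w = norm w *\<^sub>R J (J e)" by (subst e(2)) (simp add: linear_scale[OF lin])
    also have "\<dots> = - w" by (simp add: Je linear_neg[OF lin] Je' e(2)[symmetric])
    finally show ?thesis .
  qed
  \<comment> \<open>An orthogonal map has determinant 1 or -1, so its square has determinant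
    1.\<close>
  have "det (matrix (J \<circ> J)) = det (matrix J) * det (matrix J)"
    by (simp add: matrix_compose[OF lin lin] det_mul)
  also have "\<dots> = 1" using det_orthogonal_matrix[OF orthogonal_transformation_matrix_vector(1)[OF J]] by auto
  finally have "matrix (J \<circ> J) \<in> SO_matrices"
    using orthogonal_transformation_matrix_vector(1)[OF JJ] by (simp add: SO_matrices_def)
  then show ?thesis using orthogonal_transformation_matrix_vector(2)[OF JJ] JJw Jy by (intro bexI) auto
qed

theorem theorem5p6:
  fixes z :: "(real^'n \<Rightarrow> ereal) \<Rightarrow> real^'n"
  shows "(top_degree_valuation TYPE('n) z \<longleftrightarrow>
            (\<exists>\<psi>::real^'n \<Rightarrow> real^'n. Cc \<psi> \<and> (\<forall>u\<in>Conv_sc TYPE('n). z u = grad_integral \<psi> u)))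
       \<and> (CARD('n) \<ge> 3 \<longrightarrow> top_degree_valuation TYPE('n) z \<longrightarrow>
            (equivariant SO_matrices (Conv_sc TYPE('n)) z \<longleftrightarrow>
              (\<exists>\<xi>. Cb_pos \<xi> \<and> ((\<lambda>t. \<xi> t * t) \<longlongrightarrow> 0) (at_right 0) \<and>
                   (\<forall>u\<in>Conv_sc TYPE('n). z u = t_op \<xi> u))))
       \<and> (CARD('n) \<in> {1, 2} \<longrightarrow> top_degree_valuation TYPE('n) z \<longrightarrow>
            (equivariant O_matrices (Conv_sc TYPE('n)) z \<longleftrightarrow>
              (\<exists>\<xi>. Cb_pos \<xi> \<and> ((\<lambda>t. \<xi> t * t) \<longlongrightarrow> 0) (at_right 0) \<and>
                   (\<forall>u\<in>Conv_sc TYPE('n). z u = t_op \<xi> u))))"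
proof (intro conjI impI)
  show "top_degree_valuation TYPE('n) z \<longleftrightarrow>
      (\<exists>\<psi>. Cc \<psi> \<and> (\<forall>u\<in>Conv_sc TYPE('n). z u = grad_integral \<psi> u))"
    by (rule top_degree_valuation_iff)
next
  assume "CARD('n) \<ge> 3" "top_degree_valuation TYPE('n) z"
  then show "equivariant SO_matrices (Conv_sc TYPE('n)) z \<longleftrightarrow>
      (\<exists>\<xi>. Cb_pos \<xi> \<and> ((\<lambda>t. \<xi> t * t) \<longlongrightarrow> 0) (at_right 0) \<and> (\<forall>u\<in>Conv_sc TYPE('n). z u = t_op \<xi> u))"
    by (intro equivariant_iff_t_op SO_matrices_transitive SO_matrices_flip)
      (auto simp: SO_matrices_def O_matrices_def)
next
  assume "top_degree_valuation TYPE('n) z"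
  then show "equivariant O_matrices (Conv_sc TYPE('n)) z \<longleftrightarrow>
      (\<exists>\<xi>. Cb_pos \<xi> \<and> ((\<lambda>t. \<xi> t * t) \<longlongrightarrow> 0) (at_right 0) \<and> (\<forall>u\<in>Conv_sc TYPE('n). z u = t_op \<xi> u))"
    by (intro equivariant_iff_t_op O_matrices_transitive O_matrices_flip) auto
qed

end
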